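(* In the setting and notation of the context, the set $\mathbf{CP}$ of continuous polynomials in $\omega$ is dense in $L^2(\tau)$.
   Context: $T$ is a locally compact, second countable Hausdorff space without isolated points; $\mathcal B_0(T)$ is the family of relatively compact Borel sets; $\sigma$ is a Radon non-atomic measure on $T$ with $\sigma(O)>0$ for every non-empty open $O$. $\mathcal D^{(n)}=C_0(T^n)$ (real continuous functions with compact support), $\mathcal D=\mathcal D^{(1)}$. For each $t\in T$, $\mu(t,\cdot)$ is a probability measure on $\mathbb R$; $t\mapsto\mu(t,A)$ is measurable for each Borel $A$; and for each $\Delta\in\mathcal B_0(T)$ there is $R=R(\Delta)>0$ such that $\mu(t,\cdot)$ is supported in $[-R,R]$ for all $t\in\Delta$. Put $\tilde T=T\times\mathbb R$, $\tilde\sigma(dt,ds)=\sigma(dt)\mu(t,ds)$, $\mathcal H=L^2(\tilde T,\tilde\sigma)$ (real), $\mathcal F(\mathcal H)=\mathbb R\oplus\bigoplus_{n\ge1}\mathcal H^{\otimes n}$ the full Fock space with vacuum $\Omega=(1,0,0,\dots)$. Operators on $\mathcal F(\mathcal H)$: $a^+(h)g^{(n)}=h\otimes g^{(n)}$; $a^-(h)g_1\otimes\dots\otimes g_n=(h,g_1)_{\mathcal H}\,g_2\otimes\dots\otimes g_n$; $a^0(h)g_1\otimes\dots\otimes g_n=(hg_1)\otimes g_2\otimes\dots\otimes g_n$; $a^-(h)\Omega=a^0(h)\Omega=0$. For a bounded measurable $h$ on $\tilde T$ supported in $\Delta\times\mathbb R$ with $\Delta\in\mathcal B_0(T)$ ("bounded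 support"), put $x(h)=a^+(h)+a^-(h)+a^0(sh)$, where $(sh)(t,s)=s\,h(t,s)$. $L^2(\tau)$ is the real Hilbert space obtained by completing the set of (non-commutative) polynomials in the operators $x(h)$, $h$ bounded continuous on $\tilde T$ with bounded support, with respect to $\|P\|_{L^2(\tau)}=\|P\Omega\|_{\mathcal F(\mathcal H)}$; the map $I:P\mapsto P\Omega$ extends to a unitary operator $I:L^2(\tau)\to\mathcal F(\mathcal H)$, and the operators $P\in\mathbf{CP}$ below are elements of $L^2(\tau)$ via $I^{-1}(P\Omega)$. For $f\in\mathcal D$, $X(f):=x(f\otimes1)$, $(f\otimes1)(t,s)=f(t)$. For $f^{(n)}\in\mathcal D^{(n)}$ the monomial $\langle f^{(n)},\omega^{\otimes n}\rangle$ is the bounded operator on $\mathcal F(\mathcal H)$ with $\langle f_1\otimes\dots\otimes f_n,\omega^{\otimes n}\rangle=X(f_1)\cdots X(f_n)$, defined in general as follows. Write $z=(t,s)\in\tilde T$ and view $f^{(n)}$ as a function on $\tilde T^n$ not depending on the $s$-variables. For a function $h(z_1,\dots,z_k;y_1,\dots,y_m)$ ($k\ge1$) put $(Ch)(z_1,\dots,z_{k-1};y_1,\dots,y_{m+1})=h(z_1,\dots,z_{k-1},y_1;y_2,\dots,y_{m+1})$, $(Ah)(z_1,\dots,z_{k-1};y_1,\dots,y_{m-1})=\int_{\tilde T}\tilde\sigma(dz)h(z_1,\dots,z_{k-1},z;z,y_1,\dots,y_{m-1})$, $(Nh)(z_1,\dots,z_{k-1};y_1,\dots,y_m)=s(y_1)h(z_1,\dots,z_{k-1},y_1;y_1,\dots,y_m)$,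 where $s(y_1)$ is the $\mathbb R$-coordinate of $y_1$, and $Ah=Nh=0$ if $m=0$. Then $\langle f^{(n)},\omega^{\otimes n}\rangle g^{(m)}=(C+A+N)^n(f^{(n)}\otimes g^{(m)})$, where $(f^{(n)}\otimes g^{(m)})(z;y)=f^{(n)}(z)g^{(m)}(y)$. Constants are monomials of order $0$. $\mathbf{CP}$ is the set of all finite sums of monomials with kernels $f^{(n)}\in\mathcal D^{(n)}$, $n\in\mathbb N_0$. *)

theory Defs
  imports "HOL-Probability.Probability"
begin

section \<open>Measures\<close>

definition relatively_compact_borel :: "'t::topological_space set set" where
  "relatively_compact_borel = {\<Delta> \<in> sets borel. compact (closure \<Delta>)}"

definition radon_measure :: "'t::t2_space measure \<Rightarrow> bool" where
  "radon_measure M \<longleftrightarrow>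
     sets M = sets borel \<and>
     (\<forall>K. compact K \<longrightarrow> emeasure M K < \<infinity>) \<and>
     (\<forall>A \<in> sets borel. emeasure M A = (SUP K \<in> {K. compact K \<and> K \<subseteq> A}. emeasure M K))"

definition non_atomic :: "'t measure \<Rightarrow> bool" where
  "non_atomic M \<longleftrightarrow>
     (\<forall>A \<in> sets M. 0 < emeasure M A \<longrightarrow>
        (\<exists>B \<in> sets M. B \<subseteq> A \<and> 0 < emeasure M B \<and> emeasure M B < emeasure M A))"

text \<open>The measure \<open>\<sigma>(dt) \<mu>(t,ds)\<close>; see \<open>emeasure_kernel_product\<close> below.\<close>

definition kernel_product ::
    "'t::topological_space measure \<Rightarrow> ('t \<Rightarrow> real measure) \<Rightarrow> ('t \<times> real) measure" where
  "kernel_product \<sigma> \<mu> = bind \<sigma> (\<lambda>t. distr (\<mu> t) borel (Pair t))"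

lemma emeasure_kernel_product:
  fixes \<sigma> :: "'t::second_countable_topology measure"
  assumes \<sigma>: "sets \<sigma> = sets borel"
    and \<mu>: "\<And>t. prob_space (\<mu> t)" "\<And>t. sets (\<mu> t) = sets borel"
      "\<And>A. A \<in> sets borel \<Longrightarrow> (\<lambda>t. emeasure (\<mu> t) A) \<in> borel_measurable borel"
    and B: "B \<in> sets borel"
  shows "sets (kernel_product \<sigma> \<mu>) = sets borel"
    and "emeasure (kernel_product \<sigma> \<mu>) B = (\<integral>\<^sup>+ t. emeasure (\<mu> t) {s. (t, s) \<in> B} \<partial>\<sigma>)"
proof -
  have space\<sigma>: "space \<sigma> = UNIV"
    using sets_eq_imp_space_eq[OF \<sigma>] by simp
  have k: "\<mu> \<in> measurable \<sigma> (subprob_algebra borel)"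
    using \<mu> by (intro measurable_subprob_algebra)
      (auto simp: measurable_cong_sets[OF \<sigma> refl] intro: prob_space_imp_subprob_space)
  have m: "(\<lambda>t. distr (\<mu> t) borel (Pair t)) \<in> measurable \<sigma> (subprob_algebra borel)"
  proof (rule measurable_distr2[OF _ k])
    have "sets (\<sigma> \<Otimes>\<^sub>M (borel :: real measure)) = sets (borel :: ('t \<times> real) measure)"
      unfolding borel_prod[symmetric] by (rule sets_pair_measure_cong[OF \<sigma> refl])
    then show "case_prod Pair \<in> measurable (\<sigma> \<Otimes>\<^sub>M (borel :: real measure)) borel"
      by (simp add: measurable_cong_sets[of "\<sigma> \<Otimes>\<^sub>M (borel :: real measure)"])
  qed
  show "sets (kernel_product \<sigma> \<mu>) = sets borel"
    unfolding kernel_product_def using space\<sigma> by (intro sets_bind) auto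
  have P: "Pair t \<in> measurable (\<mu> t) borel" for t
    using \<mu>(2)[of t] by (simp add: measurable_cong_sets[OF \<mu>(2) refl] borel_measurable_Pair)
  have "space (\<mu> t) = UNIV" for t
    using sets_eq_imp_space_eq[OF \<mu>(2)[of t]] by simp
  then have "emeasure (distr (\<mu> t) borel (Pair t)) B = emeasure (\<mu> t) {s. (t, s) \<in> B}" for t
    using B by (simp add: emeasure_distr[OF P] vimage_def)
  then show "emeasure (kernel_product \<sigma> \<mu>) B = (\<integral>\<^sup>+ t. emeasure (\<mu> t) {s. (t, s) \<in> B} \<partial>\<sigma>)"
    unfolding kernel_product_def using space\<sigma> B by (subst emeasure_bind[OF _ m]) auto
qed


section \<open>The full Fock space\<close>

text \<open>
  The \<open>n\<close>-th tensor power of \<open>L\<^sup>2(M)\<close> is realised as \<open>L\<^sup>2\<close> of the \<open>n\<close>-fold product measure, whose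
  points are the functions in \<open>{..<n} \<rightarrow>\<^sub>E UNIV\<close> (the coordinates \<open>y\<^sub>1,\<dots>,y\<^sub>n\<close> are
  \<open>y 0,\<dots>,y (n-1)\<close>); for \<open>n = 0\<close> this is \<open>\<real>\<close>. Vectors are given by representatives: \<open>F n\<close> is the
  \<open>n\<close>-particle component of \<open>F\<close>, and vectors at \<open>fock_norm\<close>-distance 0 are the same vector.
\<close>

type_synonym 'a fock = "nat \<Rightarrow> (nat \<Rightarrow> 'a) \<Rightarrow> real"
type_synonym 'a fock_op = "'a fock \<Rightarrow> 'a fock"

definition tensor_power :: "'a measure \<Rightarrow> nat \<Rightarrow> (nat \<Rightarrow> 'a) measure" where
  "tensor_power M n = PiM {..<n} (\<lambda>_. M)"

definition fock_space :: "'a measure \<Rightarrow> 'a fock set" where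
  "fock_space M = {F.
     (\<forall>n. F n \<in> borel_measurable (tensor_power M n)) \<and>
     (\<forall>n. integrable (tensor_power M n) (\<lambda>y. (F n y)\<^sup>2)) \<and>
     summable (\<lambda>n. \<integral>y. (F n y)\<^sup>2 \<partial>tensor_power M n)}"

definition fock_norm :: "'a measure \<Rightarrow> 'a fock \<Rightarrow> real" where
  "fock_norm M F = sqrt (\<Sum>n. \<integral>y. (F n y)\<^sup>2 \<partial>tensor_power M n)"

definition vacuum :: "'a fock" where
  "vacuum n y = (if n = 0 then 1 else 0)"

text \<open>\<open>vcons n x (y\<^sub>1,\<dots>,y\<^sub>n) = (x,y\<^sub>1,\<dots>,y\<^sub>n)\<close> and \<open>vtail n (y\<^sub>1,\<dots>,y\<^sub>n\<^sub>+\<^sub>1) = (y\<^sub>2,\<dots>,y\<^sub>n\<^sub>+\<^sub>1)\<close>\<close>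

definition vcons :: "nat \<Rightarrow> 'a \<Rightarrow> (nat \<Rightarrow> 'a) \<Rightarrow> nat \<Rightarrow> 'a" where
  "vcons n x y = (\<lambda>i\<in>{..<Suc n}. case i of 0 \<Rightarrow> x | Suc j \<Rightarrow> y j)"

definition vtail :: "nat \<Rightarrow> (nat \<Rightarrow> 'a) \<Rightarrow> nat \<Rightarrow> 'a" where
  "vtail n y = (\<lambda>i\<in>{..<n}. y (Suc i))"

text \<open>
  The operators \<open>a\<^sup>+(h)\<close>, \<open>a\<^sup>-(h)\<close>, \<open>a\<^sup>0(h)\<close>. Their values on elementary tensors are computed in
  \<open>creation_tensor\<close>, \<open>annihilation_tensor\<close> and \<open>neutral_tensor\<close>.
\<close>

definition creation :: "('a \<Rightarrow> real) \<Rightarrow> 'a fock_op" where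
  "creation h F n y = (case n of 0 \<Rightarrow> 0 | Suc m \<Rightarrow> h (y 0) * F m (vtail m y))"

definition annihilation :: "'a measure \<Rightarrow> ('a \<Rightarrow> real) \<Rightarrow> 'a fock_op" where
  "annihilation M h F n y = (\<integral>w. h w * F (Suc n) (vcons n w y) \<partial>M)"

definition neutral :: "('a \<Rightarrow> real) \<Rightarrow> 'a fock_op" where
  "neutral h F n y = (if n = 0 then 0 else h (y 0) * F n y)"

definition elementary_tensor :: "nat \<Rightarrow> (nat \<Rightarrow> 'a \<Rightarrow> real) \<Rightarrow> 'a fock" where
  "elementary_tensor n g m y = (if m = n then \<Prod>i<n. g i (y i) else 0)"

lemma elementary_tensor_0: "elementary_tensor 0 g = vacuum"
  by (intro ext) (simp add: elementary_tensor_def vacuum_def)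

lemma creation_tensor:
  "creation h (elementary_tensor n g) =
   elementary_tensor (Suc n) (\<lambda>i. case i of 0 \<Rightarrow> h | Suc j \<Rightarrow> g j)"
  by (intro ext)
    (auto simp: creation_def elementary_tensor_def vtail_def prod.lessThan_Suc_shift
        split: nat.split simp del: prod.lessThan_Suc)

lemma annihilation_tensor:
  "annihilation M h (elementary_tensor (Suc n) g) m y =
   (\<integral>w. h w * g 0 w \<partial>M) * elementary_tensor n (\<lambda>i. g (Suc i)) m y"
proof (cases "m = n")
  case True
  have "annihilation M h (elementary_tensor (Suc n) g) m y =
      (\<integral>w. (h w * g 0 w) * (\<Prod>i<n. g (Suc i) (y i)) \<partial>M)"
    unfolding annihilation_def using True
    by (intro Bochner_Integration.integral_cong)
      (auto simp: elementary_tensor_def vcons_def prod.lessThan_Suc_shift mult.assoc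
        simp del: prod.lessThan_Suc)
  then show ?thesis
    using True by (simp add: elementary_tensor_def)
qed (simp add: annihilation_def elementary_tensor_def)

lemma neutral_tensor:
  "neutral h (elementary_tensor (Suc n) g) = elementary_tensor (Suc n) (g(0 := \<lambda>z. h z * g 0 z))"
  by (intro ext)
    (auto simp: neutral_def elementary_tensor_def prod.lessThan_Suc_shift mult.assoc
        simp del: prod.lessThan_Suc)

lemma annihilation_vacuum: "annihilation M h vacuum = (\<lambda>_ _. 0)"
  and neutral_vacuum: "neutral h vacuum = (\<lambda>_ _. 0)"
  by (intro ext, simp add: annihilation_def neutral_def vacuum_def)+

definition fock_add :: "'a fock \<Rightarrow> 'a fock \<Rightarrow> 'a fock" where
  "fock_add F G = (\<lambda>n y. F n y + G n y)"

definition fock_scale :: "real \<Rightarrow> 'a fock \<Rightarrow> 'a fock" where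
  "fock_scale c F = (\<lambda>n y. c * F n y)"

definition fock_dist :: "'a measure \<Rightarrow> 'a fock \<Rightarrow> 'a fock \<Rightarrow> real" where
  "fock_dist M F G = fock_norm M (\<lambda>n y. F n y - G n y)"

text \<open>\<open>x(h) = a\<^sup>+(h) + a\<^sup>-(h) + a\<^sup>0(sh)\<close>\<close>

definition field_op :: "('t \<times> real) measure \<Rightarrow> ('t \<times> real \<Rightarrow> real) \<Rightarrow> ('t \<times> real) fock_op" where
  "field_op M h F =
     fock_add (creation h F) (fock_add (annihilation M h F) (neutral (\<lambda>(t, s). s * h (t, s)) F))"


section \<open>The space \<open>L\<^sup>2(\<tau>)\<close>\<close>

definition bounded_support_continuous :: "('t::topological_space \<times> real \<Rightarrow> real) set" where
  "bounded_support_continuous = {h.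
     continuous_on UNIV h \<and> bounded (range h) \<and>
     (\<exists>\<Delta> \<in> relatively_compact_borel. \<forall>t s. t \<notin> \<Delta> \<longrightarrow> h (t, s) = 0)}"

inductive_set field_polynomials ::
    "('t::topological_space \<times> real) measure \<Rightarrow> ('t \<times> real) fock_op set"
  for M :: "('t \<times> real) measure" where
  one: "(\<lambda>F. F) \<in> field_polynomials M"
| gen: "h \<in> bounded_support_continuous \<Longrightarrow> field_op M h \<in> field_polynomials M"
| add: "P \<in> field_polynomials M \<Longrightarrow> Q \<in> field_polynomials M \<Longrightarrow>
          (\<lambda>F. fock_add (P F) (Q F)) \<in> field_polynomials M"
| scale: "P \<in> field_polynomials M \<Longrightarrow> (\<lambda>F. fock_scale c (P F)) \<in> field_polynomials M"
| mult: "P \<in> field_polynomials M \<Longrightarrow> Q \<in> field_polynomials M \<Longrightarrow>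
          (\<lambda>F. P (Q F)) \<in> field_polynomials M"

text \<open>The distance of two polynomials for the norm \<open>\<parallel>P\<parallel> = \<parallel>P \<Omega>\<parallel>\<close>\<close>

definition tau_dist :: "'a measure \<Rightarrow> 'a fock_op \<Rightarrow> 'a fock_op \<Rightarrow> real" where
  "tau_dist M P Q = fock_dist M (P vacuum) (Q vacuum)"

text \<open>The completion: Cauchy sequences of polynomials modulo null sequences\<close>

definition tau_cauchy ::
    "('t::topological_space \<times> real) measure \<Rightarrow> (nat \<Rightarrow> ('t \<times> real) fock_op) set" where
  "tau_cauchy M = {P. (\<forall>n. P n \<in> field_polynomials M) \<and>
     (\<forall>\<epsilon>>0. \<exists>N. \<forall>m\<ge>N. \<forall>n\<ge>N. tau_dist M (P m) (P n) < \<epsilon>)}"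

definition tau_equiv ::
    "('t::topological_space \<times> real) measure \<Rightarrow> (nat \<Rightarrow> ('t \<times> real) fock_op) rel" where
  "tau_equiv M = {(P, Q). P \<in> tau_cauchy M \<and> Q \<in> tau_cauchy M \<and>
     (\<lambda>n. tau_dist M (P n) (Q n)) \<longlonglongrightarrow> 0}"

definition L2_tau ::
    "('t::topological_space \<times> real) measure \<Rightarrow> (nat \<Rightarrow> ('t \<times> real) fock_op) set set" where
  "L2_tau M = tau_cauchy M // tau_equiv M"

definition L2_tau_dist ::
    "'a measure \<Rightarrow> (nat \<Rightarrow> 'a fock_op) set \<Rightarrow> (nat \<Rightarrow> 'a fock_op) set \<Rightarrow> real" where
  "L2_tau_dist M U V =
     (THE r. \<forall>P\<in>U. \<forall>Q\<in>V. (\<lambda>n. tau_dist M (P n) (Q n)) \<longlonglongrightarrow> r)"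

text \<open>
  The extension of \<open>P \<mapsto> P \<Omega>\<close> to \<open>L\<^sup>2(\<tau>)\<close>. Its value is a vector of the Fock space, i.e. the set of
  all representatives of the limit of \<open>P n \<Omega>\<close>, where \<open>P\<close> is any Cauchy sequence in the class \<open>U\<close>.
\<close>

definition L2_tau_to_fock :: "'a measure \<Rightarrow> (nat \<Rightarrow> 'a fock_op) set \<Rightarrow> 'a fock set" where
  "L2_tau_to_fock M U =
     {F \<in> fock_space M. \<forall>P\<in>U. (\<lambda>n. fock_dist M (P n vacuum) F) \<longlonglongrightarrow> 0}"

definition dense_in_L2_tau ::
    "('t::topological_space \<times> real) measure \<Rightarrow> (nat \<Rightarrow> ('t \<times> real) fock_op) set set \<Rightarrow> bool" where
  "dense_in_L2_tau M S \<longleftrightarrow>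
     S \<subseteq> L2_tau M \<and> (\<forall>U \<in> L2_tau M. \<forall>\<epsilon>>0. \<exists>V \<in> S. L2_tau_dist M U V < \<epsilon>)"


section \<open>Continuous polynomials\<close>

text \<open>\<open>C\<^sub>0(T\<^sup>n)\<close>, the continuous functions with compact support\<close>

definition kernels :: "nat \<Rightarrow> ((nat \<Rightarrow> 't::topological_space) \<Rightarrow> real) set" where
  "kernels n = (let X = product_topology (\<lambda>_. euclidean) {..<n} in
     {f. continuous_map X euclideanreal f \<and>
         compactin X (X closure_of {t \<in> topspace X. f t \<noteq> 0})})"

text \<open>
  \<open>h m\<close> is the component with \<open>m\<close> variables \<open>y\<close>. In \<open>op_C k h\<close>, \<open>op_A M k h\<close>, \<open>op_N k h\<close> the
  argument \<open>h\<close> has \<open>k + 1\<close> variables \<open>z\<close>, the last one being \<open>z k\<close>, and the result has \<open>k\<close> of them.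
\<close>

type_synonym 'a graded = "nat \<Rightarrow> (nat \<Rightarrow> 'a) \<Rightarrow> (nat \<Rightarrow> 'a) \<Rightarrow> real"

definition op_C :: "nat \<Rightarrow> 'a graded \<Rightarrow> 'a graded" where
  "op_C k h m z y = (case m of 0 \<Rightarrow> 0 | Suc m' \<Rightarrow> h m' (z(k := y 0)) (vtail m' y))"

definition op_A :: "'a measure \<Rightarrow> nat \<Rightarrow> 'a graded \<Rightarrow> 'a graded" where
  "op_A M k h m z y = (\<integral>w. h (Suc m) (z(k := w)) (vcons m w y) \<partial>M)"

definition op_N :: "nat \<Rightarrow> ('t \<times> real) graded \<Rightarrow> ('t \<times> real) graded" where
  "op_N k h m z y = (if m = 0 then 0 else snd (y 0) * h m (z(k := y 0)) y)"

primrec CAN_power ::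
    "('t \<times> real) measure \<Rightarrow> nat \<Rightarrow> ('t \<times> real) graded \<Rightarrow> ('t \<times> real) graded" where
  "CAN_power M 0 h = h"
| "CAN_power M (Suc k) h =
     CAN_power M k (\<lambda>m z y. op_C k h m z y + op_A M k h m z y + op_N k h m z y)"

text \<open>
  The operator \<open>\<langle>f, \<omega>\<^sup>\<otimes>\<^sup>n\<rangle>\<close>. After \<open>n\<close> steps no \<open>z\<close>-variables are left, and \<open>\<lambda>_. undefined\<close> is the
  only point of \<open>{..<0} \<rightarrow>\<^sub>E UNIV\<close>. For \<open>n = 0\<close> this is multiplication by the constant \<open>f\<close>.
\<close>

definition monomial :: "('t \<times> real) measure \<Rightarrow> nat \<Rightarrow> ((nat \<Rightarrow> 't) \<Rightarrow> real) \<Rightarrow> ('t \<times> real) fock_op" where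
  "monomial M n f F m y =
     CAN_power M n (\<lambda>m z y. f (\<lambda>i\<in>{..<n}. fst (z i)) * F m y) m (\<lambda>_. undefined) y"

definition CP :: "('t::topological_space \<times> real) measure \<Rightarrow> ('t \<times> real) fock_op set" where
  "CP M = {(\<lambda>F m y. \<Sum>i<N. monomial M (n i) (f i) F m y) | (N::nat) n f. \<forall>i<N. f i \<in> kernels (n i)}"

text \<open>\<open>CP\<close> as a subset of \<open>L\<^sup>2(\<tau>)\<close>: the preimages of the vectors \<open>P \<Omega>\<close>, \<open>P \<in> CP\<close>\<close>

definition CP_in_L2_tau ::
    "('t::topological_space \<times> real) measure \<Rightarrow> (nat \<Rightarrow> ('t \<times> real) fock_op) set set" where
  "CP_in_L2_tau M = {U \<in> L2_tau M. \<exists>P \<in> CP M. P vacuum \<in> L2_tau_to_fock M U}"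

text \<open>For \<open>f = f\<^sub>1 \<otimes> \<dots> \<otimes> f\<^sub>n\<close> the monomial is \<open>X(f\<^sub>1) \<cdots> X(f\<^sub>n)\<close>, where \<open>X(f) = x(f \<otimes> 1)\<close>.\<close>

lemma CAN_power_product:
  "CAN_power M n (\<lambda>m z y. (\<Prod>i<n. f i (fst (z i))) * F m y) m z y =
   foldr (\<lambda>i. field_op M (\<lambda>(t, s). f i t)) [0..<n] F m y"
proof (induction n arbitrary: F)
  case (Suc n)
  define h where "h = (\<lambda>m (z::nat \<Rightarrow> 'a \<times> real) (y::nat \<Rightarrow> 'a \<times> real).
    (\<Prod>i<Suc n. f i (fst (z i))) * F m y)"
  have p: "(\<Prod>i<n. f i (fst ((z(n := w)) i))) = (\<Prod>i<n. f i (fst (z i)))"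
    for z :: "nat \<Rightarrow> 'a \<times> real" and w
    by (rule prod.cong) auto
  have A: "op_A M n h m z y =
      (\<Prod>i<n. f i (fst (z i))) * annihilation M (\<lambda>(t, s). f n t) F m y" for m z y
    by (simp add: op_A_def h_def p annihilation_def mult.assoc case_prod_beta
        flip: integral_mult_right_zero)
  have C: "op_C n h m z y = (\<Prod>i<n. f i (fst (z i))) * creation (\<lambda>(t, s). f n t) F m y" for m z y
    by (simp add: op_C_def h_def p creation_def case_prod_beta split: nat.split)
  have N: "op_N n h m z y =
      (\<Prod>i<n. f i (fst (z i))) * neutral (\<lambda>(t, s). s * (case (t, s) of (t, s) \<Rightarrow> f n t)) F m y"
    for m z y
    by (simp add: op_N_def h_def p neutral_def case_prod_beta)
  have "(\<lambda>m z y. op_C n h m z y + op_A M n h m z y + op_N n h m z y) =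
     (\<lambda>m z y. (\<Prod>i<n. f i (fst (z i))) * field_op M (\<lambda>(t, s). f n t) F m y)"
    unfolding A C N field_op_def fock_add_def by (simp only: distrib_left add.assoc)
  then show ?case
    using Suc.IH[of "field_op M (\<lambda>(t, s). f n t) F"] unfolding h_def by simp
qed simp

lemma monomial_product:
  "monomial M n (\<lambda>t. \<Prod>i<n. f i (t i)) =
   foldr (\<lambda>i. field_op M (\<lambda>(t, s). f i t)) [0..<n]"
proof (intro ext)
  fix F m y
  have "(\<Prod>i<n. f i ((\<lambda>i\<in>{..<n}. fst (z i)) i)) = (\<Prod>i<n. f i (fst (z i)))"
    for z :: "nat \<Rightarrow> 'a \<times> real"
    by (rule prod.cong) auto
  then show "monomial M n (\<lambda>t. \<Prod>i<n. f i (t i)) F m y =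
      foldr (\<lambda>i. field_op M (\<lambda>(t, s). f i t)) [0..<n] F m y"
    unfolding monomial_def by (simp only: CAN_power_product)
qed

end

theory Submission
  imports Defs
begin

text \<open>
  The vectors \<open>X(f\<^sub>1) \<cdots> X(f\<^sub>n) \<Omega>\<close>, called words below, come from a product kernel in \<open>CP\<close> and also
  from a polynomial in the operators \<open>x(h)\<close>. It therefore suffices that the closure \<open>K\<close> of their linear span
  contains \<open>P \<Omega>\<close> for every such polynomial \<open>P\<close>, and for this that every \<open>x(h)\<close>, \<open>h\<close> bounded, continuous and
  of bounded support, maps \<open>K\<close> into itself. This is clear when \<open>h\<close> depends on \<open>t\<close> only, because
  \<open>X(f)\<close> is bounded and sends words to words. The task is to produce the dependence on \<open>s\<close>.

  The product \<open>x(h\<^sub>1) x(h\<^sub>2)\<close> depends linearly on the function \<open>h\<^sub>1(z) h\<^sub>2(w)\<close> of two variables, and so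
  extends to kernels \<open>\<psi>(z,w)\<close>. Choose continuous \<open>g\<^sub>i : T \<rightarrow> [0,1]\<close> separating the points of \<open>T\<close>. The function
  \<open>\<phi>\<^sub>n(t,u) = \<Prod>i<n. (1 - (g\<^sub>i(t) - g\<^sub>i(u))\<^sup>2)\<^sup>n\<close> is a finite sum of products of a function of \<open>t\<close> and a function
  of \<open>u\<close>, and it decreases to the indicator function of the diagonal. Since \<open>\<sigma>\<close> has no point masses, the diagonal
  is a null set; hence in the limit only those of the nine terms of \<open>x(h\<^sub>1) x(h\<^sub>2)\<close> survive in which both
  variables are identified. The kernels \<open>\<kappa>(t) \<phi>\<^sub>n(t,u) h(u,s)\<close>, with a cut-off function \<open>\<kappa>\<close>, give
  \<open>(\<integral> h) + x(s h)\<close>. So if \<open>K\<close> is invariant under \<open>x(g h)\<close> for all continuous \<open>g\<close> on \<open>T\<close>, the same is true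
  of \<open>s h\<close> (\<open>stable_symbols_snd\<close>).

  The functions \<open>p\<close> such that multiplication by \<open>p\<close> preserves this property of symbols form an algebra
  containing the functions of \<open>t\<close> and the coordinate \<open>s\<close>. The Stone-Weierstrass theorem and the
  bound of \<open>x(h)\<close> by the size of \<open>h\<close> on its support then give all symbols
  (\<open>approximable_bounded_support_field_op\<close>).

  Vectors are handled through representatives that are dominated at every point by a multiple of
  \<open>\<rho>(y\<^sub>1) \<cdots> \<rho>(y\<^sub>n)\<close> with an integrable \<open>\<rho>\<close>. On these the operators are linear exactly, not only
  up to null sets, and the limits along \<open>\<phi>\<^sub>n\<close> are instances of dominated convergence.
\<close>

section \<open>Functions on the base space\<close>

definition compactly_supported :: "('t::topological_space \<Rightarrow> real) set" where
  "compactly_supported =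
     {f. continuous_on UNIV f \<and> (\<exists>K. compact K \<and> (\<forall>t. t \<notin> K \<longrightarrow> f t = 0))}"

lemma compactly_supported_mult:
  assumes "f \<in> compactly_supported" "continuous_on UNIV g"
  shows "(\<lambda>t. g t * f t) \<in> compactly_supported"
  using assms by (force simp: compactly_supported_def intro!: continuous_intros)

lemma completely_regular_euclidean:
  assumes "locally_compact_space (euclidean :: 't::t2_space topology)"
  shows "completely_regular_space (euclidean :: 't topology)"
proof (rule locally_compact_regular_imp_completely_regular_space[OF assms])
  have "Hausdorff_space (euclidean :: 't topology)"
    unfolding Hausdorff_space_def disjnt_def
    using hausdorff[where 'a='t] by (simp flip: Bex_def)
  then show "Hausdorff_space (euclidean :: 't topology) \<or> regular_space (euclidean :: 't topology)" ..
qed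

lemma compact_cutoff:
  fixes K :: "'t::t2_space set"
  assumes lc: "locally_compact_space (euclidean :: 't topology)" and K: "compact K"
  obtains \<kappa> where "\<kappa> \<in> compactly_supported" "\<And>t. 0 \<le> \<kappa> t" "\<And>t. \<kappa> t \<le> 1"
    "\<And>t. t \<in> K \<Longrightarrow> \<kappa> t = 1"
proof -
  have "\<forall>x::'t. \<exists>U. open U \<and> (\<exists>L. compact L \<and> x \<in> U \<and> U \<subseteq> L)"
    using lc by (simp add: locally_compact_space_def)
  then obtain U L where UL: "\<And>x::'t. open (U x)" "\<And>x. compact (L x)" "\<And>x. x \<in> U x" "\<And>x. U x \<subseteq> L x"
    by metis
  obtain X where X: "finite X" "K \<subseteq> (\<Union>x\<in>X. U x)"
  proof (rule compactE_image[OF K, of K U])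
    show "K \<subseteq> (\<Union>x\<in>K. U x)" using UL(3) by blast
  qed (auto intro: UL that)
  obtain f where f: "continuous_map euclidean (top_of_set {0..1::real}) f"
      "f ` K \<subseteq> {0}" "f ` (- (\<Union>x\<in>X. U x)) \<subseteq> {1}"
  proof (rule Urysohn_completely_regular_closed_compact[of 0 1 euclidean "- (\<Union>x\<in>X. U x)" K])
    show "closedin euclidean (- (\<Union>x\<in>X. U x))" using UL(1) by (auto simp: closed_closedin[symmetric])
  qed (use X K in \<open>auto simp: disjnt_def completely_regular_euclidean[OF lc]\<close>)
  have c: "continuous_on UNIV f" and r: "f t \<in> {0..1}" for t
    using f(1) by (auto simp: continuous_map_in_subtopology)
  show thesis
  proof (rule that[of "\<lambda>t. 1 - f t"])
    have "compact (\<Union>x\<in>X. L x)" using X(1) UL(2) by auto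
    moreover have "1 - f t = 0" if "t \<notin> (\<Union>x\<in>X. L x)" for t
    proof -
      have "t \<in> - (\<Union>x\<in>X. U x)" using that UL(4) by blast
      then show ?thesis using f(3) by auto
    qed
    ultimately show "(\<lambda>t. 1 - f t) \<in> compactly_supported"
      using c by (auto simp: compactly_supported_def intro!: continuous_intros)
  qed (use r f(2) in force)+
qed

text \<open>
  For each continuous \<open>g\<close> the set of pairs with \<open>g t \<noteq> g u\<close> is open, these sets cover the complement of the
  diagonal, and countably many of them suffice because the product space is second countable.
\<close>

lemma countable_separating_family:
  assumes lc: "locally_compact_space (euclidean :: 't::{second_countable_topology,t2_space} topology)"
  obtains g :: "nat \<Rightarrow> 't::{second_countable_topology,t2_space} \<Rightarrow> real" where "\<And>i. continuous_on UNIV (g i)" "\<And>i t. 0 \<le> g i t"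
    "\<And>i t. g i t \<le> 1" "\<And>t u. t \<noteq> u \<Longrightarrow> \<exists>i. g i t \<noteq> g i u"
proof -
  define C where "C = {g :: 't \<Rightarrow> real. continuous_on UNIV g \<and> (\<forall>t. 0 \<le> g t \<and> g t \<le> 1)}"
  define W where "W g = {p :: 't \<times> 't. g (fst p) \<noteq> g (snd p)}" for g :: "'t \<Rightarrow> real"
  have ow: "open (W g)" if "g \<in> C" for g
  proof -
    have "continuous_on UNIV g" using that by (simp add: C_def)
    then have "continuous_on UNIV (\<lambda>p::'t\<times>'t. g (fst p))" "continuous_on UNIV (\<lambda>p::'t\<times>'t. g (snd p))"
      by (auto intro!: continuous_on_compose2[of UNIV g] continuous_intros)
    then show ?thesis unfolding W_def by (rule open_Collect_neq)
  qed
  have sep: "\<exists>g\<in>C. g t \<noteq> g u" if tu: "t \<noteq> u" for t u :: 't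
  proof -
    obtain V where V: "open V" "u \<in> V" "t \<notin> V" using t1_space[of u t] tu by blast
    obtain f where f: "continuous_map euclidean (top_of_set {0..1::real}) f" "f ` {u} \<subseteq> {0}" "f ` (- V) \<subseteq> {1}"
    proof (rule Urysohn_completely_regular_closed_compact[of 0 1 euclidean "- V" "{u}"])
      show "completely_regular_space (euclidean :: 't topology)"
        using lc by (rule completely_regular_euclidean)
    qed (use V in auto)
    have "f \<in> C" using f(1) by (auto simp: C_def continuous_map_in_subtopology)
    moreover have "f t \<noteq> f u" using f V by auto
    ultimately show ?thesis by blast
  qed
  obtain \<F> where \<F>: "\<F> \<subseteq> W ` C" "countable \<F>" "\<Union>\<F> = \<Union>(W ` C)"
    using Lindelof[of "W ` C"] ow by blast
  then obtain C' where C': "C' \<subseteq> C" "countable C'" "\<F> = W ` C'"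
    by (metis countable_subset_image)
  define D where "D = insert (\<lambda>_. 0) C'"
  have D: "D \<subseteq> C" "countable D" "D \<noteq> {}" using C' by (auto simp: D_def C_def)
  define g where "g = from_nat_into D"
  have gC: "g i \<in> C" for i using D from_nat_into[of D i] by (auto simp: g_def)
  show thesis
  proof (rule that[of g])
    fix t u :: 't assume "t \<noteq> u"
    then obtain h where "h \<in> C" "h t \<noteq> h u" using sep by blast
    then have "(t,u) \<in> \<Union>\<F>" using \<F>(3) by (auto simp: W_def)
    then obtain h where h: "h \<in> C'" "h t \<noteq> h u" using C'(3) by (auto simp: W_def)
    then have "h \<in> range g" using D(2,3) by (auto simp: g_def D_def range_from_nat_into)
    then show "\<exists>i. g i t \<noteq> g i u" using h(2) by auto
  qed (use gC in \<open>auto simp: C_def\<close>)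
qed

section \<open>Splitting off the first coordinate\<close>

lemma space_tensor_power: "space (tensor_power M n) = ({..<n} \<rightarrow>\<^sub>E space M)"
  by (simp add: tensor_power_def space_PiM)

lemma measurable_coordinate:
  "i < n \<Longrightarrow> (\<lambda>y. y i) \<in> measurable (tensor_power M n) M"
  unfolding tensor_power_def by (rule measurable_component_singleton) simp

lemma measurable_vcons:
  assumes [measurable]: "f \<in> measurable N M" and g: "g \<in> measurable N (tensor_power M n)"
  shows "(\<lambda>x. vcons n (f x) (g x)) \<in> measurable N (tensor_power M (Suc n))"
  unfolding tensor_power_def vcons_def
proof (rule measurable_restrict)
  fix i assume i: "i \<in> {..<Suc n}"
  show "(\<lambda>x. case i of 0 \<Rightarrow> f x | Suc j \<Rightarrow> g x j) \<in> measurable N M"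
  proof (cases i)
    case (Suc j)
    then show ?thesis using i measurable_compose[OF g measurable_coordinate[of j n M]] by simp
  qed simp
qed

lemma measurable_vtail:
  "vtail n \<in> measurable (tensor_power M (Suc n)) (tensor_power M n)"
  unfolding tensor_power_def vtail_def[abs_def]
  by (intro measurable_restrict measurable_component_singleton) auto

lemma vcons_0 [simp]: "vcons n w y 0 = w"
  and vcons_Suc [simp]: "i < n \<Longrightarrow> vcons n w y (Suc i) = y i"
  by (auto simp: vcons_def)

lemma vtail_vcons: "y \<in> space (tensor_power M n) \<Longrightarrow> vtail n (vcons n w y) = y"
  by (auto simp: vtail_def vcons_def space_tensor_power PiE_def extensional_def fun_eq_iff)

text \<open>
  All operators act on the first coordinate. This identity reduces integrals and null sets of the \<open>(n+1)\<close>-fold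
  product to the first coordinate and the remaining \<open>n\<close>.
\<close>

lemma (in sigma_finite_measure) distr_vcons:
  "distr (M \<Otimes>\<^sub>M tensor_power M n) (tensor_power M (Suc n)) (\<lambda>p. vcons n (fst p) (snd p)) = tensor_power M (Suc n)"
proof -
  interpret product_sigma_finite "\<lambda>_::nat. M" by standard
  interpret P: sigma_finite_measure "tensor_power M n"
    unfolding tensor_power_def by (rule sigma_finite) simp
  show ?thesis
    unfolding tensor_power_def[of M "Suc n"]
  proof (rule PiM_eqI)
    fix A :: "nat \<Rightarrow> 'a set" assume A: "\<And>i. i \<in> {..<Suc n} \<Longrightarrow> A i \<in> sets M"
    let ?B = "Pi\<^sub>E {..<n} (\<lambda>i. A (Suc i))"
    have split: "(\<forall>i\<in>{..<Suc n}. Q i) \<longleftrightarrow> Q 0 \<and> (\<forall>i\<in>{..<n}. Q (Suc i))" for Q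
      by (auto simp: less_Suc_eq_0_disj)
    have v: "vcons n w y \<in> Pi\<^sub>E {..<Suc n} A \<longleftrightarrow> w \<in> A 0 \<and> (\<forall>i\<in>{..<n}. y i \<in> A (Suc i))" for w y
      unfolding PiE_iff split by (auto simp: vcons_def)
    have A0: "A 0 \<in> sets M" and AS: "i < n \<Longrightarrow> A (Suc i) \<in> sets M" for i
      using A by auto
    have B: "?B \<in> sets (tensor_power M n)"
      unfolding tensor_power_def using AS by (intro sets_PiM_I_finite) auto
    have e: "(\<lambda>p. vcons n (fst p) (snd p)) -` Pi\<^sub>E {..<Suc n} A \<inter> space (M \<Otimes>\<^sub>M tensor_power M n) = A 0 \<times> ?B"
      using sets.sets_into_space[OF A0] sets.sets_into_space[OF B]
      by (auto simp: space_pair_measure space_tensor_power v)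
    have "emeasure (M \<Otimes>\<^sub>M tensor_power M n) (A 0 \<times> ?B) = emeasure M (A 0) * emeasure (tensor_power M n) ?B"
      by (rule P.emeasure_pair_measure_Times[OF A0 B])
    also have "emeasure (tensor_power M n) ?B = (\<Prod>i<n. emeasure M (A (Suc i)))"
      unfolding tensor_power_def using AS by (intro emeasure_PiM) auto
    finally have "emeasure (M \<Otimes>\<^sub>M tensor_power M n) (A 0 \<times> ?B) = (\<Prod>i<Suc n. emeasure M (A i))"
      unfolding prod.lessThan_Suc_shift .
    moreover have "Pi\<^sub>E {..<Suc n} A \<in> sets (tensor_power M (Suc n))"
      unfolding tensor_power_def using A by (intro sets_PiM_I_finite) auto
    then have "emeasure (distr (M \<Otimes>\<^sub>M tensor_power M n) (tensor_power M (Suc n)) (\<lambda>p. vcons n (fst p) (snd p)))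
        (Pi\<^sub>E {..<Suc n} A) = emeasure (M \<Otimes>\<^sub>M tensor_power M n) (A 0 \<times> ?B)"
      unfolding e[symmetric] by (intro emeasure_distr measurable_vcons measurable_fst measurable_snd)
    ultimately show "emeasure (distr (M \<Otimes>\<^sub>M tensor_power M n) (PiM {..<Suc n} (\<lambda>_. M))
        (\<lambda>p. vcons n (fst p) (snd p))) (Pi\<^sub>E {..<Suc n} A) = (\<Prod>i\<in>{..<Suc n}. emeasure M (A i))"
      by (simp add: tensor_power_def)
  qed auto
qed

lemma (in sigma_finite_measure) sigma_finite_tensor_power: "sigma_finite_measure (tensor_power M n)"
proof -
  interpret product_sigma_finite "\<lambda>_::nat. M" by standard
  show ?thesis unfolding tensor_power_def by (rule sigma_finite) simp
qed

lemma (in sigma_finite_measure) nn_integral_tensor_power_Suc: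
  assumes f: "f \<in> borel_measurable (tensor_power M (Suc n))"
  shows "(\<integral>\<^sup>+y. f y \<partial>tensor_power M (Suc n)) = (\<integral>\<^sup>+w. \<integral>\<^sup>+y. f (vcons n w y) \<partial>tensor_power M n \<partial>M)"
proof -
  interpret P: sigma_finite_measure "tensor_power M n" by (rule sigma_finite_tensor_power)
  have v: "(\<lambda>p. vcons n (fst p) (snd p)) \<in> measurable (M \<Otimes>\<^sub>M tensor_power M n) (tensor_power M (Suc n))"
    by (intro measurable_vcons measurable_fst measurable_snd)
  have "(\<integral>\<^sup>+y. f y \<partial>tensor_power M (Suc n)) = (\<integral>\<^sup>+p. f (vcons n (fst p) (snd p)) \<partial>(M \<Otimes>\<^sub>M tensor_power M n))"
    using nn_integral_distr[OF v, of f] f by (simp add: distr_vcons)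
  also have "\<dots> = (\<integral>\<^sup>+w. \<integral>\<^sup>+y. f (vcons n w y) \<partial>tensor_power M n \<partial>M)"
    using P.nn_integral_fst[OF measurable_compose[OF v f]] by simp
  finally show ?thesis .
qed

lemma (in sigma_finite_measure) AE_tensor_power_SucI:
  assumes m: "{y \<in> space (tensor_power M (Suc n)). P y} \<in> sets (tensor_power M (Suc n))"
    and ae: "AE w in M. AE y in tensor_power M n. P (vcons n w y)"
  shows "AE y in tensor_power M (Suc n). P y"
proof -
  note distr = distr_vcons[of n]
  interpret P: sigma_finite_measure "tensor_power M n" by (rule sigma_finite_tensor_power)
  interpret pair_sigma_finite M "tensor_power M n" by standard
  have v: "(\<lambda>p. vcons n (fst p) (snd p)) \<in> measurable (M \<Otimes>\<^sub>M tensor_power M n) (tensor_power M (Suc n))"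
    by (intro measurable_vcons measurable_fst measurable_snd)
  have "{p \<in> space (M \<Otimes>\<^sub>M tensor_power M n). P (vcons n (fst p) (snd p))} =
      (\<lambda>p. vcons n (fst p) (snd p)) -` {y \<in> space (tensor_power M (Suc n)). P y} \<inter> space (M \<Otimes>\<^sub>M tensor_power M n)"
    using measurable_space[OF v] by blast
  then have "{p \<in> space (M \<Otimes>\<^sub>M tensor_power M n). P (vcons n (fst p) (snd p))} \<in> sets (M \<Otimes>\<^sub>M tensor_power M n)"
    using measurable_sets[OF v m] by simp
  then have "AE p in M \<Otimes>\<^sub>M tensor_power M n. P (vcons n (fst p) (snd p))"
    using ae by (intro AE_pair_measure) simp_all
  then have "AE y in distr (M \<Otimes>\<^sub>M tensor_power M n) (tensor_power M (Suc n)) (\<lambda>p. vcons n (fst p) (snd p)). P y"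
    using AE_distr_iff[OF v m] by blast
  moreover have "distr (M \<Otimes>\<^sub>M tensor_power M n) (tensor_power M (Suc n)) (\<lambda>p. vcons n (fst p) (snd p))
      = tensor_power M (Suc n)"
    by (rule distr)
  ultimately show ?thesis by (rule back_subst[where P="\<lambda>N. AE y in N. P y"])
qed

section \<open>The square norm of Fock vectors\<close>

text \<open>
  The square of \<open>fock_norm\<close> with values in \<open>[0,\<infinity>]\<close>: sums and iterated integrals can be manipulated
  without integrability conditions. The two agree on tame vectors (\<open>tame_vectors_sqnorm\<close>).
\<close>

definition sqnorm :: "'a measure \<Rightarrow> 'a fock \<Rightarrow> ennreal" where
  "sqnorm M F = (\<Sum>m. \<integral>\<^sup>+y. ennreal ((F m y)\<^sup>2) \<partial>tensor_power M m)"

definition fock_measurable :: "'a measure \<Rightarrow> 'a fock \<Rightarrow> bool" where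
  "fock_measurable M F \<longleftrightarrow> (\<forall>m. F m \<in> borel_measurable (tensor_power M m))"

lemma fock_measurable_add:
  assumes "fock_measurable M F" "fock_measurable M G"
  shows "fock_measurable M (\<lambda>m y. F m y + G m y)"
  unfolding fock_measurable_def
  by (intro allI borel_measurable_add) (use assms in \<open>auto simp: fock_measurable_def\<close>)

lemma fock_measurable_scale:
  assumes "fock_measurable M F"
  shows "fock_measurable M (\<lambda>m y. c * F m y)"
  unfolding fock_measurable_def
  by (intro allI borel_measurable_times) (use assms in \<open>auto simp: fock_measurable_def\<close>)

text \<open>
  With \<open>t = 1\<close> this gives a crude triangle inequality, sufficient for density arguments; minimising over
  \<open>t\<close> gives the Minkowski inequality (\<open>fock_norm_triangle\<close>).
\<close>

lemma weighted_square_add: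
  fixes a b t :: real
  assumes "t > 0"
  shows "(a + b)\<^sup>2 \<le> (1 + t) * a\<^sup>2 + (1 + 1 / t) * b\<^sup>2"
proof -
  have "0 \<le> (t * a - b)\<^sup>2 / t" using assms by simp
  then show ?thesis using assms by (simp add: power2_eq_square field_simps)
qed

lemma sqnorm_add_weighted:
  assumes F: "fock_measurable M F" and G: "fock_measurable M G" and t: "t > 0"
  shows "sqnorm M (\<lambda>m y. F m y + G m y) \<le> ennreal (1 + t) * sqnorm M F + ennreal (1 + 1 / t) * sqnorm M G"
proof -
  have [measurable]: "F m \<in> borel_measurable (tensor_power M m)" "G m \<in> borel_measurable (tensor_power M m)" for m
    using F G by (auto simp: fock_measurable_def)
  have "sqnorm M (\<lambda>m y. F m y + G m y) \<le> (\<Sum>m. \<integral>\<^sup>+y. (ennreal (1 + t) * ennreal ((F m y)\<^sup>2)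
      + ennreal (1 + 1 / t) * ennreal ((G m y)\<^sup>2)) \<partial>tensor_power M m)"
    unfolding sqnorm_def
  proof (intro suminf_le nn_integral_mono summableI)
    fix m y
    show "ennreal ((F m y + G m y)\<^sup>2) \<le> ennreal (1 + t) * ennreal ((F m y)\<^sup>2) + ennreal (1 + 1 / t) * ennreal ((G m y)\<^sup>2)"
      using weighted_square_add[OF t, of "F m y" "G m y"] t
      by (simp add: ennreal_mult[symmetric] ennreal_plus[symmetric] ennreal_leI del: ennreal_plus)
  qed
  also have "\<dots> = (\<Sum>m. ennreal (1 + t) * (\<integral>\<^sup>+y. ennreal ((F m y)\<^sup>2) \<partial>tensor_power M m)
      + ennreal (1 + 1 / t) * (\<integral>\<^sup>+y. ennreal ((G m y)\<^sup>2) \<partial>tensor_power M m))"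
    by (simp add: nn_integral_add nn_integral_cmult)
  also have "\<dots> = ennreal (1 + t) * sqnorm M F + ennreal (1 + 1 / t) * sqnorm M G"
    unfolding sqnorm_def by (subst suminf_add[symmetric]) (auto simp: ennreal_suminf_cmult)
  finally show ?thesis .
qed

lemma sqnorm_add:
  assumes "fock_measurable M F" "fock_measurable M G"
  shows "sqnorm M (\<lambda>m y. F m y + G m y) \<le> 2 * sqnorm M F + 2 * sqnorm M G"
  using sqnorm_add_weighted[OF assms zero_less_one] by simp

lemma sqnorm_scale:
  assumes "fock_measurable M F"
  shows "sqnorm M (\<lambda>m y. c * F m y) = ennreal (c\<^sup>2) * sqnorm M F"
proof -
  have [measurable]: "F m \<in> borel_measurable (tensor_power M m)" for m
    using assms by (simp add: fock_measurable_def)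
  have "(\<integral>\<^sup>+y. ennreal ((c * F m y)\<^sup>2) \<partial>tensor_power M m)
      = ennreal (c\<^sup>2) * (\<integral>\<^sup>+y. ennreal ((F m y)\<^sup>2) \<partial>tensor_power M m)" for m
    by (simp add: power_mult_distrib ennreal_mult flip: nn_integral_cmult)
  then show ?thesis by (simp add: sqnorm_def)
qed

section \<open>The combined creation, annihilation and neutral operator\<close>

text \<open>
  The sum of the three elementary operations, applied to a vector that may itself depend on the variable that
  is created, integrated out or identified. With this dependence, a product of two field operators is
  one application nested in another, and its symbol may be any function of two variables.
\<close>

definition can_op :: "('t \<times> real) measure \<Rightarrow> ('t \<times> real \<Rightarrow> ('t \<times> real) fock) \<Rightarrow> ('t \<times> real) fock" where
  "can_op M G m y =
     (case m of 0 \<Rightarrow> 0 | Suc k \<Rightarrow> G (y 0) k (vtail k y))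
     + (\<integral>w. G w (Suc m) (vcons m w y) \<partial>M)
     + (if m = 0 then 0 else snd (y 0) * G (y 0) m y)"

lemma field_op_eq_can_op: "field_op M h F = can_op M (\<lambda>z m y. h z * F m y)"
  by (intro ext) (auto simp: field_op_def fock_add_def creation_def annihilation_def neutral_def
      can_op_def case_prod_beta split: nat.split)

lemma measurable_can_op:
  fixes M :: "('t::second_countable_topology \<times> real) measure"
  assumes sM: "sigma_finite_measure M" and sets_M: "sets M = sets borel"
    and G: "\<And>m. (\<lambda>(x, z, y). G x z m y) \<in> borel_measurable (N \<Otimes>\<^sub>M (M \<Otimes>\<^sub>M tensor_power M m))"
  shows "(\<lambda>(x, y). can_op M (G x) m y) \<in> borel_measurable (N \<Otimes>\<^sub>M tensor_power M m)"
proof -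
  interpret sigma_finite_measure M by fact
  have [measurable_cong]: "sets M = sets (borel \<Otimes>\<^sub>M borel)" unfolding sets_M borel_prod[symmetric] ..
  have G': "(\<lambda>p. G (a p) (b p) k (c p)) \<in> borel_measurable L"
    if "a \<in> measurable L N" "b \<in> measurable L M" "c \<in> measurable L (tensor_power M k)" for L a b c k
    using measurable_compose[OF measurable_Pair[OF that(1) measurable_Pair[OF that(2,3)]] G[of k]] by simp
  have A: "(\<lambda>(x, y). \<integral>w. G x w (Suc m) (vcons m w y) \<partial>M) \<in> borel_measurable (N \<Otimes>\<^sub>M tensor_power M m)"
  proof -
    have "(\<lambda>(p, w). G (fst p) w (Suc m) (vcons m w (snd p))) \<in> borel_measurable ((N \<Otimes>\<^sub>M tensor_power M m) \<Otimes>\<^sub>M M)"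
      unfolding case_prod_beta'
      by (rule G') (auto intro!: measurable_vcons)
    then show ?thesis
      using borel_measurable_lebesgue_integral by (simp add: case_prod_beta')
  qed
  show ?thesis
  proof (cases m)
    case 0
    then show ?thesis using A by (simp add: can_op_def)
  next
    case (Suc k)
    have y0: "(\<lambda>p. snd p 0) \<in> measurable (N \<Otimes>\<^sub>M tensor_power M m) M"
      using Suc by (intro measurable_compose[OF measurable_snd measurable_coordinate]) simp
    have t: "(\<lambda>p. vtail k (snd p)) \<in> measurable (N \<Otimes>\<^sub>M tensor_power M m) (tensor_power M k)"
      using Suc measurable_compose[OF measurable_snd measurable_vtail] by simp
    have "snd \<in> borel_measurable M" by measurable
    then have "(\<lambda>p. snd (snd p 0)) \<in> borel_measurable (N \<Otimes>\<^sub>M tensor_power M m)"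
      by (rule measurable_compose[OF y0])
    moreover have "(\<lambda>p. G (fst p) (snd p 0) m (snd p)) \<in> borel_measurable (N \<Otimes>\<^sub>M tensor_power M m)"
      by (intro G' y0) simp_all
    moreover have "(\<lambda>p. G (fst p) (snd p 0) k (vtail k (snd p))) \<in> borel_measurable (N \<Otimes>\<^sub>M tensor_power M m)"
      by (intro G' y0 t) simp_all
    ultimately show ?thesis
      using A Suc by (simp add: can_op_def case_prod_beta')
  qed
qed

section \<open>Tame functions and tame vectors\<close>

definition fock_family_measurable :: "'a measure \<Rightarrow> ('a \<Rightarrow> 'a fock) \<Rightarrow> bool" where
  "fock_family_measurable M G \<longleftrightarrow>
     (\<forall>m. (\<lambda>p. G (fst p) m (snd p)) \<in> borel_measurable (M \<Otimes>\<^sub>M tensor_power M m))"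

text \<open>
  Domination at every point by a product. It makes the integrals of the annihilation part converge
  absolutely at every point and supplies the bounds for dominated convergence.
\<close>

definition fock_family_dominated :: "('a \<Rightarrow> real) \<Rightarrow> ('a \<Rightarrow> real) \<Rightarrow> ('a \<Rightarrow> 'a fock) \<Rightarrow> bool" where
  "fock_family_dominated \<alpha> \<rho> G \<longleftrightarrow> (\<forall>z m y. \<bar>G z m y\<bar> \<le> \<alpha> z * (\<Prod>i<m. \<rho> (y i)))"

lemma fock_family_measurable_mult:
  assumes h: "h \<in> borel_measurable M" and F: "fock_measurable M F"
  shows "fock_family_measurable M (\<lambda>z m y. h z * F m y)"
  unfolding fock_family_measurable_def
proof
  fix m
  have "(\<lambda>p. F m (snd p)) \<in> borel_measurable (M \<Otimes>\<^sub>M tensor_power M m)"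
    using F by (auto simp: fock_measurable_def intro: measurable_compose[OF measurable_snd])
  moreover have "(\<lambda>p. h (fst p)) \<in> borel_measurable (M \<Otimes>\<^sub>M tensor_power M m)"
    by (rule measurable_compose[OF measurable_fst h])
  ultimately show "(\<lambda>p. h (fst p) * F m (snd p)) \<in> borel_measurable (M \<Otimes>\<^sub>M tensor_power M m)"
    by simp
qed

text \<open>
  The properties of \<open>\<sigma>(dt) \<mu>(t,ds)\<close> from which the density follows. That fibres over points are null sets is
  the form in which non-atomicity enters.
\<close>

locale fibred_measure =
  fixes M :: "('t::{second_countable_topology,t2_space} \<times> real) measure"
  assumes locally_compact: "locally_compact_space (euclidean :: 't topology)"
    and sets_M: "sets M = sets borel"
    and finite_over_compact: "compact K \<Longrightarrow> emeasure M (K \<times> UNIV) < \<infinity>"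
    and bounded_over_compact: "compact K \<Longrightarrow> \<exists>R. AE z in M. fst z \<in> K \<longrightarrow> \<bar>snd z\<bar> \<le> R"
    and null_fibre: "AE z in M. fst z \<noteq> t"
begin

lemma space_M: "space M = UNIV"
  using sets_eq_imp_space_eq[OF sets_M] by simp

lemma measurable_M: "measurable M N = measurable borel N"
  by (rule measurable_cong_sets[OF sets_M refl])

lemma closed_cylinder_sets: "closed K \<Longrightarrow> K \<times> UNIV \<in> sets M"
  unfolding sets_M by (intro borel_closed closed_Times) auto

lemma sigma_finite_M: "sigma_finite_measure M"
proof
  have "\<forall>x::'t. \<exists>U. open U \<and> (\<exists>L. compact L \<and> x \<in> U \<and> U \<subseteq> L)"
    using locally_compact by (simp add: locally_compact_space_def)
  then obtain U L where UL: "\<And>x::'t. open (U x)" "\<And>x. compact (L x)" "\<And>x. x \<in> U x" "\<And>x. U x \<subseteq> L x"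
    by metis
  obtain \<F> where \<F>: "\<F> \<subseteq> range U" "countable \<F>" "\<Union>\<F> = \<Union>(range U)"
    using Lindelof[of "range U"] UL(1) by blast
  then obtain X where X: "countable X" "\<F> = U ` X"
    by (metis countable_subset_image)
  let ?A = "(\<lambda>x. L x \<times> (UNIV :: real set)) ` X"
  have "\<Union>?A = UNIV"
  proof -
    have "t \<in> (\<Union>x\<in>X. L x)" for t using \<F>(3) X(2) UL(3)[of t] UL(4) by blast
    then show ?thesis by auto
  qed
  moreover have "emeasure M a \<noteq> \<infinity>" if "a \<in> ?A" for a
    using that finite_over_compact[OF UL(2)] by (auto simp: less_top)
  moreover have "?A \<subseteq> sets M"
    using UL(2) by (auto intro: closed_cylinder_sets compact_imp_closed)
  ultimately show "\<exists>A. countable A \<and> A \<subseteq> sets M \<and> \<Union>A = space M \<and> (\<forall>a\<in>A. emeasure M a \<noteq> \<infinity>)"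
    using X(1) space_M by (intro exI[of _ ?A]) auto
qed

end

sublocale fibred_measure \<subseteq> sigma_finite_measure M
  by (rule sigma_finite_M)

context fibred_measure
begin

text \<open>
  Symbols and weights. They vanish off a compact set of base points at every point, but are bounded only almost
  everywhere, so that multiplication by the unbounded coordinate \<open>s\<close> stays inside the class.
\<close>

definition tame :: "('t \<times> real \<Rightarrow> real) set" where
  "tame = {h. h \<in> borel_measurable M \<and>
     (\<exists>K B. compact K \<and> (\<forall>z. fst z \<notin> K \<longrightarrow> h z = 0) \<and> (AE z in M. \<bar>h z\<bar> \<le> B))}"

lemma tameI:
  assumes "h \<in> borel_measurable M" "compact K" "\<And>z. fst z \<notin> K \<Longrightarrow> h z = 0" "AE z in M. \<bar>h z\<bar> \<le> B"
  shows "h \<in> tame"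
  using assms unfolding tame_def by blast

lemma tameE:
  assumes "h \<in> tame"
  obtains K B where "compact K" "\<And>z. fst z \<notin> K \<Longrightarrow> h z = 0" "AE z in M. \<bar>h z\<bar> \<le> B" "0 \<le> B"
proof -
  obtain K B where *: "compact K" "\<And>z. fst z \<notin> K \<Longrightarrow> h z = 0" "AE z in M. \<bar>h z\<bar> \<le> B"
    using assms unfolding tame_def by blast
  have "AE z in M. \<bar>h z\<bar> \<le> \<bar>B\<bar>" using *(3) by eventually_elim auto
  then show thesis using that[of K "\<bar>B\<bar>"] *(1,2) by simp
qed

lemma tame_measurable: "h \<in> tame \<Longrightarrow> h \<in> borel_measurable M"
  by (simp add: tame_def)

lemma tame_le:
  assumes k: "k \<in> tame" and h: "h \<in> borel_measurable M" and le: "\<And>z. \<bar>h z\<bar> \<le> \<bar>k z\<bar>"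
  shows "h \<in> tame"
proof -
  obtain K B where *: "compact K" "\<And>z. fst z \<notin> K \<Longrightarrow> k z = 0" "AE z in M. \<bar>k z\<bar> \<le> B" "0 \<le> B"
    using tameE[OF k] by metis
  show ?thesis
  proof (rule tameI[OF h *(1)])
    show "fst z \<notin> K \<Longrightarrow> h z = 0" for z using le[of z] *(2)[of z] by simp
    show "AE z in M. \<bar>h z\<bar> \<le> B" using *(3) by eventually_elim (use le order_trans in blast)
  qed
qed

lemma tame_abs:
  assumes "h \<in> tame"
  shows "(\<lambda>z. \<bar>h z\<bar>) \<in> tame"
proof (rule tame_le[OF assms])
  have [measurable]: "h \<in> borel_measurable M" by (rule tame_measurable[OF assms])
  show "(\<lambda>z. \<bar>h z\<bar>) \<in> borel_measurable M" by measurable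
qed simp

lemma tame_add:
  assumes h: "h \<in> tame" and k: "k \<in> tame"
  shows "(\<lambda>z. h z + k z) \<in> tame"
proof -
  obtain K B where K: "compact K" "\<And>z. fst z \<notin> K \<Longrightarrow> h z = 0" "AE z in M. \<bar>h z\<bar> \<le> B" "0 \<le> B"
    using tameE[OF h] by metis
  obtain L C where L: "compact L" "\<And>z. fst z \<notin> L \<Longrightarrow> k z = 0" "AE z in M. \<bar>k z\<bar> \<le> C" "0 \<le> C"
    using tameE[OF k] by metis
  show ?thesis
  proof (rule tameI)
    show "(\<lambda>z. h z + k z) \<in> borel_measurable M"
      using tame_measurable[OF h] tame_measurable[OF k] by simp
    show "compact (K \<union> L)" using K L by (simp add: compact_Un)
    show "AE z in M. \<bar>h z + k z\<bar> \<le> B + C" using K(3) L(3) by eventually_elim auto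
  qed (use K L in auto)
qed

lemma tame_mult_locally_bounded:
  assumes p: "p \<in> borel_measurable M" and h: "h \<in> tame"
    and b: "\<And>K. compact K \<Longrightarrow> \<exists>C. AE z in M. fst z \<in> K \<longrightarrow> \<bar>p z\<bar> \<le> C"
  shows "(\<lambda>z. p z * h z) \<in> tame"
proof -
  obtain K B where K: "compact K" "\<And>z. fst z \<notin> K \<Longrightarrow> h z = 0" "AE z in M. \<bar>h z\<bar> \<le> B" "0 \<le> B"
    using tameE[OF h] by metis
  obtain C where C: "AE z in M. fst z \<in> K \<longrightarrow> \<bar>p z\<bar> \<le> C" using b[OF K(1)] by blast
  show ?thesis
  proof (rule tameI[OF _ K(1)])
    show "(\<lambda>z. p z * h z) \<in> borel_measurable M" using p tame_measurable[OF h] by simp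
    show "AE z in M. \<bar>p z * h z\<bar> \<le> \<bar>C\<bar> * B"
      using C K(3)
    proof eventually_elim
      case (elim z)
      show ?case
      proof (cases "fst z \<in> K")
        case True
        then have "\<bar>p z\<bar> \<le> \<bar>C\<bar>" using elim(1) by linarith
        then show ?thesis using elim(2) unfolding abs_mult by (intro mult_mono) auto
      qed (use K(2,4) in auto)
    qed
  qed (use K(2) in auto)
qed

lemma tame_mult:
  assumes h: "h \<in> tame" and k: "k \<in> tame"
  shows "(\<lambda>z. h z * k z) \<in> tame"
proof (rule tame_mult_locally_bounded[OF tame_measurable[OF h] k])
  obtain B where "AE z in M. \<bar>h z\<bar> \<le> B" using tameE[OF h] by metis
  then show "\<exists>C. AE z in M. fst z \<in> K \<longrightarrow> \<bar>h z\<bar> \<le> C" for K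
    by (intro exI[of _ B]) auto
qed

text \<open>
  Over a compact \<open>K\<close> almost every point lies in some \<open>K \<times> [-R,R]\<close>, where a continuous function is bounded.
\<close>

lemma tame_mult_continuous:
  assumes p: "continuous_on UNIV p" and h: "h \<in> tame"
  shows "(\<lambda>z. p z * h z) \<in> tame"
proof (rule tame_mult_locally_bounded[OF _ h])
  show "p \<in> borel_measurable M"
    unfolding measurable_M using p by (rule borel_measurable_continuous_onI)
  fix K :: "'t set" assume K: "compact K"
  obtain R where R: "AE z in M. fst z \<in> K \<longrightarrow> \<bar>snd z\<bar> \<le> R"
    using bounded_over_compact[OF K] by blast
  have "compact (p ` (K \<times> {-R..R}))"
    using K p by (intro compact_continuous_image compact_Times) (auto intro: continuous_on_subset)
  then obtain C where C: "\<And>x. x \<in> p ` (K \<times> {-R..R}) \<Longrightarrow> \<bar>x\<bar> \<le> C"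
    using compact_imp_bounded bounded_iff[of "p ` (K \<times> {-R..R})"] by auto
  have "AE z in M. fst z \<in> K \<longrightarrow> \<bar>p z\<bar> \<le> C"
    using R
  proof eventually_elim
    case (elim z)
    show ?case
    proof
      assume "fst z \<in> K"
      then have "z \<in> K \<times> {-R..R}" using elim by (cases z) auto
      then show "\<bar>p z\<bar> \<le> C" by (intro C) auto
    qed
  qed
  then show "\<exists>C. AE z in M. fst z \<in> K \<longrightarrow> \<bar>p z\<bar> \<le> C" by blast
qed

lemma tame_snd: "h \<in> tame \<Longrightarrow> (\<lambda>z. snd z * h z) \<in> tame"
  by (rule tame_mult_continuous) (auto intro: continuous_intros)

lemma tame_base: "continuous_on UNIV g \<Longrightarrow> h \<in> tame \<Longrightarrow> (\<lambda>z. g (fst z) * h z) \<in> tame"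
  by (rule tame_mult_continuous) (auto intro!: continuous_on_compose2[of UNIV g] continuous_intros)

lemma tame_scale: "h \<in> tame \<Longrightarrow> (\<lambda>z. c * h z) \<in> tame"
  by (rule tame_mult_continuous) auto

lemma compactly_supported_tame:
  assumes f: "f \<in> compactly_supported"
  shows "(\<lambda>z. f (fst z)) \<in> tame"
proof -
  obtain K where K: "compact K" "\<And>t. t \<notin> K \<Longrightarrow> f t = 0" and c: "continuous_on UNIV f"
    using f by (auto simp: compactly_supported_def)
  have "(indicator (K \<times> UNIV) :: _ \<Rightarrow> real) \<in> tame"
    using K(1) by (intro tameI[where K=K and B=1] borel_measurable_indicator closed_cylinder_sets)
      (auto simp: indicator_def compact_imp_closed)
  then have "(\<lambda>z. f (fst z) * indicator (K \<times> UNIV) z) \<in> tame" by (rule tame_base[OF c])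
  also have "(\<lambda>z::'t\<times>real. f (fst z) * indicator (K \<times> UNIV) z) = (\<lambda>z. f (fst z))"
    using K(2) by (auto simp: fun_eq_iff indicator_def)
  finally show ?thesis .
qed

lemma tame_integrable:
  assumes "h \<in> tame"
  shows "integrable M h"
proof -
  obtain K B where K: "compact K" "\<And>z. fst z \<notin> K \<Longrightarrow> h z = 0" "AE z in M. \<bar>h z\<bar> \<le> B"
    using tameE[OF assms] by metis
  show ?thesis
  proof (rule integrableI_bounded_set)
    show "K \<times> UNIV \<in> sets M" by (intro closed_cylinder_sets compact_imp_closed K)
    show "emeasure M (K \<times> UNIV) < \<infinity>" by (rule finite_over_compact[OF K(1)])
    show "AE z in M. z \<in> K \<times> UNIV \<longrightarrow> norm (h z) \<le> B" using K(3) by eventually_elim simp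
    show "AE z in M. z \<notin> K \<times> UNIV \<longrightarrow> h z = 0"
    proof (rule AE_I2, rule impI)
      fix z :: "'t \<times> real" assume "z \<notin> K \<times> UNIV"
      then show "h z = 0" by (intro K(2)) (cases z, auto)
    qed
  qed (rule tame_measurable[OF assms])
qed

text \<open>
  The bound on the number of particles makes all these vectors square summable.
\<close>

definition tame_vectors :: "('t \<times> real) fock set" where
  "tame_vectors = {F. fock_measurable M F \<and>
     (\<exists>\<rho> B D. \<rho> \<in> tame \<and> (\<forall>z. 0 \<le> \<rho> z) \<and> 0 \<le> B \<and>
        (\<forall>m y. \<bar>F m y\<bar> \<le> B * (\<Prod>i<m. \<rho> (y i))) \<and> (\<forall>m y. D < m \<longrightarrow> F m y = 0))}"

lemma tame_vectorsI:
  assumes "fock_measurable M F" "\<rho> \<in> tame" "\<And>z. 0 \<le> \<rho> z" "0 \<le> B"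
    "\<And>m y. \<bar>F m y\<bar> \<le> B * (\<Prod>i<m. \<rho> (y i))" "\<And>m y. D < m \<Longrightarrow> F m y = 0"
  shows "F \<in> tame_vectors"
  unfolding tame_vectors_def using assms by blast

lemma tame_vectorsE:
  assumes "F \<in> tame_vectors"
  obtains \<rho> B D where "\<rho> \<in> tame" "\<And>z. 0 \<le> \<rho> z" "0 \<le> B"
    "\<And>m y. \<bar>F m y\<bar> \<le> B * (\<Prod>i<m. \<rho> (y i))" "\<And>m y. D < m \<Longrightarrow> F m y = 0"
  using assms unfolding tame_vectors_def by blast

lemma tame_vectors_measurable: "F \<in> tame_vectors \<Longrightarrow> fock_measurable M F"
  by (simp add: tame_vectors_def)

lemma tame_vectors_scale:
  assumes "F \<in> tame_vectors"
  shows "(\<lambda>m y. c * F m y) \<in> tame_vectors"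
proof -
  obtain \<rho> B D where *: "\<rho> \<in> tame" "\<And>z. 0 \<le> \<rho> z" "0 \<le> B"
    "\<And>m y. \<bar>F m y\<bar> \<le> B * (\<Prod>i<m. \<rho> (y i))" "\<And>m y. D < m \<Longrightarrow> F m y = 0"
    using tame_vectorsE[OF assms] by metis
  show ?thesis
  proof (rule tame_vectorsI[OF _ *(1,2), of _ "\<bar>c\<bar> * B" D])
    show "fock_measurable M (\<lambda>m y. c * F m y)"
      by (intro fock_measurable_scale tame_vectors_measurable assms)
    show "\<bar>c * F m y\<bar> \<le> \<bar>c\<bar> * B * (\<Prod>i<m. \<rho> (y i))" for m y
      using mult_left_mono[OF *(4)[of m y], of "\<bar>c\<bar>"] by (simp add: abs_mult mult.assoc)
  qed (use * in auto)
qed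

lemma tame_vectors_add:
  assumes F: "F \<in> tame_vectors" and G: "G \<in> tame_vectors"
  shows "(\<lambda>m y. F m y + G m y) \<in> tame_vectors"
proof -
  obtain \<rho> B D where *: "\<rho> \<in> tame" "\<And>z. 0 \<le> \<rho> z" "0 \<le> B"
    "\<And>m y. \<bar>F m y\<bar> \<le> B * (\<Prod>i<m. \<rho> (y i))" "\<And>m y. D < m \<Longrightarrow> F m y = 0"
    using tame_vectorsE[OF F] by metis
  obtain \<rho>' B' D' where **: "\<rho>' \<in> tame" "\<And>z. 0 \<le> \<rho>' z" "0 \<le> B'"
    "\<And>m y. \<bar>G m y\<bar> \<le> B' * (\<Prod>i<m. \<rho>' (y i))" "\<And>m y. D' < m \<Longrightarrow> G m y = 0"
    using tame_vectorsE[OF G] by metis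
  show ?thesis
  proof (rule tame_vectorsI[OF _ tame_add[OF *(1) **(1)], of _ "B + B'" "max D D'"])
    show "fock_measurable M (\<lambda>m y. F m y + G m y)"
      by (intro fock_measurable_add tame_vectors_measurable F G)
    fix m and y :: "nat \<Rightarrow> 't \<times> real"
    have "(\<Prod>i<m. \<rho> (y i)) \<le> (\<Prod>i<m. \<rho> (y i) + \<rho>' (y i))" "(\<Prod>i<m. \<rho>' (y i)) \<le> (\<Prod>i<m. \<rho> (y i) + \<rho>' (y i))"
      by (intro prod_mono; simp add: *(2) **(2))+
    then have "\<bar>F m y\<bar> \<le> B * (\<Prod>i<m. \<rho> (y i) + \<rho>' (y i))" "\<bar>G m y\<bar> \<le> B' * (\<Prod>i<m. \<rho> (y i) + \<rho>' (y i))"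
      using order_trans[OF *(4) mult_left_mono] order_trans[OF **(4) mult_left_mono] *(3) **(3) by blast+
    then show "\<bar>F m y + G m y\<bar> \<le> (B + B') * (\<Prod>i<m. \<rho> (y i) + \<rho>' (y i))"
      by (simp add: distrib_right)
  qed (use * ** in \<open>auto intro: add_nonneg_nonneg\<close>)
qed

lemma tame_vectors_diff:
  "F \<in> tame_vectors \<Longrightarrow> G \<in> tame_vectors \<Longrightarrow> (\<lambda>m y. F m y - G m y) \<in> tame_vectors"
  using tame_vectors_add[OF _ tame_vectors_scale[of G "-1"]] by simp

lemma vacuum_tame: "vacuum \<in> tame_vectors"
proof (rule tame_vectorsI[of _ "\<lambda>_. 0" 1 0])
  show "fock_measurable M vacuum"
    by (simp add: fock_measurable_def vacuum_def[abs_def])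
  show "(\<lambda>_. 0) \<in> tame" by (rule tameI[of _ "{}"]) auto
qed (auto simp: vacuum_def)

lemma nn_integral_tame_square_prod:
  assumes "\<rho> \<in> tame"
  shows "(\<integral>\<^sup>+y. ennreal ((B * (\<Prod>i<m. \<rho> (y i)))\<^sup>2) \<partial>tensor_power M m) < \<infinity>"
proof -
  interpret product_sigma_finite "\<lambda>_::nat. M" by standard
  have [measurable]: "\<rho> \<in> borel_measurable M" by (rule tame_measurable[OF assms])
  have fin: "(\<integral>\<^sup>+z. ennreal ((\<rho> z)\<^sup>2) \<partial>M) < \<infinity>"
    using tame_integrable[OF tame_mult[OF assms assms]] by (simp add: integrable_iff_bounded power2_eq_square)
  have c: "(\<lambda>y. y i) \<in> measurable (PiM {..<m} (\<lambda>_. M)) M" if "i \<in> {..<m}" for i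
    using that by measurable
  have pm: "(\<lambda>y. \<Prod>i<m. ennreal ((\<rho> (y i))\<^sup>2)) \<in> borel_measurable (PiM {..<m} (\<lambda>_. M))"
    by (intro borel_measurable_prod_ennreal measurable_compose[OF c]) measurable
  have "(\<integral>\<^sup>+y. ennreal ((B * (\<Prod>i<m. \<rho> (y i)))\<^sup>2) \<partial>tensor_power M m)
      = (\<integral>\<^sup>+y. ennreal (B\<^sup>2) * (\<Prod>i<m. ennreal ((\<rho> (y i))\<^sup>2)) \<partial>PiM {..<m} (\<lambda>_. M))"
    unfolding tensor_power_def
    by (intro nn_integral_cong) (simp add: power_mult_distrib prod_power_distrib ennreal_mult prod_nonneg prod_ennreal)
  also have "\<dots> = ennreal (B\<^sup>2) * (\<Prod>i<m. \<integral>\<^sup>+z. ennreal ((\<rho> z)\<^sup>2) \<partial>M)"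
    by (subst nn_integral_cmult[OF pm], subst product_nn_integral_prod) auto
  also have "\<dots> < \<infinity>"
    using fin by (simp add: ennreal_mult_less_top less_top power_less_top_ennreal)
  finally show ?thesis .
qed

lemma tame_vectors_component_finite:
  assumes "F \<in> tame_vectors"
  shows "(\<integral>\<^sup>+y. ennreal ((F m y)\<^sup>2) \<partial>tensor_power M m) < \<infinity>"
proof -
  obtain \<rho> B D where *: "\<rho> \<in> tame" "\<And>z. 0 \<le> \<rho> z" "0 \<le> B"
    "\<And>m y. \<bar>F m y\<bar> \<le> B * (\<Prod>i<m. \<rho> (y i))" "\<And>m y. D < m \<Longrightarrow> F m y = 0"
    using tame_vectorsE[OF assms] by metis
  have "(F m y)\<^sup>2 \<le> (B * (\<Prod>i<m. \<rho> (y i)))\<^sup>2" for y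
    using power_mono[OF *(4)[of m y], of 2] by simp
  then have "(\<integral>\<^sup>+y. ennreal ((F m y)\<^sup>2) \<partial>tensor_power M m)
      \<le> (\<integral>\<^sup>+y. ennreal ((B * (\<Prod>i<m. \<rho> (y i)))\<^sup>2) \<partial>tensor_power M m)"
    by (intro nn_integral_mono ennreal_leI)
  then show ?thesis using nn_integral_tame_square_prod[OF *(1)] by (rule order.strict_trans1)
qed

section \<open>Bounds and limits for the combined operator\<close>

lemma vcons_restrict: "vcons m w (restrict y {..<m}) = vcons m w y"
  by (auto simp: vcons_def fun_eq_iff split: nat.split)

lemma measurable_vcons_first: "(\<lambda>w. vcons m w y) \<in> measurable M (tensor_power M (Suc m))"
proof -
  have "restrict y {..<m} \<in> space (tensor_power M m)"
    by (auto simp: space_tensor_power space_M)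
  then have "(\<lambda>w. vcons m w (restrict y {..<m})) \<in> measurable M (tensor_power M (Suc m))"
    by (intro measurable_vcons) auto
  then show ?thesis by (simp add: vcons_restrict)
qed

lemma prod_vcons: "(\<Prod>i<Suc m. f (vcons m w y i)) = f w * (\<Prod>i<m. f (y i))" for f :: "'t \<times> real \<Rightarrow> real"
  unfolding prod.lessThan_Suc_shift by (auto intro!: arg_cong2[where f="(*)"] prod.cong)

lemma prod_vtail: "(\<Prod>i<m. f (vtail m y i)) = (\<Prod>i<m. f (y (Suc i)))" for f :: "'t \<times> real \<Rightarrow> real"
  by (auto simp: vtail_def intro!: prod.cong)

lemma family_measurable_first:
  assumes "fock_family_measurable M G"
  shows "(\<lambda>w. G w (Suc m) (vcons m w y)) \<in> borel_measurable M"
proof -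
  have "(\<lambda>w. (w, vcons m w y)) \<in> measurable M (M \<Otimes>\<^sub>M tensor_power M (Suc m))"
    by (intro measurable_Pair measurable_vcons_first) simp
  moreover have "(\<lambda>p. G (fst p) (Suc m) (snd p)) \<in> borel_measurable (M \<Otimes>\<^sub>M tensor_power M (Suc m))"
    using assms by (simp add: fock_family_measurable_def)
  ultimately show ?thesis by (auto dest: measurable_compose)
qed

lemma family_annihilation_bound:
  fixes G :: "'t \<times> real \<Rightarrow> ('t \<times> real) fock"
  assumes "fock_family_dominated \<alpha> \<rho> G"
  shows "\<bar>G w (Suc m) (vcons m w y)\<bar> \<le> \<alpha> w * \<rho> w * (\<Prod>i<m. \<rho> (y i))"
proof -
  have "\<bar>G w (Suc m) (vcons m w y)\<bar> \<le> \<alpha> w * (\<Prod>i<Suc m. \<rho> (vcons m w y i))"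
    using assms unfolding fock_family_dominated_def by blast
  also have "(\<Prod>i<Suc m. \<rho> (vcons m w y i)) = \<rho> w * (\<Prod>i<m. \<rho> (y i))" by (rule prod_vcons)
  finally show ?thesis by (simp only: mult.assoc)
qed

lemma family_integrable:
  assumes "fock_family_measurable M G" "\<alpha> \<in> tame" "\<rho> \<in> tame" and d: "fock_family_dominated \<alpha> \<rho> G"
  shows "integrable M (\<lambda>w. G w (Suc m) (vcons m w y))"
proof (rule Bochner_Integration.integrable_bound)
  show "integrable M (\<lambda>w. \<alpha> w * \<rho> w * (\<Prod>i<m. \<rho> (y i)))"
    by (intro integrable_mult_left tame_integrable tame_mult assms)
  show "AE w in M. norm (G w (Suc m) (vcons m w y)) \<le> norm (\<alpha> w * \<rho> w * (\<Prod>i<m. \<rho> (y i)))"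
    using order_trans[OF family_annihilation_bound[OF d] abs_ge_self] by auto
qed (rule family_measurable_first[OF assms(1)])

lemma can_op_add:
  assumes "fock_family_measurable M G" "\<alpha> \<in> tame" "\<rho> \<in> tame" "fock_family_dominated \<alpha> \<rho> G"
    and "fock_family_measurable M H" "\<alpha>' \<in> tame" "\<rho>' \<in> tame" "fock_family_dominated \<alpha>' \<rho>' H"
  shows "can_op M (\<lambda>z m y. G z m y + H z m y) m y = can_op M G m y + can_op M H m y"
  using family_integrable[OF assms(1-4)] family_integrable[OF assms(5-8)]
  by (simp add: can_op_def distrib_left split: nat.split)

lemma can_op_scale: "can_op M (\<lambda>z m y. c * G z m y) m y = c * can_op M G m y"
  by (simp add: can_op_def distrib_left mult.left_commute split: nat.split)

text \<open>
  The first summand serves the coordinates that are left alone, the second a created coordinate, and the third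
  the coordinate on which the neutral part acts.
\<close>

definition can_weight :: "('t \<times> real \<Rightarrow> real) \<Rightarrow> ('t \<times> real \<Rightarrow> real) \<Rightarrow> 't \<times> real \<Rightarrow> real" where
  "can_weight \<alpha> \<rho> z = \<rho> z + (\<alpha> z + \<bar>snd z * (\<alpha> z * \<rho> z)\<bar>)"

lemma can_weight_tame: "\<alpha> \<in> tame \<Longrightarrow> \<rho> \<in> tame \<Longrightarrow> can_weight \<alpha> \<rho> \<in> tame"
  unfolding can_weight_def[abs_def] by (intro tame_add tame_abs tame_snd tame_mult)

lemma can_op_bound:
  assumes \<alpha>: "\<alpha> \<in> tame" "\<And>z. 0 \<le> \<alpha> z" and \<rho>: "\<rho> \<in> tame" "\<And>z. 0 \<le> \<rho> z"
    and d: "fock_family_dominated \<alpha> \<rho> G"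
  shows "\<bar>can_op M G m y\<bar> \<le> (2 + (\<integral>z. \<alpha> z * \<rho> z \<partial>M)) * (\<Prod>i<m. can_weight \<alpha> \<rho> (y i))"
proof -
  let ?w = "can_weight \<alpha> \<rho>"
  let ?P = "\<Prod>i<m. ?w (y i)"
  have w: "0 \<le> ?w z" "\<rho> z \<le> ?w z" "\<alpha> z \<le> ?w z" "\<bar>snd z\<bar> * (\<alpha> z * \<rho> z) \<le> ?w z" for z
    using \<alpha>(2)[of z] \<rho>(2)[of z] by (auto simp: can_weight_def abs_mult)
  have le: "(\<Prod>i\<in>I. \<rho> (f i)) \<le> (\<Prod>i\<in>I. ?w (f i))" for I and f :: "nat \<Rightarrow> 't \<times> real"
    by (intro prod_mono) (simp add: \<rho>(2) w(2))
  have P0: "0 \<le> ?P" by (intro prod_nonneg) (simp add: w(1))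
  have C: "\<bar>case m of 0 \<Rightarrow> 0 | Suc k \<Rightarrow> G (y 0) k (vtail k y)\<bar> \<le> ?P"
  proof (cases m)
    case (Suc k)
    have "\<bar>G (y 0) k (vtail k y)\<bar> \<le> \<alpha> (y 0) * (\<Prod>i<k. \<rho> (y (Suc i)))"
      using d unfolding fock_family_dominated_def by (metis prod_vtail)
    also have "\<dots> \<le> ?w (y 0) * (\<Prod>i<k. ?w (y (Suc i)))"
      by (intro mult_mono w(3) le w(1) prod_nonneg) (simp add: \<rho>(2))
    also have "\<dots> = ?P" unfolding Suc prod.lessThan_Suc_shift ..
    finally show ?thesis using Suc by simp
  qed simp
  have N: "\<bar>if m = 0 then 0 else snd (y 0) * G (y 0) m y\<bar> \<le> ?P"
  proof (cases m)
    case (Suc k)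
    have "\<bar>snd (y 0) * G (y 0) m y\<bar> \<le> \<bar>snd (y 0)\<bar> * (\<alpha> (y 0) * (\<Prod>i<m. \<rho> (y i)))"
      unfolding abs_mult by (rule mult_left_mono[OF _ abs_ge_zero]) (use d in \<open>unfold fock_family_dominated_def, blast\<close>)
    also have "\<dots> = (\<bar>snd (y 0)\<bar> * (\<alpha> (y 0) * \<rho> (y 0))) * (\<Prod>i<k. \<rho> (y (Suc i)))"
      unfolding Suc prod.lessThan_Suc_shift by simp
    also have "\<dots> \<le> ?w (y 0) * (\<Prod>i<k. ?w (y (Suc i)))"
      by (intro mult_mono w(4) le w(1) prod_nonneg) (simp add: \<rho>(2))
    also have "\<dots> = ?P" unfolding Suc prod.lessThan_Suc_shift ..
    finally show ?thesis using Suc by simp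
  qed simp
  have A: "\<bar>\<integral>w. G w (Suc m) (vcons m w y) \<partial>M\<bar> \<le> (\<integral>z. \<alpha> z * \<rho> z \<partial>M) * ?P"
  proof -
    have I0: "0 \<le> (\<integral>z. \<alpha> z * \<rho> z \<partial>M)" by (intro Bochner_Integration.integral_nonneg) (simp add: \<alpha>(2) \<rho>(2))
    have "\<bar>\<integral>w. G w (Suc m) (vcons m w y) \<partial>M\<bar> \<le> (\<integral>w. \<alpha> w * \<rho> w * (\<Prod>i<m. \<rho> (y i)) \<partial>M)"
    proof (rule order_trans)
      show "\<bar>\<integral>w. G w (Suc m) (vcons m w y) \<partial>M\<bar> \<le> (\<integral>w. \<bar>G w (Suc m) (vcons m w y)\<bar> \<partial>M)"
        using integral_norm_bound[of M "\<lambda>w. G w (Suc m) (vcons m w y)"] by simp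
      show "(\<integral>w. \<bar>G w (Suc m) (vcons m w y)\<bar> \<partial>M) \<le> (\<integral>w. \<alpha> w * \<rho> w * (\<Prod>i<m. \<rho> (y i)) \<partial>M)"
      proof (rule integral_mono')
        show "integrable M (\<lambda>w. \<alpha> w * \<rho> w * (\<Prod>i<m. \<rho> (y i)))"
          by (intro integrable_mult_left tame_integrable tame_mult \<alpha> \<rho>)
        show "0 \<le> \<alpha> w * \<rho> w * (\<Prod>i<m. \<rho> (y i))" for w
          by (intro mult_nonneg_nonneg prod_nonneg) (simp_all add: \<alpha>(2) \<rho>(2))
      qed (rule family_annihilation_bound[OF d])
    qed
    also have "\<dots> = (\<integral>z. \<alpha> z * \<rho> z \<partial>M) * (\<Prod>i<m. \<rho> (y i))" by simp
    also have "\<dots> \<le> (\<integral>z. \<alpha> z * \<rho> z \<partial>M) * ?P" by (intro mult_left_mono le I0)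
    finally show ?thesis .
  qed
  have "(2 + (\<integral>z. \<alpha> z * \<rho> z \<partial>M)) * ?P = ?P + (\<integral>z. \<alpha> z * \<rho> z \<partial>M) * ?P + ?P"
    by (simp add: distrib_right)
  then show ?thesis unfolding can_op_def using A C N by linarith
qed

lemma can_op_high_degree:
  assumes "\<And>z m y. D < m \<Longrightarrow> G z m y = 0" "Suc D < m"
  shows "can_op M G m y = 0"
  using assms by (cases m) (auto simp: can_op_def)

lemma can_op_measurable:
  assumes "fock_family_measurable M G"
  shows "fock_measurable M (can_op M G)"
  unfolding fock_measurable_def
proof
  fix m
  \<comment> \<open>The measurability statement has a parameter space; here it is a single point.\<close>
  let ?U = "count_space {()}"
  have "(\<lambda>(x, z, y). G z m y) \<in> borel_measurable (?U \<Otimes>\<^sub>M (M \<Otimes>\<^sub>M tensor_power M m))" for m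
  proof -
    have "(\<lambda>p. G (fst p) m (snd p)) \<in> borel_measurable (M \<Otimes>\<^sub>M tensor_power M m)"
      using assms by (simp add: fock_family_measurable_def)
    from measurable_compose[OF measurable_snd[of ?U] this] show ?thesis
      by (simp add: case_prod_beta')
  qed
  from measurable_can_op[OF sigma_finite_M sets_M this]
  have *: "(\<lambda>(x, y). can_op M G m y) \<in> borel_measurable (?U \<Otimes>\<^sub>M tensor_power M m)" .
  have "(\<lambda>y. ((), y)) \<in> measurable (tensor_power M m) (?U \<Otimes>\<^sub>M tensor_power M m)"
    by (intro measurable_Pair) auto
  from measurable_compose[OF this *] show "can_op M G m \<in> borel_measurable (tensor_power M m)"
    by simp
qed

lemma can_op_family_measurable:
  assumes "\<And>m. (\<lambda>(x, z, y). G x z m y) \<in> borel_measurable (M \<Otimes>\<^sub>M (M \<Otimes>\<^sub>M tensor_power M m))"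
  shows "fock_family_measurable M (\<lambda>z. can_op M (G z))"
  using measurable_can_op[OF sigma_finite_M sets_M assms]
  by (simp add: fock_family_measurable_def case_prod_beta')

lemma can_op_tendsto:
  assumes m: "\<And>n. fock_family_measurable M (G n)" and t: "\<alpha> \<in> tame" "\<rho> \<in> tame"
    and d: "\<And>n. fock_family_dominated \<alpha> \<rho> (G n)"
    and l: "\<And>z m y. (\<lambda>n. G n z m y) \<longlonglongrightarrow> H z m y"
  shows "(\<lambda>n. can_op M (G n) m y) \<longlonglongrightarrow> can_op M H m y"
proof -
  have "(\<lambda>n. \<integral>w. G n w (Suc m) (vcons m w y) \<partial>M) \<longlonglongrightarrow> (\<integral>w. H w (Suc m) (vcons m w y) \<partial>M)"
  proof (rule integral_dominated_convergence)
    show gm: "(\<lambda>w. G n w (Suc m) (vcons m w y)) \<in> borel_measurable M" for n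
      by (rule family_measurable_first[OF m])
    show "(\<lambda>w. H w (Suc m) (vcons m w y)) \<in> borel_measurable M"
      by (rule borel_measurable_LIMSEQ_real[OF l gm])
    show "integrable M (\<lambda>w. \<alpha> w * \<rho> w * (\<Prod>i<m. \<rho> (y i)))"
      by (intro integrable_mult_left tame_integrable tame_mult t)
    show "AE w in M. norm (G n w (Suc m) (vcons m w y)) \<le> \<alpha> w * \<rho> w * (\<Prod>i<m. \<rho> (y i))" for n
      using family_annihilation_bound[OF d] by auto
  qed (use l in auto)
  then show ?thesis
    unfolding can_op_def by (cases m) (auto intro!: tendsto_intros l)
qed

lemma dominated_mult:
  assumes "\<And>m y. \<bar>F m y\<bar> \<le> B * (\<Prod>i<m. \<rho> (y i))"
  shows "fock_family_dominated (\<lambda>z. \<bar>h z\<bar> * B) \<rho> (\<lambda>z m y. h z * F m y)"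
  unfolding fock_family_dominated_def
  using mult_left_mono[OF assms abs_ge_zero] by (auto simp: abs_mult mult.assoc)

lemma field_op_tame:
  assumes h: "h \<in> tame" and F: "F \<in> tame_vectors"
  shows "field_op M h F \<in> tame_vectors"
proof -
  obtain \<rho> B D where *: "\<rho> \<in> tame" "\<And>z. 0 \<le> \<rho> z" "0 \<le> B"
    "\<And>m y. \<bar>F m y\<bar> \<le> B * (\<Prod>i<m. \<rho> (y i))" "\<And>m y. D < m \<Longrightarrow> F m y = 0"
    using tame_vectorsE[OF F] by metis
  let ?\<alpha> = "\<lambda>z. \<bar>h z\<bar> * B"
  have \<alpha>: "?\<alpha> \<in> tame" using tame_scale[OF tame_abs[OF h], of B] by (simp add: mult.commute)
  have \<alpha>0: "0 \<le> ?\<alpha> z" for z using *(3) by simp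
  show ?thesis
    unfolding field_op_eq_can_op
  proof (rule tame_vectorsI)
    show "fock_measurable M (can_op M (\<lambda>z m y. h z * F m y))"
      by (intro can_op_measurable fock_family_measurable_mult tame_measurable h tame_vectors_measurable F)
    show "can_weight ?\<alpha> \<rho> \<in> tame" by (intro can_weight_tame \<alpha> *)
    show "0 \<le> can_weight ?\<alpha> \<rho> z" for z using \<alpha>0[of z] *(2)[of z] by (simp add: can_weight_def)
    show "0 \<le> 2 + (\<integral>z. ?\<alpha> z * \<rho> z \<partial>M)"
      by (intro add_nonneg_nonneg Bochner_Integration.integral_nonneg mult_nonneg_nonneg \<alpha>0) (simp_all add: *(2) *(3))
    show "\<bar>can_op M (\<lambda>z m y. h z * F m y) m y\<bar> \<le> (2 + (\<integral>z. ?\<alpha> z * \<rho> z \<partial>M)) * (\<Prod>i<m. can_weight ?\<alpha> \<rho> (y i))" for m y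
      by (rule can_op_bound[OF \<alpha> \<alpha>0 *(1,2) dominated_mult[OF *(4)]])
    show "can_op M (\<lambda>z m y. h z * F m y) m y = 0" if "Suc D < m" for m y
      using that by (intro can_op_high_degree[of D]) (auto simp: *(5))
  qed
qed

lemma field_op_add_vector:
  assumes h: "h \<in> tame" and F: "F \<in> tame_vectors" and G: "G \<in> tame_vectors"
  shows "field_op M h (\<lambda>m y. F m y + G m y) = (\<lambda>m y. field_op M h F m y + field_op M h G m y)"
proof (intro ext)
  fix m y
  obtain \<rho> B where *: "\<rho> \<in> tame" "\<And>m y. \<bar>F m y\<bar> \<le> B * (\<Prod>i<m. \<rho> (y i))"
    using tame_vectorsE[OF F] by metis
  obtain \<rho>' B' where **: "\<rho>' \<in> tame" "\<And>m y. \<bar>G m y\<bar> \<le> B' * (\<Prod>i<m. \<rho>' (y i))"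
    using tame_vectorsE[OF G] by metis
  have t: "(\<lambda>z. \<bar>h z\<bar> * c) \<in> tame" for c
    using tame_scale[OF tame_abs[OF h], of c] by (simp add: mult.commute)
  show "field_op M h (\<lambda>m y. F m y + G m y) m y = field_op M h F m y + field_op M h G m y"
    unfolding field_op_eq_can_op distrib_left
    by (rule can_op_add[OF _ t *(1) dominated_mult[OF *(2)] _ t **(1) dominated_mult[OF **(2)]])
      (intro fock_family_measurable_mult tame_measurable h tame_vectors_measurable F G)+
qed

lemma field_op_scale_vector: "field_op M h (\<lambda>m y. c * F m y) = (\<lambda>m y. c * field_op M h F m y)"
  unfolding field_op_eq_can_op
  by (intro ext) (simp add: mult.left_commute flip: can_op_scale)

lemma field_op_scale_symbol: "field_op M (\<lambda>z. c * h z) F = (\<lambda>m y. c * field_op M h F m y)"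
  unfolding field_op_eq_can_op
  by (intro ext) (simp add: mult.assoc flip: can_op_scale)

lemma field_op_add_symbol:
  assumes h: "h \<in> tame" and k: "k \<in> tame" and F: "F \<in> tame_vectors"
  shows "field_op M (\<lambda>z. h z + k z) F = (\<lambda>m y. field_op M h F m y + field_op M k F m y)"
proof (intro ext)
  fix m y
  obtain \<rho> B where *: "\<rho> \<in> tame" "\<And>m y. \<bar>F m y\<bar> \<le> B * (\<Prod>i<m. \<rho> (y i))"
    using tame_vectorsE[OF F] by metis
  have t: "(\<lambda>z. \<bar>g z\<bar> * c) \<in> tame" if "g \<in> tame" for c g
    using tame_scale[OF tame_abs[OF that], of c] by (simp add: mult.commute)
  show "field_op M (\<lambda>z. h z + k z) F m y = field_op M h F m y + field_op M k F m y"
    unfolding field_op_eq_can_op distrib_right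
    by (rule can_op_add[OF _ t[OF h] *(1) dominated_mult[OF *(2)] _ t[OF k] *(1) dominated_mult[OF *(2)]])
      (intro fock_family_measurable_mult tame_measurable h k tame_vectors_measurable F)+
qed

end

section \<open>Boundedness of the field operators\<close>

lemma suminf_ennreal_Suc: "suminf f = (\<Sum>n. f (Suc n)) + f 0" for f :: "nat \<Rightarrow> ennreal"
  using sums_Suc[OF summable_sums[OF summableI, of "\<lambda>n. f (Suc n)"]] by (simp add: sums_iff)

context fibred_measure
begin

lemma creation_measurable:
  assumes h: "h \<in> borel_measurable M" and F: "fock_measurable M F"
  shows "fock_measurable M (creation h F)"
  unfolding fock_measurable_def
proof
  fix m
  show "creation h F m \<in> borel_measurable (tensor_power M m)"
  proof (cases m)
    case (Suc k)
    have "(\<lambda>y. h (y 0)) \<in> borel_measurable (tensor_power M (Suc k))"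
      by (rule measurable_compose[OF measurable_coordinate h]) simp
    moreover have "(\<lambda>y. F k (vtail k y)) \<in> borel_measurable (tensor_power M (Suc k))"
      using F by (intro measurable_compose[OF measurable_vtail]) (simp add: fock_measurable_def)
    ultimately show ?thesis unfolding Suc creation_def[abs_def] by simp
  qed (simp add: creation_def[abs_def])
qed

lemma neutral_measurable:
  assumes h: "h \<in> borel_measurable M" and F: "fock_measurable M F"
  shows "fock_measurable M (neutral h F)"
  unfolding fock_measurable_def
proof
  fix m
  show "neutral h F m \<in> borel_measurable (tensor_power M m)"
  proof (cases m)
    case (Suc k)
    have "(\<lambda>y. h (y 0)) \<in> borel_measurable (tensor_power M (Suc k))"
      by (rule measurable_compose[OF measurable_coordinate h]) simp
    moreover have "F (Suc k) \<in> borel_measurable (tensor_power M (Suc k))"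
      using F by (simp add: fock_measurable_def)
    ultimately show ?thesis unfolding Suc neutral_def[abs_def] by simp
  qed (simp add: neutral_def[abs_def])
qed

lemma field_op_measurable:
  assumes h: "h \<in> borel_measurable M" and F: "fock_measurable M F"
  shows "fock_measurable M (field_op M h F)"
  unfolding field_op_eq_can_op by (intro can_op_measurable fock_family_measurable_mult h F)

lemma measurable_snd_mult:
  assumes "h \<in> borel_measurable M"
  shows "(\<lambda>z. snd z * h z) \<in> borel_measurable M"
proof -
  have "(snd :: 't \<times> real \<Rightarrow> real) \<in> borel_measurable M"
    unfolding measurable_M by (intro borel_measurable_continuous_onI continuous_intros)
  then show ?thesis using assms by simp
qed

text \<open>
  The sum of the three parts is measurable, and so are the two other parts.
\<close>

lemma annihilation_measurable:
  assumes h: "h \<in> borel_measurable M" and F: "fock_measurable M F"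
  shows "fock_measurable M (annihilation M h F)"
proof -
  have "annihilation M h F = (\<lambda>m y. field_op M h F m y +
      -1 * (creation h F m y + neutral (\<lambda>z. snd z * h z) F m y))"
    by (intro ext) (simp add: field_op_def fock_add_def case_prod_beta')
  then show ?thesis
    by (simp only:) (intro fock_measurable_add fock_measurable_scale field_op_measurable
        creation_measurable neutral_measurable measurable_snd_mult h F)
qed

lemma sqnorm_creation:
  assumes h: "h \<in> borel_measurable M" and F: "fock_measurable M F"
  shows "sqnorm M (creation h F) = (\<integral>\<^sup>+z. ennreal ((h z)\<^sup>2) \<partial>M) * sqnorm M F"
proof -
  have Fm [measurable]: "F m \<in> borel_measurable (tensor_power M m)" for m
    using F by (simp add: fock_measurable_def)
  have cm: "(\<lambda>y. ennreal ((creation h F m y)\<^sup>2)) \<in> borel_measurable (tensor_power M m)" for m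
  proof -
    have "creation h F m \<in> borel_measurable (tensor_power M m)"
      using creation_measurable[OF h F] by (simp add: fock_measurable_def)
    then show ?thesis by measurable
  qed
  have "(\<integral>\<^sup>+y. ennreal ((creation h F (Suc m) y)\<^sup>2) \<partial>tensor_power M (Suc m))
      = (\<integral>\<^sup>+z. ennreal ((h z)\<^sup>2) \<partial>M) * (\<integral>\<^sup>+y. ennreal ((F m y)\<^sup>2) \<partial>tensor_power M m)" for m
  proof -
    have "(\<integral>\<^sup>+y. ennreal ((creation h F (Suc m) y)\<^sup>2) \<partial>tensor_power M (Suc m))
        = (\<integral>\<^sup>+w. \<integral>\<^sup>+y. ennreal ((h w)\<^sup>2) * ennreal ((F m y)\<^sup>2) \<partial>tensor_power M m \<partial>M)"
      unfolding nn_integral_tensor_power_Suc[OF cm]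
      by (intro nn_integral_cong) (simp add: creation_def vtail_vcons power_mult_distrib ennreal_mult)
    also have "\<dots> = (\<integral>\<^sup>+w. ennreal ((h w)\<^sup>2) * (\<integral>\<^sup>+y. ennreal ((F m y)\<^sup>2) \<partial>tensor_power M m) \<partial>M)"
      by (intro nn_integral_cong nn_integral_cmult) measurable
    also have "\<dots> = (\<integral>\<^sup>+z. ennreal ((h z)\<^sup>2) \<partial>M) * (\<integral>\<^sup>+y. ennreal ((F m y)\<^sup>2) \<partial>tensor_power M m)"
      using h by (intro nn_integral_multc) measurable
    finally show ?thesis .
  qed
  then show ?thesis
    unfolding sqnorm_def
    by (subst suminf_ennreal_Suc) (simp add: creation_def ennreal_suminf_cmult)
qed

text \<open>
  The Cauchy-Schwarz inequality in the variable that is integrated out, for each value of the others.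
\<close>

lemma sqnorm_annihilation:
  assumes h: "h \<in> borel_measurable M" and F: "fock_measurable M F"
  shows "sqnorm M (annihilation M h F) \<le> (\<integral>\<^sup>+z. ennreal ((h z)\<^sup>2) \<partial>M) * sqnorm M F"
proof -
  let ?a = "\<integral>\<^sup>+z. ennreal ((h z)\<^sup>2) \<partial>M"
  have Fm: "F m \<in> borel_measurable (tensor_power M m)" for m
    using F by (simp add: fock_measurable_def)
  have F2: "(\<lambda>y. ennreal ((F m y)\<^sup>2)) \<in> borel_measurable (tensor_power M m)" for m
    using Fm[of m] by simp
  have cs: "ennreal ((annihilation M h F m y)\<^sup>2) \<le> ?a * (\<integral>\<^sup>+w. ennreal ((F (Suc m) (vcons m w y))\<^sup>2) \<partial>M)" for m y
  proof -
    have g [measurable]: "(\<lambda>w. F (Suc m) (vcons m w y)) \<in> borel_measurable M"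
      by (rule measurable_compose[OF measurable_vcons_first Fm])
    note [measurable] = h
    have "ennreal \<bar>annihilation M h F m y\<bar> \<le> (\<integral>\<^sup>+w. ennreal (norm (h w * F (Suc m) (vcons m w y))) \<partial>M)"
    proof (cases "integrable M (\<lambda>w. h w * F (Suc m) (vcons m w y))")
      case True
      from integral_norm_bound_ennreal[OF this] show ?thesis by (simp add: annihilation_def)
    qed (simp add: annihilation_def not_integrable_integral_eq)
    also have "\<dots> = (\<integral>\<^sup>+w. ennreal \<bar>h w\<bar> * ennreal \<bar>F (Suc m) (vcons m w y)\<bar> \<partial>M)"
      by (simp add: abs_mult ennreal_mult)
    finally have "(ennreal \<bar>annihilation M h F m y\<bar>)\<^sup>2 \<le> (\<integral>\<^sup>+w. ennreal \<bar>h w\<bar> * ennreal \<bar>F (Suc m) (vcons m w y)\<bar> \<partial>M)\<^sup>2"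
      by (rule power_mono) simp
    also have "\<dots> \<le> (\<integral>\<^sup>+w. (ennreal \<bar>h w\<bar>)\<^sup>2 \<partial>M) * (\<integral>\<^sup>+w. (ennreal \<bar>F (Suc m) (vcons m w y)\<bar>)\<^sup>2 \<partial>M)"
      by (rule Cauchy_Schwarz_nn_integral) measurable
    finally show ?thesis by (simp add: ennreal_power)
  qed
  have "(\<integral>\<^sup>+y. ennreal ((annihilation M h F m y)\<^sup>2) \<partial>tensor_power M m)
      \<le> ?a * (\<integral>\<^sup>+y. ennreal ((F (Suc m) y)\<^sup>2) \<partial>tensor_power M (Suc m))" for m
  proof -
    note split = nn_integral_tensor_power_Suc[OF F2, of m]
    interpret P: sigma_finite_measure "tensor_power M m" by (rule sigma_finite_tensor_power)
    have v: "(\<lambda>p. vcons m (snd p) (fst p)) \<in> measurable (tensor_power M m \<Otimes>\<^sub>M M) (tensor_power M (Suc m))"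
      by (intro measurable_vcons measurable_fst measurable_snd)
    interpret pair_sigma_finite "tensor_power M m" M by standard
    have "(\<integral>\<^sup>+y. ennreal ((annihilation M h F m y)\<^sup>2) \<partial>tensor_power M m)
        \<le> (\<integral>\<^sup>+y. ?a * (\<integral>\<^sup>+w. ennreal ((F (Suc m) (vcons m w y))\<^sup>2) \<partial>M) \<partial>tensor_power M m)"
      by (intro nn_integral_mono cs)
    also have "\<dots> = ?a * (\<integral>\<^sup>+y. \<integral>\<^sup>+w. ennreal ((F (Suc m) (vcons m w y))\<^sup>2) \<partial>M \<partial>tensor_power M m)"
    proof (rule nn_integral_cmult)
      have "(\<lambda>(y, w). ennreal ((F (Suc m) (vcons m w y))\<^sup>2)) \<in> borel_measurable (tensor_power M m \<Otimes>\<^sub>M M)"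
        using measurable_compose[OF v F2] by (simp add: case_prod_beta')
      then show "(\<lambda>y. \<integral>\<^sup>+w. ennreal ((F (Suc m) (vcons m w y))\<^sup>2) \<partial>M) \<in> borel_measurable (tensor_power M m)"
        by (rule sigma_finite_measure.borel_measurable_nn_integral[OF sigma_finite_M])
    qed
    also have "(\<integral>\<^sup>+y. \<integral>\<^sup>+w. ennreal ((F (Suc m) (vcons m w y))\<^sup>2) \<partial>M \<partial>tensor_power M m)
        = (\<integral>\<^sup>+w. \<integral>\<^sup>+y. ennreal ((F (Suc m) (vcons m w y))\<^sup>2) \<partial>tensor_power M m \<partial>M)"
      using measurable_compose[OF v F2] by (intro Fubini'[symmetric]) (simp add: case_prod_beta')
    also have "\<dots> = (\<integral>\<^sup>+y. ennreal ((F (Suc m) y)\<^sup>2) \<partial>tensor_power M (Suc m))"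
      by (rule split[symmetric])
    finally show ?thesis .
  qed
  then have "sqnorm M (annihilation M h F) \<le> (\<Sum>m. ?a * (\<integral>\<^sup>+y. ennreal ((F (Suc m) y)\<^sup>2) \<partial>tensor_power M (Suc m)))"
    unfolding sqnorm_def by (intro suminf_le summableI)
  also have "\<dots> = ?a * (\<Sum>m. \<integral>\<^sup>+y. ennreal ((F (Suc m) y)\<^sup>2) \<partial>tensor_power M (Suc m))" by simp
  also have "\<dots> \<le> ?a * sqnorm M F"
    unfolding sqnorm_def by (subst (2) suminf_ennreal_Suc) (intro mult_left_mono, auto)
  finally show ?thesis .
qed

lemma sqnorm_neutral:
  assumes h: "h \<in> borel_measurable M" and F: "fock_measurable M F" and b: "AE z in M. \<bar>h z\<bar> \<le> b"
  shows "sqnorm M (neutral h F) \<le> ennreal (b\<^sup>2) * sqnorm M F"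
proof -
  have Fm [measurable]: "F m \<in> borel_measurable (tensor_power M m)" for m
    using F by (simp add: fock_measurable_def)
  have "(\<integral>\<^sup>+y. ennreal ((neutral h F m y)\<^sup>2) \<partial>tensor_power M m)
      \<le> ennreal (b\<^sup>2) * (\<integral>\<^sup>+y. ennreal ((F m y)\<^sup>2) \<partial>tensor_power M m)" for m
  proof (cases m)
    case (Suc k)
    have c: "(\<lambda>y. h (y 0)) \<in> borel_measurable (tensor_power M (Suc k))"
      by (rule measurable_compose[OF measurable_coordinate h]) simp
    have "AE y in tensor_power M (Suc k). \<bar>h (y 0)\<bar> \<le> b"
    proof (rule AE_tensor_power_SucI)
      show "{y \<in> space (tensor_power M (Suc k)). \<bar>h (y 0)\<bar> \<le> b} \<in> sets (tensor_power M (Suc k))"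
        using c by measurable
      show "AE w in M. AE y in tensor_power M k. \<bar>h (vcons k w y 0)\<bar> \<le> b"
        using b by eventually_elim simp
    qed
    then have "AE y in tensor_power M (Suc k). ennreal ((neutral h F (Suc k) y)\<^sup>2) \<le> ennreal (b\<^sup>2) * ennreal ((F (Suc k) y)\<^sup>2)"
    proof eventually_elim
      case (elim y)
      then have "(h (y 0))\<^sup>2 \<le> b\<^sup>2" by (metis abs_ge_zero power2_abs power_mono)
      then show ?case
        by (auto simp: neutral_def power_mult_distrib ennreal_mult[symmetric] intro!: ennreal_leI mult_right_mono)
    qed
    then have "(\<integral>\<^sup>+y. ennreal ((neutral h F (Suc k) y)\<^sup>2) \<partial>tensor_power M (Suc k))
        \<le> (\<integral>\<^sup>+y. ennreal (b\<^sup>2) * ennreal ((F (Suc k) y)\<^sup>2) \<partial>tensor_power M (Suc k))"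
      by (rule nn_integral_mono_AE)
    also have "\<dots> = ennreal (b\<^sup>2) * (\<integral>\<^sup>+y. ennreal ((F (Suc k) y)\<^sup>2) \<partial>tensor_power M (Suc k))"
      by (rule nn_integral_cmult) measurable
    finally show ?thesis unfolding Suc .
  qed (simp add: neutral_def)
  then have "sqnorm M (neutral h F) \<le> (\<Sum>m. ennreal (b\<^sup>2) * (\<integral>\<^sup>+y. ennreal ((F m y)\<^sup>2) \<partial>tensor_power M m))"
    unfolding sqnorm_def by (intro suminf_le summableI)
  also have "\<dots> = ennreal (b\<^sup>2) * sqnorm M F" by (simp add: sqnorm_def)
  finally show ?thesis .
qed

text \<open>
  The constants come from splitting off the creation part first and then separating the two others, each time at the
  cost of a factor \<open>2\<close>.
\<close>

lemma sqnorm_field_op: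
  assumes h: "h \<in> borel_measurable M" and F: "fock_measurable M F" and b: "AE z in M. \<bar>snd z * h z\<bar> \<le> b"
  shows "sqnorm M (field_op M h F) \<le> (6 * (\<integral>\<^sup>+z. ennreal ((h z)\<^sup>2) \<partial>M) + 4 * ennreal (b\<^sup>2)) * sqnorm M F"
proof -
  let ?a = "\<integral>\<^sup>+z. ennreal ((h z)\<^sup>2) \<partial>M" and ?N = "sqnorm M F"
  let ?s = "\<lambda>z. snd z * h z"
  have m: "fock_measurable M (creation h F)" "fock_measurable M (annihilation M h F)" "fock_measurable M (neutral ?s F)"
    by (intro creation_measurable annihilation_measurable neutral_measurable measurable_snd_mult h F)+
  have "field_op M h F = (\<lambda>m y. creation h F m y + (annihilation M h F m y + neutral ?s F m y))"
    by (intro ext) (simp add: field_op_def fock_add_def case_prod_beta')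
  then have "sqnorm M (field_op M h F)
      \<le> 2 * sqnorm M (creation h F) + 2 * sqnorm M (\<lambda>m y. annihilation M h F m y + neutral ?s F m y)"
    using sqnorm_add[OF m(1) fock_measurable_add[OF m(2,3)]] by simp
  also have "\<dots> \<le> 2 * (?a * ?N) + 2 * (2 * (?a * ?N) + 2 * (ennreal (b\<^sup>2) * ?N))"
    using sqnorm_creation[OF h F] sqnorm_annihilation[OF h F] sqnorm_neutral[OF measurable_snd_mult[OF h] F b]
    by (intro add_mono mult_left_mono order_trans[OF sqnorm_add[OF m(2,3)]]) auto
  also have "\<dots> = (2 * ?a + 4 * ?a + 4 * ennreal (b\<^sup>2)) * ?N"
    by (simp add: distrib_right distrib_left mult.assoc[symmetric] add.assoc)
  also have "2 * ?a + 4 * ?a = 6 * ?a" by (simp flip: distrib_right)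
  finally show ?thesis .
qed

lemma tame_square_finite:
  assumes "h \<in> tame"
  shows "(\<integral>\<^sup>+z. ennreal ((h z)\<^sup>2) \<partial>M) < \<infinity>"
  using tame_integrable[OF tame_mult[OF assms assms]] by (simp add: integrable_iff_bounded power2_eq_square)

lemma field_op_bounded:
  assumes h: "h \<in> tame"
  obtains C where "0 < C" "\<And>F. fock_measurable M F \<Longrightarrow> sqnorm M (field_op M h F) \<le> ennreal C * sqnorm M F"
proof -
  obtain b where b: "AE z in M. \<bar>snd z * h z\<bar> \<le> b" using tameE[OF tame_snd[OF h]] by metis
  let ?c = "6 * (\<integral>\<^sup>+z. ennreal ((h z)\<^sup>2) \<partial>M) + 4 * ennreal (b\<^sup>2)"
  have fin: "?c < \<infinity>" using tame_square_finite[OF h] by (simp add: ennreal_mult_less_top)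
  then have le: "?c \<le> ennreal (enn2real ?c + 1)"
    by (metis add.commute enn2real_nonneg ennreal_enn2real ennreal_leI infinity_ennreal_def le_add_same_cancel2 zero_le_one)
  show thesis
  proof (rule that[of "enn2real ?c + 1"])
    show "0 < enn2real ?c + 1" using enn2real_nonneg[of ?c] by linarith
    fix F assume "fock_measurable M F"
    from sqnorm_field_op[OF tame_measurable[OF h] this b]
    show "sqnorm M (field_op M h F) \<le> ennreal (enn2real ?c + 1) * sqnorm M F"
      by (rule order_trans) (intro mult_right_mono le, simp)
  qed
qed

section \<open>The Fock norm on tame vectors\<close>

lemma tame_vectors_sqnorm:
  assumes "F \<in> tame_vectors"
  shows "F \<in> fock_space M" and "sqnorm M F = ennreal ((fock_norm M F)\<^sup>2)"
proof -
  obtain D where D: "\<And>m y. D < m \<Longrightarrow> F m y = 0" using tame_vectorsE[OF assms] by metis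
  have Fm [measurable]: "F m \<in> borel_measurable (tensor_power M m)" for m
    using tame_vectors_measurable[OF assms] by (simp add: fock_measurable_def)
  have int: "integrable (tensor_power M m) (\<lambda>y. (F m y)\<^sup>2)" for m
    using tame_vectors_component_finite[OF assms, of m] by (simp add: integrable_iff_bounded)
  let ?I = "\<lambda>m. \<integral>y. (F m y)\<^sup>2 \<partial>tensor_power M m"
  have "?I m = 0" if "m \<notin> {..D}" for m using that D[of m] by simp
  then have s: "summable ?I" by (intro summable_finite[of "{..D}"]) auto
  show "F \<in> fock_space M" unfolding fock_space_def using Fm int s by blast
  have nn: "0 \<le> ?I m" for m by simp
  have "sqnorm M F = (\<Sum>m. ennreal (?I m))"
    unfolding sqnorm_def by (intro suminf_cong nn_integral_eq_integral int) simp
  also have "\<dots> = ennreal (\<Sum>m. ?I m)" using nn s by (rule suminf_ennreal2)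
  also have "(\<Sum>m. ?I m) = (fock_norm M F)\<^sup>2"
    unfolding fock_norm_def using suminf_nonneg[OF s nn] by simp
  finally show "sqnorm M F = ennreal ((fock_norm M F)\<^sup>2)" .
qed

lemma fock_norm_nonneg: "F \<in> tame_vectors \<Longrightarrow> 0 \<le> fock_norm M F"
proof -
  assume "F \<in> tame_vectors"
  then have "summable (\<lambda>m. \<integral>y. (F m y)\<^sup>2 \<partial>tensor_power M m)"
    using tame_vectors_sqnorm(1) by (simp add: fock_space_def)
  then show ?thesis unfolding fock_norm_def by (simp add: suminf_nonneg)
qed

text \<open>
  The weighted inequality for squares is applied with the optimal weight \<open>b / a\<close>.
\<close>

lemma fock_norm_triangle:
  assumes F: "F \<in> tame_vectors" and G: "G \<in> tame_vectors"
  shows "fock_norm M (\<lambda>m y. F m y + G m y) \<le> fock_norm M F + fock_norm M G"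
proof (rule field_le_epsilon)
  fix e :: real assume e: "0 < e"
  let ?H = "\<lambda>m y. F m y + G m y"
  have H: "?H \<in> tame_vectors" by (rule tame_vectors_add[OF F G])
  \<comment> \<open>The summand \<open>e / 2\<close> avoids division by a vanishing norm.\<close>
  define a b where "a = fock_norm M F + e / 2" and "b = fock_norm M G + e / 2"
  have ab: "0 < a" "0 < b" "0 \<le> fock_norm M F" "fock_norm M F \<le> a" "0 \<le> fock_norm M G" "fock_norm M G \<le> b"
    using fock_norm_nonneg[OF F] fock_norm_nonneg[OF G] e by (auto simp: a_def b_def)
  define p q where "p = 1 + b / a" and "q = 1 + 1 / (b / a)"
  have pq: "0 \<le> p" "0 \<le> q" using ab by (simp_all add: p_def q_def)
  have "0 < b / a" using ab by simp
  from sqnorm_add_weighted[OF tame_vectors_measurable[OF F] tame_vectors_measurable[OF G] this]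
  have "ennreal ((fock_norm M ?H)\<^sup>2)
      \<le> ennreal p * ennreal ((fock_norm M F)\<^sup>2) + ennreal q * ennreal ((fock_norm M G)\<^sup>2)"
    unfolding p_def[symmetric] q_def[symmetric] tame_vectors_sqnorm(2)[OF H]
      tame_vectors_sqnorm(2)[OF F] tame_vectors_sqnorm(2)[OF G] .
  also have "\<dots> = ennreal (p * (fock_norm M F)\<^sup>2 + q * (fock_norm M G)\<^sup>2)"
    using pq by (simp add: ennreal_mult)
  finally have "(fock_norm M ?H)\<^sup>2 \<le> p * (fock_norm M F)\<^sup>2 + q * (fock_norm M G)\<^sup>2"
    using pq by (simp add: ennreal_le_iff del: ennreal_plus)
  also have "\<dots> \<le> p * a\<^sup>2 + q * b\<^sup>2"
    by (intro add_mono mult_left_mono power_mono ab pq)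
  also have "\<dots> = (a + b)\<^sup>2"
    using ab(1,2) by (simp add: p_def q_def field_simps power2_eq_square)
  finally have "fock_norm M ?H \<le> a + b"
    by (rule power2_le_imp_le) (use ab in simp)
  then show "fock_norm M ?H \<le> fock_norm M F + fock_norm M G + e" by (simp add: a_def b_def)
qed

lemma fock_dist_triangle:
  assumes F: "F \<in> tame_vectors" and G: "G \<in> tame_vectors" and H: "H \<in> tame_vectors"
  shows "fock_dist M F H \<le> fock_dist M F G + fock_dist M G H"
proof -
  have "(\<lambda>m y. F m y - H m y) = (\<lambda>m y. (F m y - G m y) + (G m y - H m y))" by (intro ext) simp
  then show ?thesis
    unfolding fock_dist_def
    using fock_norm_triangle[OF tame_vectors_diff[OF F G] tame_vectors_diff[OF G H]] by simp
qed

lemma fock_dist_commute: "fock_dist M F G = fock_dist M G F"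
  unfolding fock_dist_def fock_norm_def by (simp add: power2_commute)

lemma fock_dist_self: "fock_dist M F F = 0"
  by (simp add: fock_dist_def fock_norm_def)

lemma fock_dist_le:
  assumes F: "F \<in> tame_vectors" and G: "G \<in> tame_vectors" and e: "0 \<le> e"
    and le: "sqnorm M (\<lambda>m y. F m y - G m y) \<le> ennreal (e\<^sup>2)"
  shows "fock_dist M F G \<le> e"
proof -
  have "(fock_norm M (\<lambda>m y. F m y - G m y))\<^sup>2 \<le> e\<^sup>2"
    using le by (simp add: tame_vectors_sqnorm(2)[OF tame_vectors_diff[OF F G]])
  then show ?thesis unfolding fock_dist_def using e by (rule power2_le_imp_le)
qed

section \<open>Vectors approximable by words\<close>

text \<open>
  The vector \<open>X(f\<^sub>1) \<cdots> X(f\<^sub>n) \<Omega>\<close> for the list \<open>f\<^sub>1, \<dots>, f\<^sub>n\<close>.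
\<close>

definition word :: "('t \<Rightarrow> real) list \<Rightarrow> ('t \<times> real) fock" where
  "word fs = foldr (\<lambda>f. field_op M (\<lambda>z. f (fst z))) fs vacuum"

inductive_set word_span :: "('t \<times> real) fock set" where
  zero: "(\<lambda>_ _. 0) \<in> word_span"
| add_word: "set fs \<subseteq> compactly_supported \<Longrightarrow> G \<in> word_span \<Longrightarrow>
    (\<lambda>m y. c * word fs m y + G m y) \<in> word_span"

lemma word_tame: "set fs \<subseteq> compactly_supported \<Longrightarrow> word fs \<in> tame_vectors"
  by (induction fs) (auto simp: word_def vacuum_tame intro!: field_op_tame compactly_supported_tame)

lemma word_span_tame: "G \<in> word_span \<Longrightarrow> G \<in> tame_vectors"
proof (induction rule: word_span.induct)
  case zero
  show ?case using tame_vectors_scale[OF vacuum_tame, of 0] by simp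
next
  case (add_word fs G c)
  then show ?case by (intro tame_vectors_add tame_vectors_scale word_tame)
qed

lemma word_span_add: "F \<in> word_span \<Longrightarrow> G \<in> word_span \<Longrightarrow> (\<lambda>m y. F m y + G m y) \<in> word_span"
proof (induction rule: word_span.induct)
  case (add_word fs H c)
  then show ?case using word_span.add_word[of fs "\<lambda>m y. H m y + G m y" c] by (simp add: add.assoc)
qed simp

lemma word_span_scale: "F \<in> word_span \<Longrightarrow> (\<lambda>m y. a * F m y) \<in> word_span"
proof (induction rule: word_span.induct)
  case (add_word fs H c)
  then show ?case using word_span.add_word[of fs "\<lambda>m y. a * H m y" "a * c"] by (simp add: distrib_left mult.assoc)
qed (simp add: word_span.zero)

lemma vacuum_word_span: "vacuum \<in> word_span"
  using word_span.add_word[of "[]" "\<lambda>_ _. 0" 1] word_span.zero by (simp add: word_def)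

lemma word_span_field_op:
  assumes f: "f \<in> compactly_supported"
  shows "F \<in> word_span \<Longrightarrow> field_op M (\<lambda>z. f (fst z)) F \<in> word_span"
proof (induction rule: word_span.induct)
  case zero
  have "field_op M (\<lambda>z. f (fst z)) (\<lambda>_ _. 0) = (\<lambda>_ _. 0)"
    using field_op_scale_vector[of _ 0 "\<lambda>_ _. 0"] by simp
  then show ?case using word_span.zero by simp
next
  case (add_word fs G c)
  let ?X = "field_op M (\<lambda>z. f (fst z))"
  have "?X (\<lambda>m y. c * word fs m y + G m y) = (\<lambda>m y. c * word (f # fs) m y + ?X G m y)"
    using add_word
    by (simp add: field_op_add_vector[OF compactly_supported_tame[OF f] tame_vectors_scale[OF word_tame] word_span_tame]
        field_op_scale_vector) (simp add: word_def)
  then show ?case using add_word f by (simp add: word_span.add_word)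
qed

text \<open>
  The closure of the span of the words, taken inside the tame vectors.
\<close>

definition approximable :: "('t \<times> real) fock set" where
  "approximable = {F \<in> tame_vectors.
     \<forall>\<epsilon>>0. \<exists>G\<in>word_span. sqnorm M (\<lambda>m y. F m y - G m y) \<le> ennreal \<epsilon>}"

lemma approximable_tame: "F \<in> approximable \<Longrightarrow> F \<in> tame_vectors"
  by (simp add: approximable_def)

lemma approximable_dense:
  "F \<in> approximable \<Longrightarrow> 0 < \<epsilon> \<Longrightarrow> \<exists>G\<in>word_span. sqnorm M (\<lambda>m y. F m y - G m y) \<le> ennreal \<epsilon>"
  by (simp add: approximable_def)

lemma approximable_measurable: "F \<in> approximable \<Longrightarrow> fock_measurable M F"
  by (intro tame_vectors_measurable approximable_tame)

lemma word_span_approximable: "G \<in> word_span \<Longrightarrow> G \<in> approximable"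
  by (auto simp: approximable_def word_span_tame sqnorm_def intro!: bexI[of _ G])

lemma sqnorm_diff_triangle:
  assumes "F \<in> tame_vectors" "G \<in> tame_vectors" "H \<in> tame_vectors"
  shows "sqnorm M (\<lambda>m y. F m y - H m y)
    \<le> 2 * sqnorm M (\<lambda>m y. F m y - G m y) + 2 * sqnorm M (\<lambda>m y. G m y - H m y)"
proof -
  have "(\<lambda>m y. F m y - H m y) = (\<lambda>m y. (F m y - G m y) + (G m y - H m y))" by (intro ext) simp
  then show ?thesis
    using sqnorm_add[OF tame_vectors_measurable[OF tame_vectors_diff[OF assms(1,2)]]
        tame_vectors_measurable[OF tame_vectors_diff[OF assms(2,3)]]] by simp
qed

lemma approximable_closed:
  assumes F: "F \<in> tame_vectors"
    and ex: "\<And>\<epsilon>. 0 < \<epsilon> \<Longrightarrow> \<exists>G\<in>approximable. sqnorm M (\<lambda>m y. F m y - G m y) \<le> ennreal \<epsilon>"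
  shows "F \<in> approximable"
  unfolding approximable_def
proof (intro CollectI conjI allI impI F)
  fix \<epsilon> :: real assume e: "0 < \<epsilon>"
  \<comment> \<open>Each of the two errors enters with the factor \<open>2\<close> of the crude triangle inequality.\<close>
  obtain G where G: "G \<in> approximable" "sqnorm M (\<lambda>m y. F m y - G m y) \<le> ennreal (\<epsilon> / 4)"
    using ex[of "\<epsilon> / 4"] e by auto
  obtain H where H: "H \<in> word_span" "sqnorm M (\<lambda>m y. G m y - H m y) \<le> ennreal (\<epsilon> / 4)"
    using approximable_dense[OF G(1), of "\<epsilon> / 4"] e by auto
  have "sqnorm M (\<lambda>m y. F m y - H m y) \<le> 2 * ennreal (\<epsilon> / 4) + 2 * ennreal (\<epsilon> / 4)"
    by (rule order_trans[OF sqnorm_diff_triangle[OF F approximable_tame[OF G(1)] word_span_tame[OF H(1)]]])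
      (intro add_mono mult_left_mono G H, auto)
  also have "\<dots> = ennreal \<epsilon>"
    using e by (simp add: ennreal_mult[symmetric] ennreal_plus[symmetric] flip: ennreal_numeral del: ennreal_plus)
  finally show "\<exists>G\<in>word_span. sqnorm M (\<lambda>m y. F m y - G m y) \<le> ennreal \<epsilon>" using H(1) by blast
qed

lemma approximable_add:
  assumes F: "F \<in> approximable" and G: "G \<in> approximable"
  shows "(\<lambda>m y. F m y + G m y) \<in> approximable"
  unfolding approximable_def
proof (intro CollectI conjI allI impI tame_vectors_add approximable_tame F G)
  fix \<epsilon> :: real assume e: "0 < \<epsilon>"
  obtain F' where F': "F' \<in> word_span" "sqnorm M (\<lambda>m y. F m y - F' m y) \<le> ennreal (\<epsilon> / 4)"
    using approximable_dense[OF F, of "\<epsilon> / 4"] e by auto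
  obtain G' where G': "G' \<in> word_span" "sqnorm M (\<lambda>m y. G m y - G' m y) \<le> ennreal (\<epsilon> / 4)"
    using approximable_dense[OF G, of "\<epsilon> / 4"] e by auto
  have "sqnorm M (\<lambda>m y. (F m y - F' m y) + (G m y - G' m y)) \<le> 2 * ennreal (\<epsilon> / 4) + 2 * ennreal (\<epsilon> / 4)"
  proof (rule order_trans[OF sqnorm_add])
    show "fock_measurable M (\<lambda>m y. F m y - F' m y)" "fock_measurable M (\<lambda>m y. G m y - G' m y)"
      by (intro tame_vectors_measurable tame_vectors_diff approximable_tame word_span_tame F G F' G')+
  qed (intro add_mono mult_left_mono F' G', auto)
  also have "\<dots> = ennreal \<epsilon>"
    using e by (simp add: ennreal_mult[symmetric] ennreal_plus[symmetric] flip: ennreal_numeral del: ennreal_plus)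
  finally have "sqnorm M (\<lambda>m y. F m y + G m y - (F' m y + G' m y)) \<le> ennreal \<epsilon>"
    by (simp add: algebra_simps)
  then show "\<exists>H\<in>word_span. sqnorm M (\<lambda>m y. F m y + G m y - H m y) \<le> ennreal \<epsilon>"
    using word_span_add[OF F'(1) G'(1)] by (intro bexI[of _ "\<lambda>m y. F' m y + G' m y"])
qed

text \<open>
  A map that is Lipschitz along the span of the words and sends this span into its closure also maps the closure
  into itself.
\<close>

lemma approximable_bounded_image:
  assumes F: "F \<in> approximable" and L: "L F \<in> tame_vectors" and C: "0 < C"
    and span: "\<And>G. G \<in> word_span \<Longrightarrow> L G \<in> approximable"
    and bound: "\<And>G. G \<in> word_span \<Longrightarrow> sqnorm M (\<lambda>m y. L F m y - L G m y) \<le> ennreal C * sqnorm M (\<lambda>m y. F m y - G m y)"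
  shows "L F \<in> approximable"
proof (rule approximable_closed[OF L])
  fix \<epsilon> :: real assume e: "0 < \<epsilon>"
  then obtain G where G: "G \<in> word_span" "sqnorm M (\<lambda>m y. F m y - G m y) \<le> ennreal (\<epsilon> / C)"
    using approximable_dense[OF F, of "\<epsilon> / C"] C by auto
  have "sqnorm M (\<lambda>m y. L F m y - L G m y) \<le> ennreal C * ennreal (\<epsilon> / C)"
    by (rule order_trans[OF bound[OF G(1)]]) (intro mult_left_mono G(2), simp)
  also have "\<dots> = ennreal \<epsilon>" using C e by (simp flip: ennreal_mult)
  finally show "\<exists>H\<in>approximable. sqnorm M (\<lambda>m y. L F m y - H m y) \<le> ennreal \<epsilon>"
    using span[OF G(1)] by blast
qed

lemma approximable_scale:
  assumes F: "F \<in> approximable"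
  shows "(\<lambda>m y. c * F m y) \<in> approximable"
proof (rule approximable_bounded_image[where L="\<lambda>F m y. c * F m y" and C="c\<^sup>2 + 1", OF F])
  fix G assume G: "G \<in> word_span"
  show "(\<lambda>m y. c * G m y) \<in> approximable" by (intro word_span_approximable word_span_scale G)
  have "sqnorm M (\<lambda>m y. c * F m y - c * G m y) = ennreal (c\<^sup>2) * sqnorm M (\<lambda>m y. F m y - G m y)"
    unfolding right_diff_distrib[symmetric]
    by (intro sqnorm_scale tame_vectors_measurable tame_vectors_diff approximable_tame word_span_tame F G)
  also have "\<dots> \<le> ennreal (c\<^sup>2 + 1) * sqnorm M (\<lambda>m y. F m y - G m y)"
    by (intro mult_right_mono ennreal_leI) auto
  finally show "sqnorm M (\<lambda>m y. c * F m y - c * G m y) \<le> \<dots>" .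
next
  show "0 < c\<^sup>2 + 1" by (rule add_nonneg_pos) auto
qed (intro tame_vectors_scale approximable_tame F)

lemma field_op_diff_vector:
  assumes "h \<in> tame" "F \<in> tame_vectors" "G \<in> tame_vectors"
  shows "(\<lambda>m y. field_op M h F m y - field_op M h G m y) = field_op M h (\<lambda>m y. F m y - G m y)"
  using field_op_add_vector[OF assms(1,2) tame_vectors_scale[OF assms(3), of "-1"]]
  by (simp add: field_op_scale_vector[of h "-1" G, simplified])

lemma approximable_field_op:
  assumes f: "f \<in> compactly_supported" and F: "F \<in> approximable"
  shows "field_op M (\<lambda>z. f (fst z)) F \<in> approximable"
proof -
  let ?X = "field_op M (\<lambda>z. f (fst z))"
  note ft = compactly_supported_tame[OF f]
  obtain C where C: "0 < C" "\<And>F. fock_measurable M F \<Longrightarrow> sqnorm M (?X F) \<le> ennreal C * sqnorm M F"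
    using field_op_bounded[OF ft] by metis
  show ?thesis
  proof (rule approximable_bounded_image[where L="?X", OF F _ C(1)])
    fix G assume G: "G \<in> word_span"
    then show "?X G \<in> approximable" by (intro word_span_approximable word_span_field_op f)
    show "sqnorm M (\<lambda>m y. ?X F m y - ?X G m y) \<le> ennreal C * sqnorm M (\<lambda>m y. F m y - G m y)"
      unfolding field_op_diff_vector[OF ft approximable_tame[OF F] word_span_tame[OF G]]
      by (intro C(2) tame_vectors_measurable tame_vectors_diff approximable_tame word_span_tame F G)
  qed (intro field_op_tame ft approximable_tame F)
qed

section \<open>Kernel operators\<close>

lemma measurable_prod_tame:
  fixes \<rho> :: "'t \<times> real \<Rightarrow> real"
  assumes [measurable]: "\<rho> \<in> borel_measurable M"
  shows "(\<lambda>y. \<Prod>i<m. \<rho> (y i)) \<in> borel_measurable (tensor_power M m)"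
proof (intro borel_measurable_prod)
  show "(\<lambda>y. \<rho> (y i)) \<in> borel_measurable (tensor_power M m)" if "i \<in> {..<m}" for i
    using that by (intro measurable_compose[OF measurable_coordinate assms]) simp
qed

text \<open>
  Only finitely many components are non-zero, and each of them converges by dominated convergence.
\<close>

lemma sqnorm_dominated_convergence:
  assumes E: "\<And>n. fock_measurable M (E n)" and \<rho>: "\<rho> \<in> tame"
    and b: "\<And>n m y. \<bar>E n m y\<bar> \<le> B * (\<Prod>i<m. \<rho> (y i))" and D: "\<And>n m y. D < m \<Longrightarrow> E n m y = 0"
    and l: "\<And>m. AE y in tensor_power M m. (\<lambda>n. E n m y) \<longlonglongrightarrow> 0"
  shows "(\<lambda>n. sqnorm M (E n)) \<longlonglongrightarrow> 0"
proof -
  have Em: "E n m \<in> borel_measurable (tensor_power M m)" for n m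
    using E by (simp add: fock_measurable_def)
  have comp: "(\<lambda>n. \<integral>\<^sup>+y. ennreal ((E n m y)\<^sup>2) \<partial>tensor_power M m) \<longlonglongrightarrow> (\<integral>\<^sup>+y. 0 \<partial>tensor_power M m)" for m
  proof (rule nn_integral_dominated_convergence)
    show "(\<lambda>y. ennreal ((E n m y)\<^sup>2)) \<in> borel_measurable (tensor_power M m)" for n
      using Em[of n m] by measurable
    show "(\<lambda>y. ennreal ((B * (\<Prod>i<m. \<rho> (y i)))\<^sup>2)) \<in> borel_measurable (tensor_power M m)"
      using measurable_prod_tame[OF tame_measurable[OF \<rho>], of m] by measurable
    show "AE y in tensor_power M m. ennreal ((E n m y)\<^sup>2) \<le> ennreal ((B * (\<Prod>i<m. \<rho> (y i)))\<^sup>2)" for n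
    proof (intro AE_I2 ennreal_leI)
      fix y show "(E n m y)\<^sup>2 \<le> (B * (\<Prod>i<m. \<rho> (y i)))\<^sup>2"
        using power_mono[OF b[of n m y] abs_ge_zero, of 2] by simp
    qed
    show "(\<integral>\<^sup>+y. ennreal ((B * (\<Prod>i<m. \<rho> (y i)))\<^sup>2) \<partial>tensor_power M m) < \<infinity>"
      by (rule nn_integral_tame_square_prod[OF \<rho>])
    show "AE y in tensor_power M m. (\<lambda>n. ennreal ((E n m y)\<^sup>2)) \<longlonglongrightarrow> 0"
      using l[of m]
    proof eventually_elim
      case (elim y)
      then have "(\<lambda>n. (E n m y)\<^sup>2) \<longlonglongrightarrow> 0\<^sup>2" by (rule tendsto_power)
      then have "(\<lambda>n. ennreal ((E n m y)\<^sup>2)) \<longlonglongrightarrow> ennreal (0\<^sup>2)" by (rule tendsto_ennrealI)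
      then show ?case by simp
    qed
  qed simp
  have "sqnorm M (E n) = (\<Sum>m\<le>D. \<integral>\<^sup>+y. ennreal ((E n m y)\<^sup>2) \<partial>tensor_power M m)" for n
    unfolding sqnorm_def by (rule suminf_finite) (auto simp: D)
  moreover have "(\<lambda>n. \<Sum>m\<le>D. \<integral>\<^sup>+y. ennreal ((E n m y)\<^sup>2) \<partial>tensor_power M m) \<longlonglongrightarrow> (\<Sum>m\<le>D. 0)"
    using comp by (intro tendsto_sum) simp
  ultimately show ?thesis by simp
qed

text \<open>
  The extension of \<open>h \<otimes> k \<mapsto> x(h) x(k)\<close> to functions of two variables; see \<open>kernel_op_product\<close>.
\<close>

definition kernel_op ::
    "('t \<times> real \<Rightarrow> 't \<times> real \<Rightarrow> real) \<Rightarrow> ('t \<times> real) fock \<Rightarrow> ('t \<times> real) fock" where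
  "kernel_op \<psi> F = can_op M (\<lambda>z. can_op M (\<lambda>w m y. \<psi> z w * F m y))"

definition kernel_bounded ::
    "('t \<times> real \<Rightarrow> real) \<Rightarrow> ('t \<times> real \<Rightarrow> real) \<Rightarrow> ('t \<times> real \<Rightarrow> 't \<times> real \<Rightarrow> real) \<Rightarrow> bool" where
  "kernel_bounded \<alpha> \<beta> \<psi> \<longleftrightarrow> (\<lambda>p. \<psi> (fst p) (snd p)) \<in> borel_measurable (M \<Otimes>\<^sub>M M) \<and>
     (\<forall>z w. \<bar>\<psi> z w\<bar> \<le> \<alpha> z * \<beta> w)"

lemma kernel_op_product: "kernel_op (\<lambda>z w. h z * k w) F = field_op M h (field_op M k F)"
proof -
  have "can_op M (\<lambda>w m y. h z * k w * F m y) = (\<lambda>m y. h z * field_op M k F m y)" for z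
    unfolding field_op_eq_can_op mult.assoc by (intro ext can_op_scale)
  then show ?thesis by (simp add: kernel_op_def field_op_eq_can_op[of M h])
qed

lemma kernel_op_scale: "kernel_op (\<lambda>z w. c * \<psi> z w) F = (\<lambda>m y. c * kernel_op \<psi> F m y)"
proof -
  have "can_op M (\<lambda>w m y. c * \<psi> z w * F m y) = (\<lambda>m y. c * can_op M (\<lambda>w m y. \<psi> z w * F m y) m y)" for z
    unfolding mult.assoc by (intro ext can_op_scale)
  then show ?thesis unfolding kernel_op_def by (intro ext) (simp add: can_op_scale)
qed

text \<open>
  In a product of two operators the outer variable enters the inner bound only as a factor \<open>a\<close>. Keeping it outside
  the weight makes the inner bound a function of the outer variable that is tame again.
\<close>

lemma can_op_bound_scaled:
  assumes \<alpha>: "\<alpha> \<in> tame" "\<And>z. 0 \<le> \<alpha> z" and \<rho>: "\<rho> \<in> tame" "\<And>z. 0 \<le> \<rho> z" and a: "0 \<le> a"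
    and d: "fock_family_dominated (\<lambda>z. a * \<alpha> z) \<rho> G"
  shows "\<bar>can_op M G m y\<bar> \<le> a * ((2 + (\<integral>z. \<alpha> z * \<rho> z \<partial>M)) * (\<Prod>i<m. can_weight \<alpha> \<rho> (y i)))"
proof -
  have "fock_family_dominated \<alpha> \<rho> (\<lambda>z m y. G z m y / a)"
    unfolding fock_family_dominated_def
  proof (intro allI)
    fix z m and y :: "nat \<Rightarrow> 't \<times> real"
    have "\<bar>G z m y\<bar> \<le> a * (\<alpha> z * (\<Prod>i<m. \<rho> (y i)))"
      using d unfolding fock_family_dominated_def by (metis mult.assoc)
    moreover have "0 \<le> \<alpha> z * (\<Prod>i<m. \<rho> (y i))"
      by (intro mult_nonneg_nonneg prod_nonneg \<alpha>(2)) (simp add: \<rho>(2))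
    ultimately show "\<bar>G z m y / a\<bar> \<le> \<alpha> z * (\<Prod>i<m. \<rho> (y i))"
      using a by (cases "a = 0") (simp_all add: field_simps)
  qed
  then have "\<bar>can_op M (\<lambda>z m y. G z m y / a) m y\<bar> \<le> (2 + (\<integral>z. \<alpha> z * \<rho> z \<partial>M)) * (\<Prod>i<m. can_weight \<alpha> \<rho> (y i))"
    by (rule can_op_bound[OF \<alpha> \<rho>])
  moreover have "can_op M G m y = a * can_op M (\<lambda>z m y. G z m y / a) m y"
  proof -
    have "G z m y = 0" if "a = 0" for z m y
      using d that unfolding fock_family_dominated_def by (metis abs_le_zero_iff mult_zero_left)
    then have "G = (\<lambda>z m y. a * (G z m y / a))" by (intro ext) auto
    then show ?thesis by (metis (no_types) can_op_scale)
  qed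
  ultimately show ?thesis using a by (simp add: abs_mult mult_left_mono)
qed

lemma kernel_inner_measurable:
  assumes \<psi>: "kernel_bounded \<alpha> \<beta> \<psi>" and F: "fock_measurable M F"
  shows "fock_family_measurable M (\<lambda>w m y. \<psi> z w * F m y)"
    and "fock_family_measurable M (\<lambda>z. can_op M (\<lambda>w m y. \<psi> z w * F m y))"
proof -
  have \<psi>m: "(\<lambda>p. \<psi> (fst p) (snd p)) \<in> borel_measurable (M \<Otimes>\<^sub>M M)"
    using \<psi> by (simp add: kernel_bounded_def)
  have "(\<lambda>w. (z, w)) \<in> measurable M (M \<Otimes>\<^sub>M M)"
    by (intro measurable_Pair measurable_const) (simp_all add: space_M)
  from measurable_compose[OF this \<psi>m] show "fock_family_measurable M (\<lambda>w m y. \<psi> z w * F m y)"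
    by (intro fock_family_measurable_mult F) simp
  show "fock_family_measurable M (\<lambda>z. can_op M (\<lambda>w m y. \<psi> z w * F m y))"
  proof (rule can_op_family_measurable)
    fix m
    have Fm: "F m \<in> borel_measurable (tensor_power M m)" using F by (simp add: fock_measurable_def)
    let ?S = "M \<Otimes>\<^sub>M (M \<Otimes>\<^sub>M tensor_power M m)"
    have "(\<lambda>p. (fst p, fst (snd p))) \<in> measurable ?S (M \<Otimes>\<^sub>M M)" by measurable
    from measurable_compose[OF this \<psi>m] have "(\<lambda>p. \<psi> (fst p) (fst (snd p))) \<in> borel_measurable ?S" by simp
    moreover have "(\<lambda>p. snd (snd p)) \<in> measurable ?S (tensor_power M m)" by measurable
    from measurable_compose[OF this Fm] have "(\<lambda>p. F m (snd (snd p))) \<in> borel_measurable ?S" .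
    ultimately show "(\<lambda>(z, w, y). \<psi> z w * F m y) \<in> borel_measurable ?S"
      by (simp add: case_prod_beta')
  qed
qed

lemma kernel_inner_dominated:
  assumes \<psi>: "kernel_bounded \<alpha> \<beta> \<psi>"
    and F: "\<And>m y. \<bar>F m y\<bar> \<le> B * (\<Prod>i<m. \<rho> (y i))"
  shows "fock_family_dominated (\<lambda>w. \<alpha> z * (\<beta> w * B)) \<rho> (\<lambda>w m y. \<psi> z w * F m y)"
  unfolding fock_family_dominated_def
proof (intro allI)
  fix w m and y :: "nat \<Rightarrow> 't \<times> real"
  have p: "\<bar>\<psi> z w\<bar> \<le> \<alpha> z * \<beta> w" using \<psi> by (simp only: kernel_bounded_def)
  have "\<bar>\<psi> z w * F m y\<bar> \<le> (\<alpha> z * \<beta> w) * (B * (\<Prod>i<m. \<rho> (y i)))"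
    unfolding abs_mult by (rule mult_mono[OF p F order_trans[OF abs_ge_zero p] abs_ge_zero])
  then show "\<bar>\<psi> z w * F m y\<bar> \<le> \<alpha> z * (\<beta> w * B) * (\<Prod>i<m. \<rho> (y i))" by (simp add: mult.assoc)
qed

lemma tame_constants: "\<beta> \<in> tame \<Longrightarrow> (\<lambda>w. a * (\<beta> w * b)) \<in> tame"
  using tame_scale[of \<beta> "a * b"] by (simp add: mult_ac)

lemma kernel_outer_dominated:
  assumes \<alpha>: "\<And>z. 0 \<le> \<alpha> z" and \<beta>: "\<beta> \<in> tame" "\<And>z. 0 \<le> \<beta> z" and \<psi>: "kernel_bounded \<alpha> \<beta> \<psi>"
    and \<rho>: "\<rho> \<in> tame" "\<And>z. 0 \<le> \<rho> z" and B: "0 \<le> B"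
    and F: "\<And>m y. \<bar>F m y\<bar> \<le> B * (\<Prod>i<m. \<rho> (y i))"
  shows "fock_family_dominated (\<lambda>z. \<alpha> z * (2 + (\<integral>w. (\<beta> w * B) * \<rho> w \<partial>M))) (can_weight (\<lambda>w. \<beta> w * B) \<rho>)
    (\<lambda>z. can_op M (\<lambda>w m y. \<psi> z w * F m y))"
  unfolding fock_family_dominated_def
proof (intro allI)
  fix z m and y :: "nat \<Rightarrow> 't \<times> real"
  have t: "(\<lambda>w. \<beta> w * B) \<in> tame" using tame_constants[OF \<beta>(1), of 1 B] by simp
  have "\<bar>can_op M (\<lambda>w m y. \<psi> z w * F m y) m y\<bar>
      \<le> \<alpha> z * ((2 + (\<integral>w. (\<beta> w * B) * \<rho> w \<partial>M)) * (\<Prod>i<m. can_weight (\<lambda>w. \<beta> w * B) \<rho> (y i)))"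
    by (rule can_op_bound_scaled[OF t _ \<rho> \<alpha> kernel_inner_dominated[OF \<psi> F]]) (simp add: \<beta>(2) B)
  then show "\<bar>can_op M (\<lambda>w m y. \<psi> z w * F m y) m y\<bar>
      \<le> \<alpha> z * (2 + (\<integral>w. (\<beta> w * B) * \<rho> w \<partial>M)) * (\<Prod>i<m. can_weight (\<lambda>w. \<beta> w * B) \<rho> (y i))"
    by (simp add: mult.assoc)
qed

lemma kernel_op_add:
  assumes \<psi>: "\<alpha> \<in> tame" "\<And>z. 0 \<le> \<alpha> z" "\<beta> \<in> tame" "\<And>z. 0 \<le> \<beta> z" "kernel_bounded \<alpha> \<beta> \<psi>"
    and \<psi>': "\<alpha>' \<in> tame" "\<And>z. 0 \<le> \<alpha>' z" "\<beta>' \<in> tame" "\<And>z. 0 \<le> \<beta>' z" "kernel_bounded \<alpha>' \<beta>' \<psi>'"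
    and F: "F \<in> tame_vectors"
  shows "kernel_op (\<lambda>z w. \<psi> z w + \<psi>' z w) F = (\<lambda>m y. kernel_op \<psi> F m y + kernel_op \<psi>' F m y)"
proof (intro ext)
  fix m y
  obtain \<rho> B D where *: "\<rho> \<in> tame" "\<And>z. 0 \<le> \<rho> z" "0 \<le> B"
    "\<And>m y. \<bar>F m y\<bar> \<le> B * (\<Prod>i<m. \<rho> (y i))" "\<And>m y. D < m \<Longrightarrow> F m y = 0"
    using tame_vectorsE[OF F] by metis
  note Fm = tame_vectors_measurable[OF F]
  note im = kernel_inner_measurable[OF \<psi>(5) Fm] kernel_inner_measurable[OF \<psi>'(5) Fm]
  have inner: "can_op M (\<lambda>w m y. (\<psi> z w + \<psi>' z w) * F m y) =
      (\<lambda>m y. can_op M (\<lambda>w m y. \<psi> z w * F m y) m y + can_op M (\<lambda>w m y. \<psi>' z w * F m y) m y)" for z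
    unfolding distrib_right
    by (intro ext can_op_add[OF im(1) _ *(1) kernel_inner_dominated[OF \<psi>(5) *(4)]
          im(3) _ *(1) kernel_inner_dominated[OF \<psi>'(5) *(4)]] tame_constants \<psi> \<psi>')
  have t: "(\<lambda>z. \<gamma> z * c) \<in> tame" if "\<gamma> \<in> tame" for \<gamma> c
    using tame_constants[OF that, of 1 c] by simp
  show "kernel_op (\<lambda>z w. \<psi> z w + \<psi>' z w) F m y = kernel_op \<psi> F m y + kernel_op \<psi>' F m y"
    unfolding kernel_op_def inner
    by (rule can_op_add[OF im(2) _ _ kernel_outer_dominated[OF \<psi>(2-5) *(1-4)]
          im(4) _ _ kernel_outer_dominated[OF \<psi>'(2-5) *(1-4)]]) (intro t can_weight_tame \<psi> \<psi>' *)+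
qed

text \<open>
  The bound depends on the kernel only through \<open>\<alpha>\<close> and \<open>\<beta>\<close>, as dominated convergence along a sequence of kernels
  requires.
\<close>

lemma kernel_op_uniform_bound:
  assumes \<alpha>: "\<alpha> \<in> tame" "\<And>z. 0 \<le> \<alpha> z" and \<beta>: "\<beta> \<in> tame" "\<And>z. 0 \<le> \<beta> z" and F: "F \<in> tame_vectors"
  obtains \<rho> B D where "\<rho> \<in> tame" "\<And>z. 0 \<le> \<rho> z" "0 \<le> B"
    "\<And>\<psi> m y. kernel_bounded \<alpha> \<beta> \<psi> \<Longrightarrow> \<bar>kernel_op \<psi> F m y\<bar> \<le> B * (\<Prod>i<m. \<rho> (y i))"
    "\<And>\<psi> m y. D < m \<Longrightarrow> kernel_op \<psi> F m y = 0"
proof -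
  obtain \<rho> B D where *: "\<rho> \<in> tame" "\<And>z. 0 \<le> \<rho> z" "0 \<le> B"
    "\<And>m y. \<bar>F m y\<bar> \<le> B * (\<Prod>i<m. \<rho> (y i))" "\<And>m y. D < m \<Longrightarrow> F m y = 0"
    using tame_vectorsE[OF F] by metis
  have t: "(\<lambda>z. \<gamma> z * c) \<in> tame" if "\<gamma> \<in> tame" for \<gamma> c
    using tame_constants[OF that, of 1 c] by simp
  define \<rho>' where "\<rho>' = can_weight (\<lambda>w. \<beta> w * B) \<rho>"
  define c where "c = 2 + (\<integral>w. (\<beta> w * B) * \<rho> w \<partial>M)"
  have c0: "0 \<le> c" unfolding c_def
    by (intro add_nonneg_nonneg Bochner_Integration.integral_nonneg mult_nonneg_nonneg) (simp_all add: *(2,3) \<beta>(2))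
  have w0: "0 \<le> can_weight \<gamma> \<delta> z" if "\<And>z. 0 \<le> \<gamma> z" "\<And>z. 0 \<le> \<delta> z" for \<gamma> \<delta> z
    using that[of z] by (simp add: can_weight_def)
  have \<rho>': "\<rho>' \<in> tame" "0 \<le> \<rho>' z" for z
    unfolding \<rho>'_def by (intro can_weight_tame t \<beta> *) (intro w0 mult_nonneg_nonneg \<beta> *)
  define \<alpha>' where "\<alpha>' z = \<alpha> z * c" for z
  have \<alpha>': "\<alpha>' \<in> tame" "0 \<le> \<alpha>' z" for z
    using t[OF \<alpha>(1), of c] \<alpha>(2)[of z] c0 by (simp_all add: \<alpha>'_def[abs_def])
  show thesis
  proof (rule that)
    show "can_weight \<alpha>' \<rho>' \<in> tame" by (intro can_weight_tame \<alpha>' \<rho>')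
    show "0 \<le> can_weight \<alpha>' \<rho>' z" for z by (intro w0 \<alpha>' \<rho>')
    show "0 \<le> 2 + (\<integral>z. \<alpha>' z * \<rho>' z \<partial>M)"
      by (intro add_nonneg_nonneg Bochner_Integration.integral_nonneg mult_nonneg_nonneg) (simp_all add: \<alpha>' \<rho>')
    show "\<bar>kernel_op \<psi> F m y\<bar> \<le> (2 + (\<integral>z. \<alpha>' z * \<rho>' z \<partial>M)) * (\<Prod>i<m. can_weight \<alpha>' \<rho>' (y i))"
      if "kernel_bounded \<alpha> \<beta> \<psi>" for \<psi> m y
      unfolding kernel_op_def
      by (rule can_op_bound[OF \<alpha>' \<rho>'])
        (use kernel_outer_dominated[OF \<alpha>(2) \<beta> that *(1-4)] in \<open>simp add: \<alpha>'_def[abs_def] \<rho>'_def c_def\<close>)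
    show "kernel_op \<psi> F m y = 0" if "Suc (Suc D) < m" for \<psi> m y
      unfolding kernel_op_def
      by (rule can_op_high_degree[OF can_op_high_degree that]) (auto simp: *(5))
  qed
qed

lemma kernel_op_tendsto:
  assumes \<alpha>: "\<alpha> \<in> tame" "\<And>z. 0 \<le> \<alpha> z" and \<beta>: "\<beta> \<in> tame" "\<And>z. 0 \<le> \<beta> z"
    and \<psi>: "\<And>n. kernel_bounded \<alpha> \<beta> (\<psi> n)" and F: "F \<in> tame_vectors"
    and l: "\<And>z w. (\<lambda>n. \<psi> n z w) \<longlonglongrightarrow> \<psi>' z w"
  shows "(\<lambda>n. kernel_op (\<psi> n) F m y) \<longlonglongrightarrow> kernel_op \<psi>' F m y"
proof -
  obtain \<rho> B D where *: "\<rho> \<in> tame" "\<And>z. 0 \<le> \<rho> z" "0 \<le> B"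
    "\<And>m y. \<bar>F m y\<bar> \<le> B * (\<Prod>i<m. \<rho> (y i))" "\<And>m y. D < m \<Longrightarrow> F m y = 0"
    using tame_vectorsE[OF F] by metis
  note Fm = tame_vectors_measurable[OF F]
  have t: "(\<lambda>z. \<gamma> z * c) \<in> tame" if "\<gamma> \<in> tame" for \<gamma> c
    using tame_constants[OF that, of 1 c] by simp
  have inner: "(\<lambda>n. can_op M (\<lambda>w m y. \<psi> n z w * F m y) m y) \<longlonglongrightarrow> can_op M (\<lambda>w m y. \<psi>' z w * F m y) m y" for z m y
    by (rule can_op_tendsto[OF kernel_inner_measurable(1)[OF \<psi> Fm] tame_constants[OF \<beta>(1)] *(1)
          kernel_inner_dominated[OF \<psi> *(4)]]) (intro tendsto_mult l tendsto_const)
  show ?thesis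
    unfolding kernel_op_def
    by (rule can_op_tendsto[OF kernel_inner_measurable(2)[OF \<psi> Fm] _ _
          kernel_outer_dominated[OF \<alpha>(2) \<beta> \<psi> *(1-4)] inner]) (intro t can_weight_tame \<alpha> \<beta> *)+
qed

section \<open>Kernels concentrated on the diagonal\<close>

text \<open>
  The diagonal is a null set, because it meets each section in a fibre over a point.
\<close>

lemma AE_distinct_base_points:
  "AE y in tensor_power M (Suc (Suc j)). fst (y 0) \<noteq> fst (y (Suc 0))"
proof (rule AE_tensor_power_SucI)
  have f: "(fst :: 't \<times> real \<Rightarrow> 't) \<in> borel_measurable M"
    unfolding measurable_M by (intro borel_measurable_continuous_onI continuous_intros)
  let ?T = "tensor_power M (Suc (Suc j))"
  have "(\<lambda>y. fst (y i)) \<in> borel_measurable ?T" if "i < Suc (Suc j)" for i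
    by (rule measurable_compose[OF measurable_coordinate[OF that] f])
  then have "(\<lambda>y. (fst (y 0), fst (y (Suc 0)))) \<in> borel_measurable ?T"
    by (intro borel_measurable_Pair) simp_all
  moreover have "open {p :: 't \<times> 't. fst p \<noteq> snd p}"
    by (intro open_Collect_neq continuous_intros)
  ultimately have "(\<lambda>y. (fst (y 0), fst (y (Suc 0)))) -` {p. fst p \<noteq> snd p} \<inter> space ?T \<in> sets ?T"
    by (rule measurable_sets[OF _ borel_open])
  also have "(\<lambda>y. (fst (y 0), fst (y (Suc 0)))) -` {p. fst p \<noteq> snd p} \<inter> space ?T =
      {y \<in> space ?T. fst (y 0) \<noteq> fst (y (Suc 0))}" by auto
  finally show "{y \<in> space ?T. fst (y 0) \<noteq> fst (y (Suc 0))} \<in> sets ?T" .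
  show "AE w in M. AE y in tensor_power M (Suc j). fst (vcons (Suc j) w y 0) \<noteq> fst (vcons (Suc j) w y (Suc 0))"
  proof (rule AE_I2)
    fix w :: "'t \<times> real"
    have "AE y in tensor_power M (Suc j). fst (y 0) \<noteq> fst w"
    proof (rule AE_tensor_power_SucI)
      have "(\<lambda>y. fst (y 0)) \<in> borel_measurable (tensor_power M (Suc j))"
        by (rule measurable_compose[OF measurable_coordinate f]) simp
      then have "(\<lambda>y. fst (y 0)) -` (- {fst w}) \<inter> space (tensor_power M (Suc j)) \<in> sets (tensor_power M (Suc j))"
        by (rule measurable_sets) simp
      also have "(\<lambda>y. fst (y 0)) -` (- {fst w}) \<inter> space (tensor_power M (Suc j)) =
          {y \<in> space (tensor_power M (Suc j)). fst (y 0) \<noteq> fst w}" by auto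
      finally show "{y \<in> space (tensor_power M (Suc j)). fst (y 0) \<noteq> fst w} \<in> sets (tensor_power M (Suc j))" .
      show "AE v in M. AE y in tensor_power M j. fst (vcons j v y 0) \<noteq> fst w"
        using null_fibre[of "fst w"] by eventually_elim simp
    qed
    then show "AE y in tensor_power M (Suc j). fst (vcons (Suc j) w y 0) \<noteq> fst (vcons (Suc j) w y (Suc 0))"
      by eventually_elim auto
  qed
qed

text \<open>
  An integral of \<open>\<delta> z\<close> against its second variable vanishes, since the fibre over the base point of \<open>z\<close> is
  a null set. This removes the inner annihilation. If the outer operator creates, the inner one is evaluated
  at two different coordinates, and the kernel vanishes there for almost every \<open>y\<close>. In the four remaining terms both
  variables coincide: annihilation after creation gives the integral of \<open>h\<close>, annihilation after the neutral part,
  the neutral part after creation and the square of the neutral part give the three parts of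
  \<open>x(s h)\<close>.
\<close>

lemma kernel_op_diagonal:
  assumes h: "h \<in> tame" and F: "F \<in> tame_vectors"
  defines "\<delta> \<equiv> \<lambda>z w. if fst z = fst w then h w else 0"
  shows "AE y in tensor_power M m.
    kernel_op \<delta> F m y = (\<integral>z. h z \<partial>M) * F m y + field_op M (\<lambda>z. snd z * h z) F m y"
proof -
  let ?G = "\<lambda>z. can_op M (\<lambda>w m y. \<delta> z w * F m y)"
  let ?s = "\<lambda>z. snd z * h z"
  have ann0: "(\<integral>w. \<delta> z w * F (Suc m) (vcons m w y) \<partial>M) = 0" for z m y
  proof (rule integral_eq_zero_AE)
    show "AE w in M. \<delta> z w * F (Suc m) (vcons m w y) = 0"
      using null_fibre[of "fst z"] by eventually_elim (simp add: \<delta>_def)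
  qed
  have G: "?G z m y = (case m of 0 \<Rightarrow> 0 | Suc k \<Rightarrow> \<delta> z (y 0) * F k (vtail k y))
      + (if m = 0 then 0 else snd (y 0) * (\<delta> z (y 0) * F m y))" for z m y
    unfolding can_op_def ann0 by simp
  have same: "\<delta> z z = h z" for z by (simp add: \<delta>_def)
  obtain \<rho> B D where *: "\<rho> \<in> tame" "\<And>z. 0 \<le> \<rho> z" "0 \<le> B"
    "\<And>m y. \<bar>F m y\<bar> \<le> B * (\<Prod>i<m. \<rho> (y i))" "\<And>m y. D < m \<Longrightarrow> F m y = 0"
    using tame_vectorsE[OF F] by metis
  have int: "integrable M (\<lambda>w. snd w * h w * F (Suc m) (vcons m w y))" for y
  proof (rule family_integrable[OF _ _ *(1) dominated_mult[OF *(4)]])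
    show "fock_family_measurable M (\<lambda>z m y. snd z * h z * F m y)"
      by (intro fock_family_measurable_mult measurable_snd_mult tame_measurable h tame_vectors_measurable F)
    show "(\<lambda>z. \<bar>snd z * h z\<bar> * B) \<in> tame"
      using tame_constants[OF tame_abs[OF tame_snd[OF h]], of 1 B] by simp
  qed
  have A: "(\<integral>w. ?G w (Suc m) (vcons m w y) \<partial>M)
      = (\<integral>z. h z \<partial>M) * F m y + (\<integral>w. ?s w * F (Suc m) (vcons m w y) \<partial>M)"
    if y: "y \<in> space (tensor_power M m)" for y
  proof -
    have "(\<integral>w. ?G w (Suc m) (vcons m w y) \<partial>M) = (\<integral>w. h w * F m y + ?s w * F (Suc m) (vcons m w y) \<partial>M)"
      by (intro Bochner_Integration.integral_cong refl) (simp add: G same vtail_vcons[OF y] mult.assoc)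
    also have "\<dots> = (\<integral>w. h w * F m y \<partial>M) + (\<integral>w. ?s w * F (Suc m) (vcons m w y) \<partial>M)"
      by (intro Bochner_Integration.integral_add integrable_mult_left tame_integrable h int)
    finally show ?thesis by simp
  qed
  have "AE y in tensor_power M m. (case m of 0 \<Rightarrow> 0 | Suc k \<Rightarrow> ?G (y 0) k (vtail k y)) = 0"
  proof (cases "m < 2")
    case True
    then have "m = 0 \<or> m = Suc 0" by auto
    then show ?thesis by (auto simp: G)
  next
    case False
    then obtain j where m: "m = Suc (Suc j)" by (metis add_2_eq_Suc le_Suc_ex not_less)
    have "?G (y 0) (Suc j) (vtail (Suc j) y) = 0" if "fst (y 0) \<noteq> fst (y (Suc 0))" for y
      unfolding G using that by (simp add: \<delta>_def vtail_def)
    then show ?thesis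
      unfolding m using AE_distinct_base_points[of j] by (auto elim!: eventually_mono)
  qed
  moreover have "AE y in tensor_power M m. y \<in> space (tensor_power M m)" by (rule AE_space)
  ultimately show ?thesis
  proof eventually_elim
    case (elim y)
    have "(if m = 0 then 0 else snd (y 0) * ?G (y 0) m y)
        = (case m of 0 \<Rightarrow> 0 | Suc k \<Rightarrow> ?s (y 0) * F k (vtail k y)) + (if m = 0 then 0 else snd (y 0) * (?s (y 0) * F m y))"
      by (cases m) (simp_all add: G same distrib_left mult.assoc)
    then show ?case
      unfolding kernel_op_def field_op_eq_can_op can_op_def[of M "\<lambda>z. can_op M (\<lambda>w m y. \<delta> z w * F m y)"] elim(1) A[OF elim(2)]
      by (simp add: can_op_def[of M "\<lambda>z m y. snd z * h z * F m y"])
  qed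
qed

end

section \<open>Multiplication of the symbol by the fibre coordinate\<close>

text \<open>
  Products of the functions \<open>1 - (g(t) - g(u))\<^sup>2\<close>. They are equal to \<open>1\<close> on the diagonal, and expanding the squares
  writes them as finite sums of products of a function of \<open>t\<close> and a function of \<open>u\<close>.
\<close>

inductive_set diagonal_kernels :: "('t::topological_space \<Rightarrow> 't \<Rightarrow> real) set" where
  one: "(\<lambda>_ _. 1) \<in> diagonal_kernels"
| mult: "\<phi> \<in> diagonal_kernels \<Longrightarrow> continuous_on UNIV g \<Longrightarrow> (\<And>t. 0 \<le> g t) \<Longrightarrow> (\<And>t. g t \<le> 1) \<Longrightarrow>
    (\<lambda>t u. (1 - (g t - g u)\<^sup>2) * \<phi> t u) \<in> diagonal_kernels"

lemma one_minus_square_diff_bounds: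
  assumes "0 \<le> a" "a \<le> 1" "0 \<le> b" "b \<le> (1::real)"
  shows "0 \<le> 1 - (a - b)\<^sup>2" "1 - (a - b)\<^sup>2 \<le> 1"
proof -
  have "\<bar>a - b\<bar> \<le> 1" using assms by auto
  then show "0 \<le> 1 - (a - b)\<^sup>2" by (simp add: abs_square_le_1)
qed simp

lemma diagonal_kernels_bounds:
  "\<phi> \<in> diagonal_kernels \<Longrightarrow> 0 \<le> \<phi> t u \<and> \<phi> t u \<le> 1"
proof (induction arbitrary: t u rule: diagonal_kernels.induct)
  case (mult \<phi> g)
  have "0 \<le> 1 - (g t - g u)\<^sup>2" "1 - (g t - g u)\<^sup>2 \<le> 1"
    using one_minus_square_diff_bounds mult(3,4) by auto
  with mult.IH[of t u] show ?case by (auto intro: mult_le_one)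
qed simp

lemma diagonal_kernels_continuous:
  "\<phi> \<in> diagonal_kernels \<Longrightarrow> continuous_on UNIV (\<lambda>p. \<phi> (fst p) (snd p))"
proof (induction rule: diagonal_kernels.induct)
  case (mult \<phi> g)
  have "continuous_on UNIV (\<lambda>p::'a\<times>'a. g (fst p))" "continuous_on UNIV (\<lambda>p::'a\<times>'a. g (snd p))"
    by (auto intro!: continuous_on_compose2[OF mult(2)] continuous_intros)
  with mult.IH show ?case by (intro continuous_intros)
qed simp

lemma diagonal_kernels_power:
  assumes "continuous_on UNIV g" "\<And>t. 0 \<le> g t" "\<And>t. g t \<le> 1" and \<phi>: "\<phi> \<in> diagonal_kernels"
  shows "(\<lambda>t u. (1 - (g t - g u)\<^sup>2) ^ k * \<phi> t u) \<in> diagonal_kernels"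
proof (induction k)
  case (Suc k)
  from diagonal_kernels.mult[OF this assms(1-3)] show ?case by (simp add: mult.assoc)
qed (simp add: \<phi>)

lemma diagonal_kernels_prod:
  fixes g :: "nat \<Rightarrow> 't::topological_space \<Rightarrow> real"
  assumes "\<And>i. continuous_on UNIV (g i)" "\<And>i t. 0 \<le> g i t" "\<And>i t. g i t \<le> 1"
  shows "(\<lambda>t u. \<Prod>i<j. (1 - (g i t - g i u)\<^sup>2) ^ k) \<in> diagonal_kernels"
proof (induction j)
  case (Suc j)
  from diagonal_kernels_power[of "g j", OF assms this] show ?case by (simp add: mult.commute)
qed (simp add: diagonal_kernels.one)

text \<open>
  Off the diagonal one factor is \<open>a\<^sup>n\<close> with a fixed \<open>a < 1\<close>, and the others are at most \<open>1\<close>.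
\<close>

lemma diagonal_kernels_tendsto:
  fixes g :: "nat \<Rightarrow> 't \<Rightarrow> real"
  assumes g: "\<And>i t. 0 \<le> g i t" "\<And>i t. g i t \<le> 1" and sep: "t \<noteq> u \<Longrightarrow> \<exists>i. g i t \<noteq> g i u"
  shows "(\<lambda>n. \<Prod>i<n. (1 - (g i t - g i u)\<^sup>2) ^ n) \<longlonglongrightarrow> (if t = u then 1 else 0)"
proof (cases "t = u")
  case False
  then obtain j where j: "g j t \<noteq> g j u" using sep by blast
  let ?a = "\<lambda>i. 1 - (g i t - g i u)\<^sup>2"
  have b: "0 \<le> ?a i" "?a i \<le> 1" for i using one_minus_square_diff_bounds g by auto
  have "?a j < 1" using j by simp
  then have l: "(\<lambda>n. ?a j ^ n) \<longlonglongrightarrow> 0" using b by (intro LIMSEQ_realpow_zero) auto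
  have "(\<lambda>n. \<Prod>i<n. ?a i ^ n) \<longlonglongrightarrow> 0"
  proof (rule tendsto_sandwich[OF _ _ tendsto_const l])
    show "\<forall>\<^sub>F n in sequentially. 0 \<le> (\<Prod>i<n. ?a i ^ n)"
      by (intro always_eventually allI prod_nonneg zero_le_power b)
    show "\<forall>\<^sub>F n in sequentially. (\<Prod>i<n. ?a i ^ n) \<le> ?a j ^ n"
      using eventually_gt_at_top[of j]
    proof eventually_elim
      case (elim n)
      have "(\<Prod>i<n. ?a i ^ n) = ?a j ^ n * (\<Prod>i\<in>{..<n} - {j}. ?a i ^ n)"
        using elim by (intro prod.remove) auto
      also have "\<dots> \<le> ?a j ^ n * 1"
        by (intro mult_left_mono prod_le_1 conjI zero_le_power power_le_one b)
      finally show ?case by simp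
    qed
  qed
  then show ?thesis using False by simp
qed simp

context fibred_measure
begin

lemma measurable_M_M: "measurable (M \<Otimes>\<^sub>M M) N = measurable borel N"
proof (rule measurable_cong_sets[OF _ refl])
  have "sets (M \<Otimes>\<^sub>M M) = sets (borel \<Otimes>\<^sub>M borel)" by (rule sets_pair_measure_cong[OF sets_M sets_M])
  then show "sets (M \<Otimes>\<^sub>M M) = sets borel" by (simp only: borel_prod)
qed

definition approximable_kernels :: "('t \<times> real) fock \<Rightarrow> ('t \<times> real \<Rightarrow> 't \<times> real \<Rightarrow> real) set" where
  "approximable_kernels F = {\<psi>. (\<exists>\<alpha>\<in>tame. \<exists>\<beta>\<in>tame. (\<forall>z. 0 \<le> \<alpha> z) \<and> (\<forall>z. 0 \<le> \<beta> z) \<and> kernel_bounded \<alpha> \<beta> \<psi>) \<and>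
     kernel_op \<psi> F \<in> approximable}"

lemma approximable_kernelsI:
  assumes "\<alpha> \<in> tame" "\<beta> \<in> tame" "\<And>z. 0 \<le> \<alpha> z" "\<And>z. 0 \<le> \<beta> z" "kernel_bounded \<alpha> \<beta> \<psi>"
    "kernel_op \<psi> F \<in> approximable"
  shows "\<psi> \<in> approximable_kernels F"
  using assms unfolding approximable_kernels_def by blast

lemma approximable_kernels_scale:
  assumes "\<psi> \<in> approximable_kernels F"
  shows "(\<lambda>z w. c * \<psi> z w) \<in> approximable_kernels F"
proof -
  obtain \<alpha> \<beta> where *: "\<alpha> \<in> tame" "\<beta> \<in> tame" "\<And>z. 0 \<le> \<alpha> z" "\<And>z. 0 \<le> \<beta> z" "kernel_bounded \<alpha> \<beta> \<psi>"
    and a: "kernel_op \<psi> F \<in> approximable"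
    using assms unfolding approximable_kernels_def by blast
  have "kernel_bounded (\<lambda>z. \<bar>c\<bar> * \<alpha> z) \<beta> (\<lambda>z w. c * \<psi> z w)"
    unfolding kernel_bounded_def
  proof (intro conjI allI)
    show "(\<lambda>p. c * \<psi> (fst p) (snd p)) \<in> borel_measurable (M \<Otimes>\<^sub>M M)"
      using *(5) unfolding kernel_bounded_def by (intro borel_measurable_times borel_measurable_const) blast
    fix z w
    have "\<bar>\<psi> z w\<bar> \<le> \<alpha> z * \<beta> w" using *(5) unfolding kernel_bounded_def by blast
    from mult_left_mono[OF this abs_ge_zero[of c]]
    show "\<bar>c * \<psi> z w\<bar> \<le> \<bar>c\<bar> * \<alpha> z * \<beta> w" by (simp add: abs_mult mult.assoc)
  qed
  moreover have "(\<lambda>z. \<bar>c\<bar> * \<alpha> z) \<in> tame" by (rule tame_scale[OF *(1)])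
  moreover have "0 \<le> \<bar>c\<bar> * \<alpha> z" for z using *(3)[of z] by simp
  moreover have "kernel_op (\<lambda>z w. c * \<psi> z w) F \<in> approximable"
    unfolding kernel_op_scale by (rule approximable_scale[OF a])
  ultimately show ?thesis using *(2,4) by (intro approximable_kernelsI)
qed

lemma approximable_kernels_add:
  assumes \<psi>: "\<psi> \<in> approximable_kernels F" and \<psi>': "\<psi>' \<in> approximable_kernels F" and F: "F \<in> tame_vectors"
  shows "(\<lambda>z w. \<psi> z w + \<psi>' z w) \<in> approximable_kernels F"
proof -
  obtain \<alpha> \<beta> where *: "\<alpha> \<in> tame" "\<And>z. 0 \<le> \<alpha> z" "\<beta> \<in> tame" "\<And>z. 0 \<le> \<beta> z" "kernel_bounded \<alpha> \<beta> \<psi>"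
    and a: "kernel_op \<psi> F \<in> approximable"
    using \<psi> unfolding approximable_kernels_def by blast
  obtain \<alpha>' \<beta>' where **: "\<alpha>' \<in> tame" "\<And>z. 0 \<le> \<alpha>' z" "\<beta>' \<in> tame" "\<And>z. 0 \<le> \<beta>' z" "kernel_bounded \<alpha>' \<beta>' \<psi>'"
    and a': "kernel_op \<psi>' F \<in> approximable"
    using \<psi>' unfolding approximable_kernels_def by blast
  have "kernel_bounded (\<lambda>z. \<alpha> z + \<alpha>' z) (\<lambda>z. \<beta> z + \<beta>' z) (\<lambda>z w. \<psi> z w + \<psi>' z w)"
    unfolding kernel_bounded_def
  proof (intro conjI allI)
    show "(\<lambda>p. \<psi> (fst p) (snd p) + \<psi>' (fst p) (snd p)) \<in> borel_measurable (M \<Otimes>\<^sub>M M)"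
      using *(5) **(5) unfolding kernel_bounded_def by (intro borel_measurable_add) blast+
    fix z w
    have "\<bar>\<psi> z w\<bar> \<le> \<alpha> z * \<beta> w" "\<bar>\<psi>' z w\<bar> \<le> \<alpha>' z * \<beta>' w"
      using *(5) **(5) unfolding kernel_bounded_def by blast+
    moreover have "0 \<le> \<alpha> z * \<beta>' w" "0 \<le> \<alpha>' z * \<beta> w"
      by (intro mult_nonneg_nonneg * **)+
    ultimately show "\<bar>\<psi> z w + \<psi>' z w\<bar> \<le> (\<alpha> z + \<alpha>' z) * (\<beta> w + \<beta>' w)"
      by (simp add: distrib_left distrib_right)
  qed
  moreover have "(\<lambda>z. \<alpha> z + \<alpha>' z) \<in> tame" "(\<lambda>z. \<beta> z + \<beta>' z) \<in> tame"
    by (intro tame_add * **)+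
  moreover have "0 \<le> \<alpha> z + \<alpha>' z" "0 \<le> \<beta> z + \<beta>' z" for z by (intro add_nonneg_nonneg * **)+
  moreover have "kernel_op (\<lambda>z w. \<psi> z w + \<psi>' z w) F \<in> approximable"
    unfolding kernel_op_add[OF * ** F] by (rule approximable_add[OF a a'])
  ultimately show ?thesis by (intro approximable_kernelsI)
qed

text \<open>
  The condition is imposed on all multiples of \<open>h\<close> by continuous functions of the base point: the kernels
  concentrating on the diagonal redistribute such factors between the two variables.
\<close>

definition stable_symbols :: "('t \<times> real \<Rightarrow> real) set" where
  "stable_symbols = {h \<in> tame. \<forall>g F. continuous_on UNIV g \<longrightarrow> F \<in> approximable \<longrightarrow>
     field_op M (\<lambda>z. g (fst z) * h z) F \<in> approximable}"

lemma stable_symbolsI: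
  assumes "h \<in> tame"
    "\<And>g F. continuous_on UNIV g \<Longrightarrow> F \<in> approximable \<Longrightarrow> field_op M (\<lambda>z. g (fst z) * h z) F \<in> approximable"
  shows "h \<in> stable_symbols"
  using assms unfolding stable_symbols_def by blast

lemma stable_symbols_tame: "h \<in> stable_symbols \<Longrightarrow> h \<in> tame"
  by (simp add: stable_symbols_def)

lemma stable_symbols_base_mult:
  "h \<in> stable_symbols \<Longrightarrow> continuous_on UNIV g \<Longrightarrow> F \<in> approximable \<Longrightarrow>
    field_op M (\<lambda>z. g (fst z) * h z) F \<in> approximable"
  unfolding stable_symbols_def by blast

lemma stable_symbols_field_op: "h \<in> stable_symbols \<Longrightarrow> F \<in> approximable \<Longrightarrow> field_op M h F \<in> approximable"
  using stable_symbols_base_mult[of h "\<lambda>_. 1" F] by simp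

lemma compactly_supported_stable:
  assumes "f \<in> compactly_supported"
  shows "(\<lambda>z. f (fst z)) \<in> stable_symbols"
proof (rule stable_symbolsI[OF compactly_supported_tame[OF assms]])
  fix g :: "'t \<Rightarrow> real" and F assume "continuous_on UNIV g" "F \<in> approximable"
  then show "field_op M (\<lambda>z. g (fst z) * f (fst z)) F \<in> approximable"
    by (intro approximable_field_op[of "\<lambda>t. g t * f t"] compactly_supported_mult assms)
qed

lemma diagonal_kernel_bounded:
  assumes \<phi>: "\<phi> \<in> diagonal_kernels" and a: "continuous_on UNIV a" and b: "b \<in> tame"
  shows "kernel_bounded (\<lambda>z. \<bar>a (fst z)\<bar>) (\<lambda>w. \<bar>b w\<bar>) (\<lambda>z w. a (fst z) * b w * \<phi> (fst z) (fst w))"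
  unfolding kernel_bounded_def
proof (intro conjI allI)
  have "continuous_on UNIV (\<lambda>p::('t \<times> real) \<times> ('t \<times> real). a (fst (fst p)))"
    by (intro continuous_on_compose2[OF a] continuous_intros) auto
  then have "(\<lambda>p. a (fst (fst p))) \<in> borel_measurable (M \<Otimes>\<^sub>M M)"
    unfolding measurable_M_M by (rule borel_measurable_continuous_onI)
  moreover have "continuous_on UNIV (\<lambda>p::('t \<times> real) \<times> ('t \<times> real). \<phi> (fst (fst (fst p), fst (snd p))) (snd (fst (fst p), fst (snd p))))"
    by (intro continuous_on_compose2[OF diagonal_kernels_continuous[OF \<phi>]] continuous_intros) auto
  then have "(\<lambda>p. \<phi> (fst (fst p)) (fst (snd p))) \<in> borel_measurable (M \<Otimes>\<^sub>M M)"
    unfolding measurable_M_M fst_conv snd_conv by (rule borel_measurable_continuous_onI)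
  moreover have "(\<lambda>p. b (snd p)) \<in> borel_measurable (M \<Otimes>\<^sub>M M)"
    by (rule measurable_compose[OF measurable_snd tame_measurable[OF b]])
  ultimately show "(\<lambda>p. a (fst (fst p)) * b (snd p) * \<phi> (fst (fst p)) (fst (snd p))) \<in> borel_measurable (M \<Otimes>\<^sub>M M)"
    by (intro borel_measurable_times)
  fix z w
  show "\<bar>a (fst z) * b w * \<phi> (fst z) (fst w)\<bar> \<le> \<bar>a (fst z)\<bar> * \<bar>b w\<bar>"
    unfolding abs_mult
    using diagonal_kernels_bounds[OF \<phi>, of "fst z" "fst w"] by (intro mult_left_le) auto
qed

text \<open>
  Induction over the factors of \<open>\<phi>\<close>. The functions \<open>g\<close> and \<open>k\<close> are arbitrary, so that they absorb the terms of each
  expanded square; for \<open>\<phi> = 1\<close> the operator is \<open>X(g \<kappa>) x(k h)\<close>.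
\<close>

lemma diagonal_kernel_approximable:
  assumes \<kappa>: "\<kappa> \<in> compactly_supported" and h: "h \<in> stable_symbols" and F: "F \<in> approximable"
  shows "\<phi> \<in> diagonal_kernels \<Longrightarrow> continuous_on UNIV g \<Longrightarrow> continuous_on UNIV k \<Longrightarrow>
    (\<lambda>z w. (g (fst z) * \<kappa> (fst z)) * (k (fst w) * h w) * \<phi> (fst z) (fst w)) \<in> approximable_kernels F"
proof (induction arbitrary: g k rule: diagonal_kernels.induct)
  case one
  have c: "(\<lambda>t. g t * \<kappa> t) \<in> compactly_supported" by (rule compactly_supported_mult[OF \<kappa> one(1)])
  have b: "(\<lambda>w. k (fst w) * h w) \<in> tame" by (rule tame_base[OF one(2) stable_symbols_tame[OF h]])
  have "continuous_on UNIV (\<lambda>t. g t * \<kappa> t)" using c by (simp add: compactly_supported_def)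
  from diagonal_kernel_bounded[OF diagonal_kernels.one this b]
  have kb: "kernel_bounded (\<lambda>z. \<bar>g (fst z) * \<kappa> (fst z)\<bar>) (\<lambda>w. \<bar>k (fst w) * h w\<bar>)
      (\<lambda>z w. (g (fst z) * \<kappa> (fst z)) * (k (fst w) * h w) * 1)" .
  have ap: "kernel_op (\<lambda>z w. (g (fst z) * \<kappa> (fst z)) * (k (fst w) * h w) * 1) F \<in> approximable"
    unfolding mult_1_right kernel_op_product
    by (intro approximable_field_op[OF c] stable_symbols_base_mult h one F)
  have t: "(\<lambda>z. \<bar>g (fst z) * \<kappa> (fst z)\<bar>) \<in> tame" "(\<lambda>w. \<bar>k (fst w) * h w\<bar>) \<in> tame"
    by (intro tame_abs compactly_supported_tame[OF c] b)+
  show ?case by (rule approximable_kernelsI[OF t abs_ge_zero abs_ge_zero kb ap])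
next
  case (mult \<phi> e)
  let ?K = "\<lambda>g k z w. (g (fst z) * \<kappa> (fst z)) * (k (fst w) * h w) * \<phi> (fst z) (fst w)"
  note cont = mult(2) mult.prems
  \<comment> \<open>Expanding the square separates the two base points again.\<close>
  have "(\<lambda>z w. ?K g k z w + (-1 * ?K (\<lambda>t. g t * (e t)\<^sup>2) k z w +
      (2 * ?K (\<lambda>t. g t * e t) (\<lambda>t. k t * e t) z w + -1 * ?K g (\<lambda>t. k t * (e t)\<^sup>2) z w)))
      \<in> approximable_kernels F"
    by (intro approximable_kernels_add approximable_kernels_scale mult.IH approximable_tame[OF F]
        continuous_intros cont)
  also have "(\<lambda>z w. ?K g k z w + (-1 * ?K (\<lambda>t. g t * (e t)\<^sup>2) k z w +
      (2 * ?K (\<lambda>t. g t * e t) (\<lambda>t. k t * e t) z w + -1 * ?K g (\<lambda>t. k t * (e t)\<^sup>2) z w))) =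
      (\<lambda>z w. (g (fst z) * \<kappa> (fst z)) * (k (fst w) * h w) * ((1 - (e (fst z) - e (fst w))\<^sup>2) * \<phi> (fst z) (fst w)))"
    by (intro ext) (simp add: power2_eq_square algebra_simps)
  finally show ?case .
qed

text \<open>
  The kernels \<open>\<kappa>(t) \<phi>\<^sub>n(t,u) g(u) h(u,s)\<close> converge pointwise to the diagonal kernel of \<open>g h\<close>, where \<open>\<kappa> = 1\<close> on
  the support of \<open>h\<close>. The limit operator is \<open>c + x(s g h)\<close> with the constant \<open>c = \<integral> g h\<close>, and \<open>c F\<close> can be subtracted.
\<close>

lemma stable_symbols_snd:
  assumes h: "h \<in> stable_symbols"
  shows "(\<lambda>z. snd z * h z) \<in> stable_symbols"
proof (rule stable_symbolsI[OF tame_snd[OF stable_symbols_tame[OF h]]])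
  fix g :: "'t \<Rightarrow> real" and F assume g: "continuous_on UNIV g" and F: "F \<in> approximable"
  note ht = stable_symbols_tame[OF h] and Ft = approximable_tame[OF F]
  let ?h = "\<lambda>w. g (fst w) * h w" and ?s = "\<lambda>z. snd z * (g (fst z) * h z)"
  have t: "?h \<in> tame" by (rule tame_base[OF g ht])
  obtain K where K: "compact K" "\<And>z. fst z \<notin> K \<Longrightarrow> h z = 0" using tameE[OF ht] by metis
  obtain \<kappa> where \<kappa>: "\<kappa> \<in> compactly_supported" "\<And>t. t \<in> K \<Longrightarrow> \<kappa> t = 1"
    using compact_cutoff[OF locally_compact K(1)] by metis
  obtain e :: "nat \<Rightarrow> 't \<Rightarrow> real" where e: "\<And>i. continuous_on UNIV (e i)" "\<And>i t. 0 \<le> e i t" "\<And>i t. e i t \<le> 1"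
    "\<And>t u. t \<noteq> u \<Longrightarrow> \<exists>i. e i t \<noteq> e i u"
    using countable_separating_family[OF locally_compact] by metis
  define \<phi> where "\<phi> n t u = (\<Prod>i<n. (1 - (e i t - e i u)\<^sup>2) ^ n)" for n t u
  have \<phi>: "\<phi> n \<in> diagonal_kernels" for n
    unfolding \<phi>_def[abs_def] by (rule diagonal_kernels_prod[OF e(1-3)])
  define \<psi> where "\<psi> n z w = \<kappa> (fst z) * ?h w * \<phi> n (fst z) (fst w)" for n and z w :: "'t \<times> real"
  define \<delta> where "\<delta> z w = (if fst z = fst w then ?h w else 0)" for z w :: "'t \<times> real"
  define \<alpha> \<beta> where "\<alpha> = (\<lambda>z::'t \<times> real. \<bar>\<kappa> (fst z)\<bar>)" and "\<beta> = (\<lambda>w. \<bar>?h w\<bar>)"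
  have ab: "\<alpha> \<in> tame" "\<And>z. 0 \<le> \<alpha> z" "\<beta> \<in> tame" "\<And>z. 0 \<le> \<beta> z"
    unfolding \<alpha>_def \<beta>_def by (intro tame_abs compactly_supported_tame \<kappa> t abs_ge_zero)+
  have kb: "kernel_bounded \<alpha> \<beta> (\<psi> n)" for n
    unfolding \<alpha>_def \<beta>_def \<psi>_def[abs_def] using \<kappa>(1)
    by (intro diagonal_kernel_bounded \<phi> t) (simp add: compactly_supported_def)
  have "\<psi> n \<in> approximable_kernels F" for n
    using diagonal_kernel_approximable[OF \<kappa>(1) h F \<phi> _ g, of "\<lambda>_. 1" n] by (simp add: \<psi>_def[abs_def])
  then have ap: "kernel_op (\<psi> n) F \<in> approximable" for n by (simp add: approximable_kernels_def)
  have lim: "(\<lambda>n. \<psi> n z w) \<longlonglongrightarrow> \<delta> z w" for z w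
  proof -
    have "(\<lambda>n. \<psi> n z w) \<longlonglongrightarrow> \<kappa> (fst z) * ?h w * (if fst z = fst w then 1 else 0)"
      unfolding \<psi>_def \<phi>_def
      by (intro tendsto_mult tendsto_const diagonal_kernels_tendsto e)
    also have "\<kappa> (fst z) * ?h w * (if fst z = fst w then 1 else 0) = \<delta> z w"
      using K(2)[of w] \<kappa>(2)[of "fst w"] by (cases "fst w \<in> K") (auto simp: \<delta>_def)
    finally show ?thesis .
  qed
  define H where "H m y = (\<integral>z. ?h z \<partial>M) * F m y + field_op M ?s F m y" for m y
  have Ht: "H \<in> tame_vectors"
    unfolding H_def[abs_def] by (intro tame_vectors_add tame_vectors_scale field_op_tame tame_snd t Ft)
  obtain \<rho> B D where *: "\<rho> \<in> tame" "\<And>z. 0 \<le> \<rho> z" "0 \<le> B"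
    "\<And>\<psi> m y. kernel_bounded \<alpha> \<beta> \<psi> \<Longrightarrow> \<bar>kernel_op \<psi> F m y\<bar> \<le> B * (\<Prod>i<m. \<rho> (y i))"
    "\<And>\<psi> m y. D < m \<Longrightarrow> kernel_op \<psi> F m y = 0"
    using kernel_op_uniform_bound[OF ab Ft] by metis
  obtain \<rho>' B' D' where **: "\<rho>' \<in> tame" "\<And>z. 0 \<le> \<rho>' z" "0 \<le> B'"
    "\<And>m y. \<bar>H m y\<bar> \<le> B' * (\<Prod>i<m. \<rho>' (y i))" "\<And>m y. D' < m \<Longrightarrow> H m y = 0"
    using tame_vectorsE[OF Ht] by metis
  have "(\<lambda>n. sqnorm M (\<lambda>m y. H m y - kernel_op (\<psi> n) F m y)) \<longlonglongrightarrow> 0"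
  proof (rule sqnorm_dominated_convergence)
    show "fock_measurable M (\<lambda>m y. H m y - kernel_op (\<psi> n) F m y)" for n
      by (intro tame_vectors_measurable tame_vectors_diff Ht approximable_tame ap)
    show "(\<lambda>z. \<rho> z + \<rho>' z) \<in> tame" by (intro tame_add * **)
    show "\<bar>H m y - kernel_op (\<psi> n) F m y\<bar> \<le> (B + B') * (\<Prod>i<m. \<rho> (y i) + \<rho>' (y i))" for n m y
    proof -
      have "(\<Prod>i<m. \<rho> (y i)) \<le> (\<Prod>i<m. \<rho> (y i) + \<rho>' (y i))" "(\<Prod>i<m. \<rho>' (y i)) \<le> (\<Prod>i<m. \<rho> (y i) + \<rho>' (y i))"
        by (intro prod_mono; simp add: *(2) **(2))+
      then have "\<bar>kernel_op (\<psi> n) F m y\<bar> \<le> B * (\<Prod>i<m. \<rho> (y i) + \<rho>' (y i))"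
        "\<bar>H m y\<bar> \<le> B' * (\<Prod>i<m. \<rho> (y i) + \<rho>' (y i))"
        using order_trans[OF *(4)[OF kb] mult_left_mono] order_trans[OF **(4) mult_left_mono] *(3) **(3) by blast+
      then show ?thesis unfolding distrib_right by linarith
    qed
    show "H m y - kernel_op (\<psi> n) F m y = 0" if "max D D' < m" for n m y
      using that by (simp add: *(5) **(5))
    show "AE y in tensor_power M m. (\<lambda>n. H m y - kernel_op (\<psi> n) F m y) \<longlonglongrightarrow> 0" for m
      using kernel_op_diagonal[OF t Ft, of m]
    proof eventually_elim
      case (elim y)
      have "(\<lambda>n. kernel_op (\<psi> n) F m y) \<longlonglongrightarrow> kernel_op \<delta> F m y"
        by (rule kernel_op_tendsto[OF ab kb Ft lim])
      also have "kernel_op \<delta> F m y = H m y" unfolding \<delta>_def[abs_def] H_def by (rule elim)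
      finally show ?case using tendsto_diff[OF tendsto_const, of _ "H m y" _ "H m y"] by fastforce
    qed
  qed
  have "H \<in> approximable"
  proof (rule approximable_closed[OF Ht])
    fix \<epsilon> :: real assume "0 < \<epsilon>"
    then have "\<forall>\<^sub>F n in sequentially. sqnorm M (\<lambda>m y. H m y - kernel_op (\<psi> n) F m y) < ennreal \<epsilon>"
      using \<open>(\<lambda>n. sqnorm M _) \<longlonglongrightarrow> 0\<close> by (intro order_tendstoD(2)) auto
    then obtain n where "sqnorm M (\<lambda>m y. H m y - kernel_op (\<psi> n) F m y) < ennreal \<epsilon>"
      by (auto simp: eventually_sequentially)
    then show "\<exists>G\<in>approximable. sqnorm M (\<lambda>m y. H m y - G m y) \<le> ennreal \<epsilon>"
      using ap[of n] by (intro bexI[of _ "kernel_op (\<psi> n) F"]) simp_all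
  qed
  from approximable_add[OF this approximable_scale[OF F, of "- (\<integral>z. ?h z \<partial>M)"]]
  have "(\<lambda>m y. field_op M ?s F m y) \<in> approximable" by (simp add: H_def)
  then show "field_op M (\<lambda>z. g (fst z) * (snd z * h z)) F \<in> approximable"
    by (simp add: mult.left_commute)
qed

section \<open>From continuous symbols to polynomials\<close>

lemma stable_symbols_add:
  assumes h: "h \<in> stable_symbols" and k: "k \<in> stable_symbols"
  shows "(\<lambda>z. h z + k z) \<in> stable_symbols"
proof (rule stable_symbolsI)
  show "(\<lambda>z. h z + k z) \<in> tame" by (intro tame_add stable_symbols_tame h k)
  fix g :: "'t \<Rightarrow> real" and F assume g: "continuous_on UNIV g" and F: "F \<in> approximable"
  show "field_op M (\<lambda>z. g (fst z) * (h z + k z)) F \<in> approximable"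
    unfolding distrib_left
      field_op_add_symbol[OF tame_base[OF g stable_symbols_tame[OF h]] tame_base[OF g stable_symbols_tame[OF k]] approximable_tame[OF F]]
    by (intro approximable_add stable_symbols_base_mult h k g F)
qed

lemma stable_symbols_base:
  assumes h: "h \<in> stable_symbols" and g: "continuous_on UNIV g"
  shows "(\<lambda>z. g (fst z) * h z) \<in> stable_symbols"
proof (rule stable_symbolsI[OF tame_base[OF g stable_symbols_tame[OF h]]])
  fix k :: "'t \<Rightarrow> real" and F assume k: "continuous_on UNIV k" and F: "F \<in> approximable"
  have "continuous_on UNIV (\<lambda>t. k t * g t)" using k g by (rule continuous_on_mult)
  from stable_symbols_base_mult[OF h this F]
  show "field_op M (\<lambda>z. k (fst z) * (g (fst z) * h z)) F \<in> approximable" by (simp add: mult.assoc)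
qed

text \<open>
  The multipliers of \<open>stable_symbols\<close> form an algebra. It contains all continuous functions of the base point and
  the fibre coordinate, and these separate points.
\<close>

lemma stable_symbols_uniformly_dense:
  assumes S: "compact S" and h: "continuous_on S h" and e: "0 < e"
  shows "\<exists>p. continuous_on UNIV p \<and> (\<forall>k\<in>stable_symbols. (\<lambda>z. p z * k z) \<in> stable_symbols) \<and>
    (\<forall>z\<in>S. \<bar>h z - p z\<bar> < e)"
proof -
  let ?P = "\<lambda>p. continuous_on UNIV p \<and> (\<forall>k\<in>stable_symbols. (\<lambda>z. p z * k z) \<in> stable_symbols)"
  have base: "?P (\<lambda>z. g (fst z))" if g: "continuous_on UNIV g" for g
    using stable_symbols_base[OF _ g] by (auto intro!: continuous_on_compose2[OF g] continuous_intros)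
  have "\<exists>p. ?P p \<and> (\<forall>z\<in>S. \<bar>h z - p z\<bar> < e)"
  proof (rule Stone_Weierstrass_HOL[OF S _ _ _ _ _ h e])
    show "?P (\<lambda>_. c)" for c using base[of "\<lambda>_. c"] by simp
    show "continuous_on S p" if "?P p" for p using that by (auto intro: continuous_on_subset)
    show "?P (\<lambda>z. p z + q z)" if pq: "?P p \<and> ?P q" for p q
    proof (intro conjI ballI)
      fix k assume k: "k \<in> stable_symbols"
      have "(\<lambda>z. p z * k z) \<in> stable_symbols" "(\<lambda>z. q z * k z) \<in> stable_symbols" using pq k by blast+
      then have "(\<lambda>z. p z * k z + q z * k z) \<in> stable_symbols" by (rule stable_symbols_add)
      then show "(\<lambda>z. (p z + q z) * k z) \<in> stable_symbols" by (simp only: distrib_right)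
    qed (use pq in \<open>auto intro: continuous_intros\<close>)
    show "?P (\<lambda>z. p z * q z)" if pq: "?P p \<and> ?P q" for p q
    proof (intro conjI ballI)
      fix k assume k: "k \<in> stable_symbols"
      have P: "(\<lambda>z. p z * l z) \<in> stable_symbols" if "l \<in> stable_symbols" for l using pq that by blast
      have "(\<lambda>z. q z * k z) \<in> stable_symbols" using pq k by blast
      then have "(\<lambda>z. p z * (q z * k z)) \<in> stable_symbols" by (rule P)
      then show "(\<lambda>z. p z * q z * k z) \<in> stable_symbols" by (simp only: mult.assoc)
    qed (use pq in \<open>auto intro: continuous_intros\<close>)
    show "\<exists>p. ?P p \<and> p x \<noteq> p y" if xy: "x \<in> S \<and> y \<in> S \<and> x \<noteq> y" for x y
    proof (cases "fst x = fst y")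
      case True
      then have "snd x \<noteq> snd y" using xy by (simp add: prod_eq_iff)
      moreover have "?P snd" using stable_symbols_snd by (auto intro: continuous_intros)
      ultimately show ?thesis by blast
    next
      case False
      obtain e :: "nat \<Rightarrow> 't \<Rightarrow> real" where e: "\<And>i. continuous_on UNIV (e i)" "\<And>t u. t \<noteq> u \<Longrightarrow> \<exists>i. e i t \<noteq> e i u"
        using countable_separating_family[OF locally_compact] by metis
      then obtain i where "e i (fst x) \<noteq> e i (fst y)" using False by blast
      then show ?thesis using base[OF e(1)[of i]] by blast
    qed
  qed
  then show ?thesis by blast
qed

lemma bounded_support_continuous_tame:
  assumes "h \<in> bounded_support_continuous"
  shows "h \<in> tame"
proof -
  obtain \<Delta> where \<Delta>: "\<Delta> \<in> relatively_compact_borel" "\<And>t s. t \<notin> \<Delta> \<Longrightarrow> h (t, s) = 0"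
    and h: "continuous_on UNIV h" "bounded (range h)"
    using assms unfolding bounded_support_continuous_def by blast
  obtain B where B: "\<And>z. \<bar>h z\<bar> \<le> B" using h(2) unfolding bounded_iff by auto
  show ?thesis
  proof (rule tameI)
    show "h \<in> borel_measurable M" unfolding measurable_M using h(1) by (rule borel_measurable_continuous_onI)
    show "compact (closure \<Delta>)" using \<Delta>(1) by (simp add: relatively_compact_borel_def)
    show "h z = 0" if "fst z \<notin> closure \<Delta>" for z
      using \<Delta>(2)[of "fst z" "snd z"] that closure_subset[of \<Delta>] by auto
    show "AE z in M. \<bar>h z\<bar> \<le> B" by (rule AE_I2) (rule B)
  qed
qed

text \<open>
  The constant depends only on the compact set that carries the symbol, so uniform convergence of symbols on a
  common support implies convergence of the operators in norm.
\<close>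

lemma field_op_small:
  assumes K: "compact K"
  shows "\<exists>c\<ge>0. \<forall>d\<in>tame. \<forall>e F. (\<forall>z. fst z \<notin> K \<longrightarrow> d z = 0) \<longrightarrow> (AE z in M. \<bar>d z\<bar> \<le> e) \<longrightarrow> 0 \<le> e \<longrightarrow>
    fock_measurable M F \<longrightarrow> sqnorm M (field_op M d F) \<le> ennreal (c * e\<^sup>2) * sqnorm M F"
proof -
  obtain R where R: "AE z in M. fst z \<in> K \<longrightarrow> \<bar>snd z\<bar> \<le> R" using bounded_over_compact[OF K] by blast
  let ?A = "K \<times> (UNIV :: real set)"
  have A: "?A \<in> sets M" by (intro closed_cylinder_sets compact_imp_closed K)
  define m where "m = measure M ?A"
  have m: "emeasure M ?A = ennreal m" "0 \<le> m"
    unfolding m_def using finite_over_compact[OF K] by (auto simp: emeasure_eq_ennreal_measure)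
  show ?thesis
  proof (intro exI[of _ "6 * m + 4 * R\<^sup>2"] conjI ballI allI impI)
    show "0 \<le> 6 * m + 4 * R\<^sup>2" using m(2) by simp
    fix d e F assume d: "d \<in> tame" and dK: "\<forall>z. fst z \<notin> K \<longrightarrow> d z = 0" and de: "AE z in M. \<bar>d z\<bar> \<le> e"
      and e: "0 \<le> e" and F: "fock_measurable M F"
    have d0: "d z = 0" if "fst z \<notin> K" for z using dK that by blast
    have "AE z in M. \<bar>snd z * d z\<bar> \<le> \<bar>R\<bar> * e"
      using R de
    proof eventually_elim
      case (elim z)
      show ?case
      proof (cases "fst z \<in> K")
        case True
        then have "\<bar>snd z\<bar> \<le> \<bar>R\<bar>" using elim(1) by linarith
        then show ?thesis unfolding abs_mult using elim(2) by (intro mult_mono) auto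
      qed (use d0 e in simp)
    qed
    from sqnorm_field_op[OF tame_measurable[OF d] F this]
    have "sqnorm M (field_op M d F)
        \<le> (6 * (\<integral>\<^sup>+z. ennreal ((d z)\<^sup>2) \<partial>M) + 4 * ennreal ((\<bar>R\<bar> * e)\<^sup>2)) * sqnorm M F" .
    also have "\<dots> \<le> (6 * ennreal (e\<^sup>2 * m) + 4 * ennreal ((\<bar>R\<bar> * e)\<^sup>2)) * sqnorm M F"
    proof (intro mult_right_mono add_mono mult_left_mono order_refl)
      have "(\<integral>\<^sup>+z. ennreal ((d z)\<^sup>2) \<partial>M) \<le> (\<integral>\<^sup>+z. ennreal (e\<^sup>2) * indicator ?A z \<partial>M)"
      proof (rule nn_integral_mono_AE)
        show "AE z in M. ennreal ((d z)\<^sup>2) \<le> ennreal (e\<^sup>2) * indicator ?A z"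
          using de
        proof eventually_elim
          case (elim z)
          show ?case
          proof (cases "fst z \<in> K")
            case True
            have "(d z)\<^sup>2 \<le> e\<^sup>2" using power_mono[OF elim abs_ge_zero, of 2] by simp
            then show ?thesis using True by (cases z) (simp add: ennreal_leI)
          qed (use d0 in simp)
        qed
      qed
      also have "\<dots> = ennreal (e\<^sup>2) * ennreal m" using A m(1) by (simp add: nn_integral_cmult_indicator)
      also have "\<dots> = ennreal (e\<^sup>2 * m)" using m(2) by (simp add: ennreal_mult)
      finally show "(\<integral>\<^sup>+z. ennreal ((d z)\<^sup>2) \<partial>M) \<le> ennreal (e\<^sup>2 * m)" .
    qed auto
    also have "6 * ennreal (e\<^sup>2 * m) + 4 * ennreal ((\<bar>R\<bar> * e)\<^sup>2) = ennreal (6 * (e\<^sup>2 * m) + 4 * (\<bar>R\<bar> * e)\<^sup>2)"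
      using m(2) by (simp add: ennreal_mult)
    also have "6 * (e\<^sup>2 * m) + 4 * (\<bar>R\<bar> * e)\<^sup>2 = (6 * m + 4 * R\<^sup>2) * e\<^sup>2"
      by (simp add: power_mult_distrib algebra_simps)
    finally show "sqnorm M (field_op M d F) \<le> ennreal ((6 * m + 4 * R\<^sup>2) * e\<^sup>2) * sqnorm M F" .
  qed
qed

text \<open>
  The symbol is approximated by a multiplier \<open>p\<close> on \<open>K \<times> [-R,R]\<close>, where \<open>K\<close> carries a cut-off function \<open>\<kappa>\<close> that is
  \<open>1\<close> on the support of \<open>h\<close>. Then \<open>h - p \<kappa> = \<kappa> (h - p)\<close> is small almost everywhere and vanishes off \<open>K \<times> \<real>\<close>,
  although \<open>p\<close> is not controlled outside \<open>K \<times> [-R,R]\<close>.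
\<close>

lemma approximable_bounded_support_field_op:
  assumes h: "h \<in> bounded_support_continuous" and F: "F \<in> approximable"
  shows "field_op M h F \<in> approximable"
proof -
  obtain \<Delta> where \<Delta>: "\<Delta> \<in> relatively_compact_borel" "\<And>t s. t \<notin> \<Delta> \<Longrightarrow> h (t, s) = 0"
    and hc: "continuous_on UNIV h"
    using h unfolding bounded_support_continuous_def by blast
  have ht: "h \<in> tame" by (rule bounded_support_continuous_tame[OF h])
  have "compact (closure \<Delta>)" using \<Delta>(1) by (simp add: relatively_compact_borel_def)
  then obtain \<kappa> where \<kappa>: "\<kappa> \<in> compactly_supported" "\<And>t. 0 \<le> \<kappa> t" "\<And>t. \<kappa> t \<le> 1" "\<And>t. t \<in> closure \<Delta> \<Longrightarrow> \<kappa> t = 1"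
    using compact_cutoff[OF locally_compact] by metis
  have h\<kappa>: "\<kappa> (fst z) * h z = h z" for z
    using \<Delta>(2)[of "fst z" "snd z"] \<kappa>(4)[of "fst z"] closure_subset[of \<Delta>] by (cases "fst z \<in> \<Delta>") auto
  obtain K where K: "compact K" "\<And>t. t \<notin> K \<Longrightarrow> \<kappa> t = 0" using \<kappa>(1) unfolding compactly_supported_def by blast
  obtain R where R: "AE z in M. fst z \<in> K \<longrightarrow> \<bar>snd z\<bar> \<le> R" using bounded_over_compact[OF K(1)] by blast
  let ?S = "K \<times> {-R..R}"
  have S: "compact ?S" using K(1) by (intro compact_Times) auto
  obtain c where c: "0 \<le> c" "\<forall>d\<in>tame. \<forall>e F. (\<forall>z. fst z \<notin> K \<longrightarrow> d z = 0) \<longrightarrow> (AE z in M. \<bar>d z\<bar> \<le> e) \<longrightarrow> 0 \<le> e \<longrightarrow>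
    fock_measurable M F \<longrightarrow> sqnorm M (field_op M d F) \<le> ennreal (c * e\<^sup>2) * sqnorm M F"
    using field_op_small[OF K(1)] by blast
  let ?N = "(fock_norm M F)\<^sup>2"
  show ?thesis
  proof (rule approximable_closed[OF field_op_tame[OF ht approximable_tame[OF F]]])
    fix \<epsilon> :: real assume \<epsilon>: "0 < \<epsilon>"
    \<comment> \<open>The added \<open>1\<close> covers the case that \<open>c\<close> or the norm of \<open>F\<close> is zero.\<close>
    define e where "e = sqrt (\<epsilon> / (c * ?N + 1))"
    have pos: "0 < c * ?N + 1" using c(1) by (intro add_nonneg_pos mult_nonneg_nonneg) auto
    have e: "0 < e" "e\<^sup>2 = \<epsilon> / (c * ?N + 1)" using \<epsilon> pos by (simp_all add: e_def less_imp_le)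
    obtain p where p: "continuous_on UNIV p" "\<And>k. k \<in> stable_symbols \<Longrightarrow> (\<lambda>z. p z * k z) \<in> stable_symbols"
      "\<And>z. z \<in> ?S \<Longrightarrow> \<bar>h z - p z\<bar> < e"
      using stable_symbols_uniformly_dense[OF S continuous_on_subset[OF hc subset_UNIV] e(1)] by blast
    let ?k = "\<lambda>z. p z * \<kappa> (fst z)"
    have k: "?k \<in> stable_symbols" by (intro p(2) compactly_supported_stable \<kappa>(1))
    have kt: "?k \<in> tame" by (rule stable_symbols_tame[OF k])
    define d where "d z = h z + -1 * ?k z" for z
    have d: "d z = \<kappa> (fst z) * (h z - p z)" for z
      using h\<kappa>[of z] by (simp add: d_def algebra_simps)
    have dt: "d \<in> tame" unfolding d_def[abs_def] by (intro tame_add tame_scale ht kt)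
    have dE: "field_op M d F = (\<lambda>m y. field_op M h F m y - field_op M ?k F m y)"
      unfolding d_def[abs_def] field_op_add_symbol[OF ht tame_scale[OF kt] approximable_tame[OF F]] field_op_scale_symbol
      by simp
    have dK: "d z = 0" if "fst z \<notin> K" for z using that by (simp add: d K(2))
    have "AE z in M. \<bar>d z\<bar> \<le> e"
      using R
    proof eventually_elim
      case (elim z)
      show ?case
      proof (cases "fst z \<in> K")
        case True
        then have "z \<in> ?S" using elim by (cases z) auto
        then have "\<bar>h z - p z\<bar> \<le> e" using p(3) by (simp add: less_imp_le)
        then show ?thesis
          unfolding d abs_mult using mult_mono[of "\<bar>\<kappa> (fst z)\<bar>" 1 "\<bar>h z - p z\<bar>" e] \<kappa>(2,3)[of "fst z"] by simp
      qed (use K(2) e(1) in \<open>simp add: d\<close>)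
    qed
    from c(2)[rule_format, OF dt dK this less_imp_le[OF e(1)] approximable_measurable[OF F]]
    have "sqnorm M (field_op M d F) \<le> ennreal (c * e\<^sup>2) * sqnorm M F" .
    also have "\<dots> = ennreal (c * e\<^sup>2 * ?N)"
      unfolding tame_vectors_sqnorm(2)[OF approximable_tame[OF F]] using c(1) by (simp add: ennreal_mult)
    also have "\<dots> \<le> ennreal \<epsilon>"
    proof (rule ennreal_leI)
      have "c * e\<^sup>2 * ?N = \<epsilon> * (c * ?N / (c * ?N + 1))" unfolding e(2) by simp
      also have "\<dots> \<le> \<epsilon> * 1" using pos \<epsilon> by (intro mult_left_mono) simp_all
      finally show "c * e\<^sup>2 * ?N \<le> \<epsilon>" by simp
    qed
    finally have "sqnorm M (\<lambda>m y. field_op M h F m y - field_op M ?k F m y) \<le> ennreal \<epsilon>" unfolding dE .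
    then show "\<exists>G\<in>approximable. sqnorm M (\<lambda>m y. field_op M h F m y - G m y) \<le> ennreal \<epsilon>"
      using stable_symbols_field_op[OF k F] by (intro bexI[of _ "field_op M ?k F"])
  qed
qed

lemma field_polynomials_approximable:
  "P \<in> field_polynomials M \<Longrightarrow> F \<in> approximable \<Longrightarrow> P F \<in> approximable"
proof (induction arbitrary: F rule: field_polynomials.induct)
  case (gen h)
  then show ?case by (rule approximable_bounded_support_field_op)
next
  case (add P Q)
  then show ?case unfolding fock_add_def by (intro approximable_add) blast+
next
  case (scale P c)
  then show ?case unfolding fock_scale_def by (intro approximable_scale) blast
qed simp_all

lemma field_polynomials_vacuum: "P \<in> field_polynomials M \<Longrightarrow> P vacuum \<in> approximable"
  by (rule field_polynomials_approximable[OF _ word_span_approximable[OF vacuum_word_span]])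

section \<open>Words as continuous polynomials\<close>

lemma compactly_supported_bounded_support:
  fixes f :: "'t \<Rightarrow> real"
  assumes f: "f \<in> compactly_supported"
  shows "(\<lambda>z. f (fst z)) \<in> bounded_support_continuous"
proof -
  obtain K where K: "compact K" "\<And>t. t \<notin> K \<Longrightarrow> f t = 0" and c: "continuous_on UNIV f"
    using f by (auto simp: compactly_supported_def)
  have "continuous_on UNIV (\<lambda>z::'t \<times> real. f (fst z))"
    by (intro continuous_on_compose2[OF c] continuous_intros) auto
  moreover have "bounded (range (\<lambda>z::'t \<times> real. f (fst z)))"
  proof -
    have "compact (f ` K)" using K(1) c by (intro compact_continuous_image) (auto intro: continuous_on_subset)
    then have "bounded (insert 0 (f ` K))" by (simp add: compact_imp_bounded)
    moreover have "range (\<lambda>z::'t \<times> real. f (fst z)) \<subseteq> insert 0 (f ` K)" using K(2) by auto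
    ultimately show ?thesis by (rule bounded_subset)
  qed
  moreover have "K \<in> relatively_compact_borel"
    using K(1) by (simp add: relatively_compact_borel_def compact_imp_closed borel_closed)
  ultimately show ?thesis
    using K(2) unfolding bounded_support_continuous_def by auto
qed

lemma word_field_polynomial:
  "set fs \<subseteq> compactly_supported \<Longrightarrow> \<exists>P\<in>field_polynomials M. P vacuum = word fs"
proof (induction fs)
  case Nil
  show ?case using field_polynomials.one[of M] by (auto simp: word_def)
next
  case (Cons f fs)
  then obtain P where P: "P \<in> field_polynomials M" "P vacuum = word fs" by auto
  have "(\<lambda>F. field_op M (\<lambda>z. f (fst z)) (P F)) \<in> field_polynomials M"
    using Cons.prems
    by (intro field_polynomials.mult[OF field_polynomials.gen P(1)] compactly_supported_bounded_support) simp
  then show ?case using P(2) by (intro bexI) (auto simp: word_def)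
qed

lemma word_span_field_polynomial: "G \<in> word_span \<Longrightarrow> \<exists>P\<in>field_polynomials M. P vacuum = G"
proof (induction rule: word_span.induct)
  case zero
  have "(\<lambda>F. fock_scale 0 F) \<in> field_polynomials M" by (rule field_polynomials.scale[OF field_polynomials.one])
  then show ?case by (intro bexI) (auto simp: fock_scale_def)
next
  case (add_word fs G c)
  then obtain P Q where P: "P \<in> field_polynomials M" "P vacuum = word fs" and Q: "Q \<in> field_polynomials M" "Q vacuum = G"
    using word_field_polynomial by blast
  have "(\<lambda>F. fock_add (fock_scale c (P F)) (Q F)) \<in> field_polynomials M"
    by (rule field_polynomials.add[OF field_polynomials.scale[OF P(1)] Q(1)])
  then show ?case using P(2) Q(2) by (intro bexI) (auto simp: fock_scale_def fock_add_def)
qed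

end

lemma product_kernel:
  fixes f :: "nat \<Rightarrow> 't::t2_space \<Rightarrow> real"
  assumes f: "\<And>i. i < n \<Longrightarrow> f i \<in> compactly_supported"
  shows "(\<lambda>t. \<Prod>i<n. f i (t i)) \<in> kernels n"
proof -
  let ?X = "product_topology (\<lambda>_. euclidean :: 't topology) {..<n}" and ?f = "\<lambda>t. \<Prod>i<n. f i (t i)"
  obtain K where K: "\<And>i. i < n \<Longrightarrow> compact (K i)" "\<And>i t. i < n \<Longrightarrow> t \<notin> K i \<Longrightarrow> f i t = 0"
    using f unfolding compactly_supported_def by (simp, metis)
  have "continuous_map ?X euclideanreal ?f"
  proof (intro continuous_map_prod)
    fix i assume i: "i \<in> {..<n}"
    then have "continuous_map euclidean euclideanreal (f i)" using f by (simp add: compactly_supported_def)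
    from continuous_map_compose[OF continuous_map_product_projection[OF i] this]
    show "continuous_map ?X euclideanreal (\<lambda>t. f i (t i))" by (simp add: o_def)
  qed simp
  moreover have "compactin ?X (?X closure_of {t \<in> topspace ?X. ?f t \<noteq> 0})"
  proof (rule closed_compactin)
    show "compactin ?X (Pi\<^sub>E {..<n} K)" using K(1) by (simp add: compactin_PiE)
    show "closedin ?X (?X closure_of {t \<in> topspace ?X. ?f t \<noteq> 0})" by simp
    have "closedin ?X (Pi\<^sub>E {..<n} K)"
      using K(1) by (simp add: closedin_product_topology compact_imp_closed)
    moreover have "{t \<in> topspace ?X. ?f t \<noteq> 0} \<subseteq> Pi\<^sub>E {..<n} K"
      using K(2) by (force simp: PiE_iff)
    ultimately show "?X closure_of {t \<in> topspace ?X. ?f t \<noteq> 0} \<subseteq> Pi\<^sub>E {..<n} K"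
      by (rule closure_of_minimal[rotated])
  qed
  ultimately show ?thesis by (simp add: kernels_def Let_def)
qed

lemma constant_kernel: "(\<lambda>_. c) \<in> kernels 0"
proof -
  let ?X = "product_topology (\<lambda>_. euclidean) ({..<0}::nat set)"
  have "compactin ?X (?X closure_of {t \<in> topspace ?X. c \<noteq> 0})"
  proof (rule finite_imp_compactin[OF closure_of_subset_topspace])
    have "finite (topspace ?X)" by simp
    then show "finite (?X closure_of {t \<in> topspace ?X. c \<noteq> 0})"
      by (rule finite_subset[OF closure_of_subset_topspace])
  qed
  moreover have "continuous_map ?X euclideanreal (\<lambda>_. c)" by simp
  ultimately show ?thesis unfolding kernels_def Let_def by blast
qed

lemma CP_add_monomial:
  fixes M :: "('t::topological_space \<times> real) measure"
  assumes P: "P \<in> CP M" and f: "f \<in> kernels k"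
  shows "(\<lambda>F m y. monomial M k f F m y + P F m y) \<in> CP M"
proof -
  obtain N and n :: "nat \<Rightarrow> nat" and g :: "nat \<Rightarrow> (nat \<Rightarrow> 't) \<Rightarrow> real" where g: "\<And>i. i < N \<Longrightarrow> g i \<in> kernels (n i)"
    and P: "P = (\<lambda>F m y. \<Sum>i<N. monomial M (n i) (g i) F m y)"
    using P unfolding CP_def by blast
  have "(\<lambda>F m y. monomial M k f F m y + P F m y) =
      (\<lambda>F m y. \<Sum>i<Suc N. monomial M ((n(N := k)) i) ((g(N := f)) i) F m y)"
    unfolding P by (intro ext) simp
  then show ?thesis
    unfolding CP_def using g f by (intro CollectI exI[of _ "Suc N"] exI[of _ "n(N := k)"] exI[of _ "g(N := f)"]) auto
qed

context fibred_measure
begin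

lemma word_monomial:
  "monomial M (length fs) (\<lambda>t. \<Prod>i<length fs. (fs ! i) (t i)) vacuum = word fs"
proof -
  have "foldr (\<lambda>i. field_op M (\<lambda>(t, s). (fs ! i) t)) [0..<length fs] vacuum = word fs"
    unfolding word_def by (subst (3) map_nth[symmetric]) (simp only: foldr_map o_def case_prod_beta')
  then show ?thesis by (simp only: monomial_product)
qed

text \<open>
  The scalar is absorbed into the first factor, and into the constant kernel when the word is empty.
\<close>

lemma scaled_word_monomial:
  assumes "set fs \<subseteq> compactly_supported"
  shows "\<exists>n. \<exists>f\<in>kernels n. monomial M n f vacuum = (\<lambda>m y. c * word fs m y)"
proof (cases fs)
  case Nil
  have "monomial M 0 (\<lambda>_. c) vacuum = (\<lambda>m y. c * word fs m y)"
    by (intro ext) (simp add: monomial_def Nil word_def)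
  then show ?thesis using constant_kernel by blast
next
  case (Cons f gs)
  let ?fs = "(\<lambda>t. c * f t) # gs"
  have eq: "word ?fs = (\<lambda>m y. c * word fs m y)" unfolding Cons word_def by (simp add: field_op_scale_symbol)
  have "?fs ! i \<in> compactly_supported" if "i < length ?fs" for i
  proof -
    have "set ?fs \<subseteq> compactly_supported"
      using assms compactly_supported_mult[of f "\<lambda>_. c"] by (auto simp: Cons)
    then show ?thesis using that nth_mem by blast
  qed
  then have "(\<lambda>t. \<Prod>i<length ?fs. (?fs ! i) (t i)) \<in> kernels (length ?fs)" by (rule product_kernel)
  then show ?thesis using word_monomial[of ?fs, unfolded eq] by blast
qed

lemma word_span_CP: "G \<in> word_span \<Longrightarrow> \<exists>P\<in>CP M. P vacuum = G"
proof (induction rule: word_span.induct)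
  case zero
  have "(\<lambda>_ _ _. 0) \<in> CP M" unfolding CP_def by (intro CollectI exI[of _ 0]) auto
  then show ?case by (intro bexI) auto
next
  case (add_word fs G c)
  then obtain P where P: "P \<in> CP M" "P vacuum = G" by blast
  obtain n f where f: "f \<in> kernels n" "monomial M n f vacuum = (\<lambda>m y. c * word fs m y)"
    using scaled_word_monomial[OF add_word(1)] by blast
  from CP_add_monomial[OF P(1) f(1)] show ?case using P(2) f(2) by (intro bexI) auto
qed

section \<open>Density in the completion\<close>

lemma tau_dist_triangle:
  assumes "P vacuum \<in> tame_vectors" "Q vacuum \<in> tame_vectors" "R vacuum \<in> tame_vectors"
  shows "tau_dist M P R \<le> tau_dist M P Q + tau_dist M Q R"
  unfolding tau_dist_def by (rule fock_dist_triangle[OF assms])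

lemma tau_dist_commute: "tau_dist M P Q = tau_dist M Q P"
  unfolding tau_dist_def by (rule fock_dist_commute)

lemma field_polynomials_tame: "P \<in> field_polynomials M \<Longrightarrow> P vacuum \<in> tame_vectors"
  by (intro approximable_tame field_polynomials_vacuum)

lemma tau_cauchyD: "P \<in> tau_cauchy M \<Longrightarrow> P n \<in> field_polynomials M"
  by (simp add: tau_cauchy_def)

lemma tau_cauchy_const: "Q \<in> field_polynomials M \<Longrightarrow> (\<lambda>_. Q) \<in> tau_cauchy M"
  by (simp add: tau_cauchy_def tau_dist_def fock_dist_self)

lemma tau_dist_const_convergent:
  assumes P: "P \<in> tau_cauchy M" and Q: "Q \<in> field_polynomials M"
  shows "convergent (\<lambda>n. tau_dist M (P n) Q)"
proof -
  have t: "P n vacuum \<in> tame_vectors" "Q vacuum \<in> tame_vectors" for n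
    by (intro field_polynomials_tame tau_cauchyD P Q)+
  have "Cauchy (\<lambda>n. tau_dist M (P n) Q)"
  proof (rule CauchyI)
    fix e :: real assume "0 < e"
    then obtain N where N: "\<And>m n. N \<le> m \<Longrightarrow> N \<le> n \<Longrightarrow> tau_dist M (P m) (P n) < e"
      using P unfolding tau_cauchy_def by blast
    have "norm (tau_dist M (P m) Q - tau_dist M (P n) Q) < e" if "N \<le> m" "N \<le> n" for m n
      using tau_dist_triangle[of "P m" "P n" Q] tau_dist_triangle[of "P n" "P m" Q] t
        N[OF that] tau_dist_commute[of "P n" "P m"] by (simp add: abs_less_iff)
    then show "\<exists>N. \<forall>m\<ge>N. \<forall>n\<ge>N. norm (tau_dist M (P m) Q - tau_dist M (P n) Q) < e" by blast
  qed
  then show ?thesis by (simp add: Cauchy_convergent_iff)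
qed

text \<open>
  Representatives of a class differ by null sequences, so the limit of the distances does not depend on them.
\<close>

lemma L2_tau_dist_const:
  assumes P: "P \<in> tau_cauchy M" and Q: "Q \<in> field_polynomials M"
    and r: "(\<lambda>n. tau_dist M (P n) Q) \<longlonglongrightarrow> r"
  shows "L2_tau_dist M (tau_equiv M `` {P}) (tau_equiv M `` {\<lambda>_. Q}) = r"
  unfolding L2_tau_dist_def
proof (rule the_equality)
  have self: "R \<in> tau_equiv M `` {R}" if "R \<in> tau_cauchy M" for R
    using that by (simp add: tau_equiv_def tau_dist_def fock_dist_self)
  show "\<forall>P'\<in>tau_equiv M `` {P}. \<forall>Q'\<in>tau_equiv M `` {\<lambda>_. Q}. (\<lambda>n. tau_dist M (P' n) (Q' n)) \<longlonglongrightarrow> r"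
  proof (intro ballI)
    fix P' Q' assume "P' \<in> tau_equiv M `` {P}" "Q' \<in> tau_equiv M `` {\<lambda>_. Q}"
    then have P': "P' \<in> tau_cauchy M" "(\<lambda>n. tau_dist M (P n) (P' n)) \<longlonglongrightarrow> 0"
      and Q': "Q' \<in> tau_cauchy M" "(\<lambda>n. tau_dist M Q (Q' n)) \<longlonglongrightarrow> 0"
      by (simp_all add: tau_equiv_def)
    have t: "P n vacuum \<in> tame_vectors" "P' n vacuum \<in> tame_vectors" "Q' n vacuum \<in> tame_vectors" "Q vacuum \<in> tame_vectors" for n
      by (intro field_polynomials_tame tau_cauchyD P P' Q' Q)+
    have b: "\<bar>tau_dist M (P' n) (Q' n) - tau_dist M (P n) Q\<bar> \<le> tau_dist M (P n) (P' n) + tau_dist M Q (Q' n)" for n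
      using tau_dist_triangle[of "P' n" "P n" "Q' n"] tau_dist_triangle[of "P n" Q "Q' n"]
        tau_dist_triangle[of "P n" "P' n" Q] tau_dist_triangle[of "P' n" "Q' n" Q]
        tau_dist_commute[of "P' n" "P n"] tau_dist_commute[of "Q' n" Q] t by (simp add: abs_le_iff)
    have "(\<lambda>n. tau_dist M (P n) (P' n) + tau_dist M Q (Q' n)) \<longlonglongrightarrow> 0"
      using tendsto_add[OF P'(2) Q'(2)] by simp
    then have "(\<lambda>n. tau_dist M (P' n) (Q' n) - tau_dist M (P n) Q) \<longlonglongrightarrow> 0"
      by (rule Lim_null_comparison[rotated]) (simp add: b)
    from tendsto_add[OF this r] show "(\<lambda>n. tau_dist M (P' n) (Q' n)) \<longlonglongrightarrow> r" by simp
  qed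
  then show "s = r" if "\<forall>P'\<in>tau_equiv M `` {P}. \<forall>Q'\<in>tau_equiv M `` {\<lambda>_. Q}. (\<lambda>n. tau_dist M (P' n) (Q' n)) \<longlonglongrightarrow> s" for s
    using that self[OF P] self[OF tau_cauchy_const[OF Q]] LIMSEQ_unique by blast
qed

text \<open>
  Every representative of the class of a constant sequence converges to \<open>Q \<Omega>\<close>, which is also a value of \<open>CP\<close>.
\<close>

lemma constant_class_in_CP:
  assumes Q: "Q \<in> field_polynomials M" and P: "P \<in> CP M" and eq: "P vacuum = Q vacuum"
  shows "tau_equiv M `` {\<lambda>_. Q} \<in> CP_in_L2_tau M"
proof -
  have "tau_equiv M `` {\<lambda>_. Q} \<in> L2_tau M"
    unfolding L2_tau_def by (rule quotientI[OF tau_cauchy_const[OF Q]])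
  moreover have "P vacuum \<in> L2_tau_to_fock M (tau_equiv M `` {\<lambda>_. Q})"
    unfolding L2_tau_to_fock_def eq
  proof (intro CollectI conjI ballI)
    show "Q vacuum \<in> fock_space M" by (rule tame_vectors_sqnorm(1)[OF field_polynomials_tame[OF Q]])
    fix R assume "R \<in> tau_equiv M `` {\<lambda>_. Q}"
    then show "(\<lambda>n. fock_dist M (R n vacuum) (Q vacuum)) \<longlonglongrightarrow> 0"
      by (simp add: tau_equiv_def tau_dist_def fock_dist_commute)
  qed
  ultimately show ?thesis unfolding CP_in_L2_tau_def using P by blast
qed

text \<open>
  A Cauchy sequence is close to one of its members, that member to a linear combination of words, and the
  latter is the vector of a constant sequence.
\<close>

theorem CP_dense: "dense_in_L2_tau M (CP_in_L2_tau M)"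
  unfolding dense_in_L2_tau_def
proof (intro conjI ballI allI impI)
  show "CP_in_L2_tau M \<subseteq> L2_tau M" by (auto simp: CP_in_L2_tau_def)
  fix U and \<epsilon> :: real assume "U \<in> L2_tau M" and \<epsilon>: "0 < \<epsilon>"
  then obtain P where P: "P \<in> tau_cauchy M" and U: "U = tau_equiv M `` {P}"
    unfolding L2_tau_def by (auto elim: quotientE)
  have "0 < \<epsilon> / 3" using \<epsilon> by simp
  then obtain N where N: "\<And>m n. N \<le> m \<Longrightarrow> N \<le> n \<Longrightarrow> tau_dist M (P m) (P n) < \<epsilon> / 3"
    using P unfolding tau_cauchy_def by blast
  have PN: "P N vacuum \<in> approximable" by (intro field_polynomials_vacuum tau_cauchyD P)
  obtain G where G: "G \<in> word_span" "sqnorm M (\<lambda>m y. P N vacuum m y - G m y) \<le> ennreal ((\<epsilon> / 3)\<^sup>2)"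
    using approximable_dense[OF PN, of "(\<epsilon> / 3)\<^sup>2"] \<epsilon> by auto
  obtain Q where Q: "Q \<in> field_polynomials M" "Q vacuum = G" using word_span_field_polynomial[OF G(1)] by blast
  obtain C where C: "C \<in> CP M" "C vacuum = G" using word_span_CP[OF G(1)] by blast
  have "fock_dist M (P N vacuum) G \<le> \<epsilon> / 3"
    by (rule fock_dist_le[OF approximable_tame[OF PN] word_span_tame[OF G(1)] _ G(2)]) (use \<epsilon> in simp)
  then have d: "tau_dist M (P N) Q \<le> \<epsilon> / 3" by (simp add: tau_dist_def Q(2))
  obtain r where r: "(\<lambda>n. tau_dist M (P n) Q) \<longlonglongrightarrow> r"
    using tau_dist_const_convergent[OF P Q(1)] by (auto simp: convergent_def)
  have "r \<le> 2 * \<epsilon> / 3"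
  proof (rule LIMSEQ_le_const2[OF r], intro exI allI impI)
    fix n assume "N \<le> n"
    then show "tau_dist M (P n) Q \<le> 2 * \<epsilon> / 3"
      using tau_dist_triangle[of "P n" "P N" Q] field_polynomials_tame tau_cauchyD[OF P] Q(1) N[of n N] d by fastforce
  qed
  moreover have "L2_tau_dist M U (tau_equiv M `` {\<lambda>_. Q}) = r"
    unfolding U by (rule L2_tau_dist_const[OF P Q(1) r])
  moreover have "tau_equiv M `` {\<lambda>_. Q} \<in> CP_in_L2_tau M"
    by (rule constant_class_in_CP[OF Q(1) C(1)]) (simp add: C Q)
  ultimately show "\<exists>V\<in>CP_in_L2_tau M. L2_tau_dist M U V < \<epsilon>" using \<epsilon> by (intro bexI) auto
qed

end

section \<open>The measure of the kernel product\<close>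

lemma kernel_product_fibred:
  fixes \<sigma> :: "'t::{second_countable_topology, t2_space} measure" and \<mu> :: "'t \<Rightarrow> real measure"
  assumes lc: "locally_compact_space (euclidean :: 't topology)"
    and sets_\<sigma>: "sets \<sigma> = sets borel"
    and finite: "\<And>K. compact K \<Longrightarrow> emeasure \<sigma> K < \<infinity>"
    and points: "\<And>t. emeasure \<sigma> {t} = 0"
    and \<mu>: "\<And>t. prob_space (\<mu> t)" "\<And>t. sets (\<mu> t) = sets borel"
      "\<And>A. A \<in> sets borel \<Longrightarrow> (\<lambda>t. emeasure (\<mu> t) A) \<in> borel_measurable borel"
    and bounded: "\<And>\<Delta>. \<Delta> \<in> relatively_compact_borel \<Longrightarrow> \<exists>R>0. \<forall>t\<in>\<Delta>. emeasure (\<mu> t) (- {-R..R}) = 0"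
  shows "fibred_measure (kernel_product \<sigma> \<mu>)"
proof
  let ?M = "kernel_product \<sigma> \<mu>"
  show sets_M: "sets ?M = sets borel"
    by (rule emeasure_kernel_product(1)[where B="{}"]) (simp_all add: sets_\<sigma> \<mu>)
  have M: "emeasure ?M B = (\<integral>\<^sup>+ t. emeasure (\<mu> t) {s. (t, s) \<in> B} \<partial>\<sigma>)" if "B \<in> sets borel" for B
    by (rule emeasure_kernel_product(2)) (simp_all add: sets_\<sigma> \<mu> that)
  have space_\<mu>: "space (\<mu> t) = UNIV" for t using sets_eq_imp_space_eq[OF \<mu>(2)[of t]] by simp
  have mass: "emeasure (\<mu> t) UNIV = 1" for t
    using prob_space.emeasure_space_1[OF \<mu>(1)[of t]] by (simp add: space_\<mu>)
  have cylinder: "emeasure ?M (K \<times> UNIV) = emeasure \<sigma> K" if K: "closed K" for K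
  proof -
    have "emeasure ?M (K \<times> UNIV) = (\<integral>\<^sup>+t. emeasure (\<mu> t) {s. (t, s) \<in> K \<times> UNIV} \<partial>\<sigma>)"
      using K by (intro M borel_closed closed_Times) auto
    also have "\<dots> = (\<integral>\<^sup>+t. indicator K t \<partial>\<sigma>)"
      by (intro nn_integral_cong) (auto simp: indicator_def mass)
    also have "\<dots> = emeasure \<sigma> K" using K by (simp add: sets_\<sigma> borel_closed)
    finally show ?thesis .
  qed
  show "locally_compact_space (euclidean :: 't topology)" by (rule lc)
  show "emeasure ?M (K \<times> UNIV) < \<infinity>" if "compact K" for K
    using that finite by (simp add: cylinder compact_imp_closed)
  show "AE z in ?M. fst z \<noteq> t" for t
  proof (rule AE_I)
    show "{z \<in> space ?M. \<not> fst z \<noteq> t} \<subseteq> {t} \<times> UNIV" by auto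
    show "emeasure ?M ({t} \<times> UNIV) = 0" by (simp add: cylinder points)
    show "{t} \<times> UNIV \<in> sets ?M" unfolding sets_M by (intro borel_closed closed_Times) auto
  qed
  fix K :: "'t set" assume K: "compact K"
  then have "K \<in> relatively_compact_borel"
    by (simp add: relatively_compact_borel_def compact_imp_closed borel_closed)
  then obtain R where R: "\<And>t. t \<in> K \<Longrightarrow> emeasure (\<mu> t) (- {-R..R}) = 0" using bounded by blast
  have "AE z in ?M. fst z \<in> K \<longrightarrow> \<bar>snd z\<bar> \<le> R"
  proof (rule AE_I)
    let ?N = "K \<times> (- {-R..R})"
    show "{z \<in> space ?M. \<not> (fst z \<in> K \<longrightarrow> \<bar>snd z\<bar> \<le> R)} \<subseteq> ?N" by auto
    have N: "?N \<in> sets borel"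
      unfolding borel_prod[symmetric] using K by (intro pair_measureI) (auto simp: compact_imp_closed borel_closed)
    then show "?N \<in> sets ?M" by (simp add: sets_M)
    have "emeasure ?M ?N = (\<integral>\<^sup>+t. emeasure (\<mu> t) {s. (t, s) \<in> ?N} \<partial>\<sigma>)" by (rule M[OF N])
    also have "\<dots> = (\<integral>\<^sup>+t. 0 \<partial>\<sigma>)"
    proof (intro nn_integral_cong)
      fix t
      have "{s. (t, s) \<in> ?N} = (if t \<in> K then - {-R..R} else {})" by auto
      then show "emeasure (\<mu> t) {s. (t, s) \<in> ?N} = 0" using R by simp
    qed
    finally show "emeasure ?M ?N = 0" by simp
  qed
  then show "\<exists>R. AE z in ?M. fst z \<in> K \<longrightarrow> \<bar>snd z\<bar> \<le> R" by blast
qed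

text \<open>
  The only subsets of a point are the empty set and the point itself, so no intermediate value is attained.
\<close>

lemma non_atomic_singleton:
  assumes "non_atomic \<sigma>" "sets \<sigma> = sets (borel :: 't::t1_space measure)"
  shows "emeasure \<sigma> {t} = 0"
proof (rule ccontr)
  assume "emeasure \<sigma> {t} \<noteq> 0"
  then have "0 < emeasure \<sigma> {t}" by (simp add: zero_less_iff_neq_zero)
  then obtain B where "B \<subseteq> {t}" "0 < emeasure \<sigma> B" "emeasure \<sigma> B < emeasure \<sigma> {t}"
    using assms unfolding non_atomic_def by (metis borel_singleton sets.empty_sets)
  then show False by (cases "B = {}") (auto dest: subset_singletonD)
qed

theorem proposition3p3:
  fixes \<sigma> :: "'t::{second_countable_topology, t2_space, perfect_space} measure"
    and \<mu> :: "'t \<Rightarrow> real measure"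
  assumes "locally_compact_space (euclidean :: 't topology)"
    and "radon_measure \<sigma>"
    and "non_atomic \<sigma>"
    and "\<And>O'. open O' \<Longrightarrow> O' \<noteq> {} \<Longrightarrow> 0 < emeasure \<sigma> O'"
    and "\<And>t. prob_space (\<mu> t)"
    and "\<And>t. sets (\<mu> t) = sets borel"
    and "\<And>A. A \<in> sets borel \<Longrightarrow> (\<lambda>t. emeasure (\<mu> t) A) \<in> borel_measurable borel"
    and "\<And>\<Delta>. \<Delta> \<in> relatively_compact_borel \<Longrightarrow>
           \<exists>R>0. \<forall>t\<in>\<Delta>. emeasure (\<mu> t) (- {-R..R}) = 0"
  shows "dense_in_L2_tau (kernel_product \<sigma> \<mu>) (CP_in_L2_tau (kernel_product \<sigma> \<mu>))"
proof -
  have \<sigma>: "sets \<sigma> = sets borel" "\<And>K. compact K \<Longrightarrow> emeasure \<sigma> K < \<infinity>"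
    using assms(2) by (auto simp: radon_measure_def)
  interpret fibred_measure "kernel_product \<sigma> \<mu>"
    by (rule kernel_product_fibred[OF assms(1) \<sigma> non_atomic_singleton[OF assms(3) \<sigma>(1)] assms(5-8)])
  show ?thesis by (rule CP_dense)
qed

end
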